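(* Let $(\omega,N,\phi)$ be a pseudo-symplectic Nijenhuis structure on a $C^\infty$-manifold $M$, let $\pi$ be the nondegenerate $2$-vector field corresponding to $\omega$, and let $\pi_N$ be the $2$-vector field $\pi_N(\alpha,\beta)=\langle N\pi^\sharp\alpha,\beta\rangle$. Then $(\pi_N,\phi)$ is a twisted Poisson structure, i.e. $$\tfrac12[\pi_N,\pi_N]=\pi_N^\sharp\phi,\qquad d\phi=0.$$
   Context: Notation: $\Omega^1(M)$ denotes the one-forms, $\mathfrak{X}^*(M)=\Gamma(\Lambda^*TM)$, $\mathfrak X(M)=\mathfrak X^1(M)$; $\langle\cdot,\cdot\rangle$ is the pairing of vectors and covectors; $\mathcal L$ is the usual Lie derivative. For a $2$-vector field $\pi$, $\pi^\sharp:T^*M\to TM$ is defined by $\langle\pi^\sharp\alpha,\beta\rangle=\pi(\alpha,\beta)$, and $\pi^\sharp$ is extended to $\Lambda^3T^*M\to\Lambda^3TM$ by $\pi^\sharp(\alpha\wedge\beta\wedge\gamma)=\pi^\sharp\alpha\wedge\pi^\sharp\beta\wedge\pi^\sharp\gamma$; equivalently $(\pi^\sharp\phi)(\alpha,\beta,\gamma)=-\phi(\pi^\sharp\alpha,\pi^\sharp\beta,\pi^\sharp\gamma)$. The nondegenerate $2$-vector field $\pi$ corresponding to a nondegenerate $2$-form $\omega$ is the one with $\omega(\pi^\sharp\alpha,\pi^\sharp\beta)=\pi(\alpha,\beta)$, i.e. $\omega^\flat=-(\pi^\sharp)^{-1}$ where $\langle\omega^\flat X,Y\rangle=\omega(X,Y)$.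 A $(1,1)$-tensor $N$ is viewed as a bundle map $N:TM\to TM$ with dual $N^*:T^*M\to T^*M$. $[\cdot,\cdot]$ on $\mathfrak X^*(M)$ is the usual Schouten bracket: bilinear of degree $-1$, $[f,g]=0$, $[X,f]=Xf$, the Lie bracket on vector fields, $[D_1,D_2\wedge D_3]=[D_1,D_2]\wedge D_3+(-1)^{(\deg D_1+1)\deg D_2}D_2\wedge[D_1,D_3]$, $[D_1,D_2]=-(-1)^{(\deg D_1-1)(\deg D_2-1)}[D_2,D_1]$. For $X,Y\in\mathfrak X(M)$ put $[X,Y]_N=[NX,Y]+[X,NY]-N[X,Y]$; $N$ is a Nijenhuis structure if $[NX,NY]=N[X,Y]_N$ for all $X,Y$. For $\alpha,\beta\in\Omega^1(M)$ put $[\alpha,\beta]_\pi=\mathcal L_{\pi^\sharp\alpha}\beta-\mathcal L_{\pi^\sharp\beta}\alpha-d\langle\pi^\sharp\alpha,\beta\rangle$; $\pi$ and $N$ are compatible if $N\circ\pi^\sharp=\pi^\sharp\circ N^*$ (so that $\pi_N$ is indeed skew-symmetric) and for all $\alpha,\beta\in\Omega^1(M)$ $$\mathcal L_{N\pi^\sharp\alpha}\beta-\mathcal L_{N\pi^\sharp\beta}\alpha-d\langle N\pi^\sharp\alpha,\beta\rangle=[N^*\alpha,\beta]_\pi+[\alpha,N^*\beta]_\pi-N^*[\alpha,\beta]_\pi.$$ A pseudo-symplectic Nijenhuis structure on $M$ is a triple $(\omega,N,\phi)$ where $\omega$ is a nondegenerate $2$-form, $N$ is a Nijenhuis structure compatible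 with the nondegenerate $2$-vector field $\pi$ corresponding to $\omega$, and $\phi$ is a closed $3$-form, such that $\iota_{X\wedge Y}d\omega=N^*\iota_{X\wedge Y}\phi$ for all $X,Y\in\mathfrak X(M)$, where $\iota_{X\wedge Y}=\iota_Y\iota_X$ (i.e. $d\omega(X,Y,Z)=\phi(X,Y,NZ)$). *)

theory Defs
  imports "HOL-Analysis.Analysis" "HOL-Combinatorics.Permutations"
begin

section \<open>Smooth manifolds\<close>

text \<open>
  Smoothness on an open set \<open>S\<close> of a finite-dimensional space, by iterated directional
  derivatives.
\<close>

primrec Ck_on :: "nat \<Rightarrow> 'a::real_normed_vector set \<Rightarrow> ('a \<Rightarrow> 'b::real_normed_vector) \<Rightarrow> bool" where
  "Ck_on 0 S f \<longleftrightarrow> continuous_on S f"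
| "Ck_on (Suc k) S f \<longleftrightarrow>
     (\<forall>x\<in>S. f differentiable (at x)) \<and> (\<forall>v. Ck_on k S (\<lambda>x. frechet_derivative f (at x) v))"

definition smooth_on :: "'a::real_normed_vector set \<Rightarrow> ('a \<Rightarrow> 'b::real_normed_vector) \<Rightarrow> bool" where
  "smooth_on S f \<longleftrightarrow> (\<forall>k. Ck_on k S f)"

text \<open>
  The manifold is the whole type \<open>'m\<close>; a chart is a pair of a domain and a coordinate map.
  The model space is a finite-dimensional real inner product space, that is, some \<open>\<real>\<^sup>n\<close>. The class
  \<open>euclidean_space\<close> is not used because it excludes the case \<open>n = 0\<close>; the sort constraints
  \<open>banach\<close> and \<open>heine_borel\<close> hold automatically in finite dimension.
\<close>

type_synonym ('m, 'e) atlas = "('m set \<times> ('m \<Rightarrow> 'e)) set"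

definition smooth_atlas ::
  "('m::{t2_space,second_countable_topology}, 'e::{real_inner,banach,heine_borel}) atlas \<Rightarrow> bool" where
  "smooth_atlas A \<longleftrightarrow>
     (\<exists>B::'e set. finite B \<and> span B = UNIV) \<and>
     (\<Union>(U, \<phi>)\<in>A. U) = UNIV \<and>
     (\<forall>(U, \<phi>)\<in>A. open U \<and> open (\<phi> ` U) \<and> homeomorphism U (\<phi> ` U) \<phi> (inv_into U \<phi>)) \<and>
     (\<forall>(U, \<phi>)\<in>A. \<forall>(V, \<psi>)\<in>A. smooth_on (\<phi> ` (U \<inter> V)) (\<psi> \<circ> inv_into U \<phi>))"

definition smooth_funs :: "('m, 'e::real_normed_vector) atlas \<Rightarrow> ('m \<Rightarrow> real) set" where
  "smooth_funs A = {f. \<forall>(U, \<phi>)\<in>A. smooth_on (\<phi> ` U) (f \<circ> inv_into U \<phi>)}"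


section \<open>Multilinear algebra over subspaces of function spaces\<close>

text \<open>
  Tangent spaces are linear subspaces \<open>V\<close> of a space of real functions, and so are their duals.
  All functionals on \<open>V\<close> are set to zero outside their domain, so that equality of
  functionals on \<open>V\<close> is equality of HOL functions.
\<close>

definition dual_space :: "('b \<Rightarrow> real) set \<Rightarrow> (('b \<Rightarrow> real) \<Rightarrow> real) set" where
  "dual_space V = {\<alpha>.
     (\<forall>u. u \<notin> V \<longrightarrow> \<alpha> u = 0) \<and>
     (\<forall>u\<in>V. \<forall>w\<in>V. \<alpha> (\<lambda>x. u x + w x) = \<alpha> u + \<alpha> w) \<and>
     (\<forall>c. \<forall>u\<in>V. \<alpha> (\<lambda>x. c * u x) = c * \<alpha> u)}"

text \<open>Alternating \<open>k\<close>-linear forms on \<open>V\<close>; the arguments are given as a list of length \<open>k\<close>.\<close>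

definition alternating_forms :: "nat \<Rightarrow> ('b \<Rightarrow> real) set \<Rightarrow> (('b \<Rightarrow> real) list \<Rightarrow> real) set" where
  "alternating_forms k V = {T.
     (\<forall>us. \<not> (length us = k \<and> set us \<subseteq> V) \<longrightarrow> T us = 0) \<and>
     (\<forall>us i u w. length us = k \<and> set us \<subseteq> V \<and> i < k \<and> u \<in> V \<and> w \<in> V \<longrightarrow>
        T (us[i := (\<lambda>x. u x + w x)]) = T (us[i := u]) + T (us[i := w])) \<and>
     (\<forall>us i c u. length us = k \<and> set us \<subseteq> V \<and> i < k \<and> u \<in> V \<longrightarrow>
        T (us[i := (\<lambda>x. c * u x)]) = c * T (us[i := u])) \<and>
     (\<forall>us i j. length us = k \<and> set us \<subseteq> V \<and> i < j \<and> j < k \<and> us ! i = us ! j \<longrightarrow> T us = 0)}"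

definition nondegenerate_on :: "('b \<Rightarrow> real) set \<Rightarrow> (('b \<Rightarrow> real) list \<Rightarrow> real) \<Rightarrow> bool" where
  "nondegenerate_on V T \<longleftrightarrow> (\<forall>u\<in>V. (\<forall>w\<in>V. T [u, w] = 0) \<longrightarrow> u = (\<lambda>_. 0))"


section \<open>Tensor fields\<close>

type_synonym 'm tvec = "('m \<Rightarrow> real) \<Rightarrow> real"
type_synonym 'm covec = "'m tvec \<Rightarrow> real"
type_synonym 'm vfield = "'m \<Rightarrow> 'm tvec"
type_synonym 'm one_form = "'m \<Rightarrow> 'm covec"
type_synonym 'm form = "'m \<Rightarrow> 'm tvec list \<Rightarrow> real"
type_synonym 'm mvfield = "'m \<Rightarrow> 'm covec list \<Rightarrow> real"
type_synonym 'm tensor11 = "'m \<Rightarrow> 'm tvec \<Rightarrow> 'm tvec"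

text \<open>Tangent vectors at \<open>p\<close> are the derivations at \<open>p\<close> of the algebra of smooth functions.\<close>

definition tangent_space :: "('m, 'e::real_normed_vector) atlas \<Rightarrow> 'm \<Rightarrow> 'm tvec set" where
  "tangent_space A p = {v.
     (\<forall>f. f \<notin> smooth_funs A \<longrightarrow> v f = 0) \<and>
     (\<forall>f\<in>smooth_funs A. \<forall>g\<in>smooth_funs A. v (\<lambda>x. f x + g x) = v f + v g) \<and>
     (\<forall>c. \<forall>f\<in>smooth_funs A. v (\<lambda>x. c * f x) = c * v f) \<and>
     (\<forall>f\<in>smooth_funs A. \<forall>g\<in>smooth_funs A. v (\<lambda>x. f x * g x) = f p * v g + g p * v f)}"

definition cotangent_space :: "('m, 'e::real_normed_vector) atlas \<Rightarrow> 'm \<Rightarrow> 'm covec set" where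
  "cotangent_space A p = dual_space (tangent_space A p)"

definition vector_fields :: "('m, 'e::real_normed_vector) atlas \<Rightarrow> 'm vfield set" where
  "vector_fields A = {X. (\<forall>p. X p \<in> tangent_space A p) \<and>
     (\<forall>f\<in>smooth_funs A. (\<lambda>p. X p f) \<in> smooth_funs A)}"

definition one_forms :: "('m, 'e::real_normed_vector) atlas \<Rightarrow> 'm one_form set" where
  "one_forms A = {\<alpha>. (\<forall>p. \<alpha> p \<in> cotangent_space A p) \<and>
     (\<forall>X\<in>vector_fields A. (\<lambda>p. \<alpha> p (X p)) \<in> smooth_funs A)}"

definition k_forms :: "('m, 'e::real_normed_vector) atlas \<Rightarrow> nat \<Rightarrow> 'm form set" where
  "k_forms A k = {\<omega>. (\<forall>p. \<omega> p \<in> alternating_forms k (tangent_space A p)) \<and>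
     (\<forall>Xs. length Xs = k \<and> set Xs \<subseteq> vector_fields A \<longrightarrow>
        (\<lambda>p. \<omega> p (map (\<lambda>X. X p) Xs)) \<in> smooth_funs A)}"

text \<open>
  Sections of \<open>\<Lambda>\<^sup>k TM\<close>, seen as alternating forms on covectors: the value of
  \<open>X\<^sub>1 \<and> \<dots> \<and> X\<^sub>k\<close> on \<open>\<alpha>\<^sub>1, \<dots>, \<alpha>\<^sub>k\<close> is the determinant of \<open>\<langle>X\<^sub>i, \<alpha>\<^sub>j\<rangle>\<close>.
\<close>

definition k_vector_fields :: "('m, 'e::real_normed_vector) atlas \<Rightarrow> nat \<Rightarrow> 'm mvfield set" where
  "k_vector_fields A k = {P. (\<forall>p. P p \<in> alternating_forms k (cotangent_space A p)) \<and>
     (\<forall>\<alpha>s. length \<alpha>s = k \<and> set \<alpha>s \<subseteq> one_forms A \<longrightarrow>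
        (\<lambda>p. P p (map (\<lambda>\<alpha>. \<alpha> p) \<alpha>s)) \<in> smooth_funs A)}"

text \<open>Bundle maps \<open>TM \<rightarrow> TM\<close> over the identity; their values outside \<open>TM\<close> are irrelevant.\<close>

definition tensors11 :: "('m, 'e::real_normed_vector) atlas \<Rightarrow> 'm tensor11 set" where
  "tensors11 A = {N.
     (\<forall>p. \<forall>u\<in>tangent_space A p. N p u \<in> tangent_space A p) \<and>
     (\<forall>p. \<forall>u\<in>tangent_space A p. \<forall>w\<in>tangent_space A p.
        N p (\<lambda>f. u f + w f) = (\<lambda>f. N p u f + N p w f)) \<and>
     (\<forall>p c. \<forall>u\<in>tangent_space A p. N p (\<lambda>f. c * u f) = (\<lambda>f. c * N p u f)) \<and>
     (\<forall>X\<in>vector_fields A. (\<lambda>p. N p (X p)) \<in> vector_fields A)}"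

definition dual_map ::
  "('m, 'e::real_normed_vector) atlas \<Rightarrow> 'm tensor11 \<Rightarrow> 'm \<Rightarrow> 'm covec \<Rightarrow> 'm covec" where
  "dual_map A N p \<alpha> = (\<lambda>u. if u \<in> tangent_space A p then \<alpha> (N p u) else 0)"


section \<open>Lie bracket, Lie derivative and exterior derivative\<close>

definition lie_bracket :: "'m vfield \<Rightarrow> 'm vfield \<Rightarrow> 'm vfield" where
  "lie_bracket X Y = (\<lambda>p f. X p (\<lambda>q. Y q f) - Y p (\<lambda>q. X q f))"

text \<open>\<open>lie_derivative X \<beta> Y\<close> is the function \<open>(\<L>\<^sub>X \<beta>)(Y) = X(\<beta>(Y)) - \<beta>([X,Y])\<close>.\<close>

definition lie_derivative :: "'m vfield \<Rightarrow> 'm one_form \<Rightarrow> 'm vfield \<Rightarrow> 'm \<Rightarrow> real" where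
  "lie_derivative X \<beta> Y = (\<lambda>p. X p (\<lambda>q. \<beta> q (Y q)) - \<beta> p (lie_bracket X Y p))"

text \<open>
  \<open>ext_deriv \<omega> [X\<^sub>0, \<dots>, X\<^sub>k]\<close> is the function \<open>d\<omega>(X\<^sub>0, \<dots>, X\<^sub>k)\<close>, for a \<open>k\<close>-form \<open>\<omega>\<close>:
  \<open>\<Sum>\<^sub>i (-1)\<^sup>i X\<^sub>i(\<omega>(\<dots> omit i \<dots>)) + \<Sum>\<^sub>i\<^sub><\<^sub>j (-1)\<^sup>i\<^sup>+\<^sup>j \<omega>([X\<^sub>i,X\<^sub>j], \<dots> omit i, j \<dots>)\<close>.
\<close>

definition ext_deriv :: "'m form \<Rightarrow> 'm vfield list \<Rightarrow> 'm \<Rightarrow> real" where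
  "ext_deriv \<omega> Xs = (\<lambda>p.
     (\<Sum>i<length Xs. (-1) ^ i * (Xs ! i) p (\<lambda>q. \<omega> q (map (\<lambda>X. X q) (nths Xs (- {i}))))) +
     (\<Sum>j<length Xs. \<Sum>i<j. (-1) ^ (i + j) *
        \<omega> p (map (\<lambda>X. X p) (lie_bracket (Xs ! i) (Xs ! j) # nths Xs (- {i, j})))))"

definition closed_form :: "('m, 'e::real_normed_vector) atlas \<Rightarrow> nat \<Rightarrow> 'm form \<Rightarrow> bool" where
  "closed_form A k \<phi> \<longleftrightarrow> \<phi> \<in> k_forms A k \<and>
     (\<forall>Xs. length Xs = Suc k \<and> set Xs \<subseteq> vector_fields A \<longrightarrow> ext_deriv \<phi> Xs = (\<lambda>_. 0))"


section \<open>The Schouten bracket\<close>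

definition wedge :: "nat \<Rightarrow> nat \<Rightarrow> 'm mvfield \<Rightarrow> 'm mvfield \<Rightarrow> 'm mvfield" where
  "wedge k l P Q = (\<lambda>p \<alpha>s. if length \<alpha>s = k + l then
     (\<Sum>\<sigma> | \<sigma> permutes {..<k + l}. of_int (sign \<sigma>) *
        P p (map (\<lambda>i. \<alpha>s ! \<sigma> i) [0..<k]) * Q p (map (\<lambda>i. \<alpha>s ! \<sigma> i) [k..<k + l]))
     / (fact k * fact l) else 0)"

text \<open>Functions and vector fields as multivector fields of degree \<open>0\<close> and \<open>1\<close>.\<close>

definition mv_fun :: "('m \<Rightarrow> real) \<Rightarrow> 'm mvfield" where
  "mv_fun f = (\<lambda>p \<alpha>s. if \<alpha>s = [] then f p else 0)"

definition mv_vec :: "('m, 'e::real_normed_vector) atlas \<Rightarrow> 'm vfield \<Rightarrow> 'm mvfield" where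
  "mv_vec A X = (\<lambda>p \<alpha>s. if length \<alpha>s = 1 \<and> set \<alpha>s \<subseteq> cotangent_space A p
     then (\<alpha>s ! 0) (X p) else 0)"

text \<open>
  \<open>B k l P Q\<close> is the bracket of \<open>P\<close> of degree \<open>k\<close> and \<open>Q\<close> of degree \<open>l\<close>. These axioms
  determine the Schouten bracket uniquely. The degree \<open>k + l - 1\<close> is truncated to \<open>0\<close>
  for \<open>k = l = 0\<close>, where the bracket vanishes.
  The exponent \<open>(k + 1) * (l + 1)\<close> has the parity of \<open>(k - 1)(l - 1)\<close>.
\<close>

definition schouten_bracket :: "('m, 'e::real_normed_vector) atlas \<Rightarrow>
    (nat \<Rightarrow> nat \<Rightarrow> 'm mvfield \<Rightarrow> 'm mvfield \<Rightarrow> 'm mvfield) \<Rightarrow> bool" where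
  "schouten_bracket A B \<longleftrightarrow>
     (\<forall>k l. \<forall>P\<in>k_vector_fields A k. \<forall>Q\<in>k_vector_fields A l.
        B k l P Q \<in> k_vector_fields A (k + l - 1)) \<and>
     (\<forall>k l. \<forall>P\<in>k_vector_fields A k. \<forall>P'\<in>k_vector_fields A k. \<forall>Q\<in>k_vector_fields A l.
        B k l (\<lambda>p \<alpha>s. P p \<alpha>s + P' p \<alpha>s) Q = (\<lambda>p \<alpha>s. B k l P Q p \<alpha>s + B k l P' Q p \<alpha>s)) \<and>
     (\<forall>k l. \<forall>P\<in>k_vector_fields A k. \<forall>Q\<in>k_vector_fields A l. \<forall>Q'\<in>k_vector_fields A l.
        B k l P (\<lambda>p \<alpha>s. Q p \<alpha>s + Q' p \<alpha>s) = (\<lambda>p \<alpha>s. B k l P Q p \<alpha>s + B k l P Q' p \<alpha>s)) \<and>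
     (\<forall>k l c. \<forall>P\<in>k_vector_fields A k. \<forall>Q\<in>k_vector_fields A l.
        B k l (\<lambda>p \<alpha>s. c * P p \<alpha>s) Q = (\<lambda>p \<alpha>s. c * B k l P Q p \<alpha>s) \<and>
        B k l P (\<lambda>p \<alpha>s. c * Q p \<alpha>s) = (\<lambda>p \<alpha>s. c * B k l P Q p \<alpha>s)) \<and>
     (\<forall>f\<in>smooth_funs A. \<forall>g\<in>smooth_funs A. B 0 0 (mv_fun f) (mv_fun g) = (\<lambda>p \<alpha>s. 0)) \<and>
     (\<forall>X\<in>vector_fields A. \<forall>f\<in>smooth_funs A.
        B 1 0 (mv_vec A X) (mv_fun f) = mv_fun (\<lambda>p. X p f)) \<and>
     (\<forall>X\<in>vector_fields A. \<forall>Y\<in>vector_fields A.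
        B 1 1 (mv_vec A X) (mv_vec A Y) = mv_vec A (lie_bracket X Y)) \<and>
     (\<forall>k l m. \<forall>P\<in>k_vector_fields A k. \<forall>Q\<in>k_vector_fields A l. \<forall>R\<in>k_vector_fields A m.
        B k (l + m) P (wedge l m Q R) = (\<lambda>p \<alpha>s.
          wedge (k + l - 1) m (B k l P Q) R p \<alpha>s +
          (-1) ^ ((k + 1) * l) * wedge l (k + m - 1) Q (B k m P R) p \<alpha>s)) \<and>
     (\<forall>k l. \<forall>P\<in>k_vector_fields A k. \<forall>Q\<in>k_vector_fields A l.
        B k l P Q = (\<lambda>p \<alpha>s. - ((-1) ^ ((k + 1) * (l + 1))) * B l k Q P p \<alpha>s))"


section \<open>Twisted Poisson and pseudo-symplectic Nijenhuis structures\<close>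

text \<open>\<open>\<pi>\<^sup>\<sharp> \<alpha>\<close> is the tangent vector with \<open>\<langle>\<pi>\<^sup>\<sharp> \<alpha>, \<beta>\<rangle> = \<pi>(\<alpha>, \<beta>)\<close> for all covectors \<open>\<beta>\<close> at \<open>p\<close>.\<close>

definition sharp ::
  "('m, 'e::real_normed_vector) atlas \<Rightarrow> 'm mvfield \<Rightarrow> 'm \<Rightarrow> 'm covec \<Rightarrow> 'm tvec" where
  "sharp A \<pi> p \<alpha> = (THE v. v \<in> tangent_space A p \<and>
     (\<forall>\<beta>\<in>cotangent_space A p. \<beta> v = \<pi> p [\<alpha>, \<beta>]))"

text \<open>
  Extension to 3-forms by \<open>\<pi>\<^sup>\<sharp>(\<alpha>\<and>\<beta>\<and>\<gamma>) = \<pi>\<^sup>\<sharp>\<alpha> \<and> \<pi>\<^sup>\<sharp>\<beta> \<and> \<pi>\<^sup>\<sharp>\<gamma>\<close>; the sign comes from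
  \<open>\<langle>\<pi>\<^sup>\<sharp>\<alpha>, \<beta>\<rangle> = - \<langle>\<pi>\<^sup>\<sharp>\<beta>, \<alpha>\<rangle>\<close> in each of the three arguments.
\<close>

definition sharp3 ::
  "('m, 'e::real_normed_vector) atlas \<Rightarrow> 'm mvfield \<Rightarrow> 'm form \<Rightarrow> 'm mvfield" where
  "sharp3 A \<pi> \<phi> = (\<lambda>p \<alpha>s. if length \<alpha>s = 3 \<and> set \<alpha>s \<subseteq> cotangent_space A p
     then - \<phi> p (map (sharp A \<pi> p) \<alpha>s) else 0)"

definition twisted_poisson :: "('m, 'e::real_normed_vector) atlas \<Rightarrow>
    (nat \<Rightarrow> nat \<Rightarrow> 'm mvfield \<Rightarrow> 'm mvfield \<Rightarrow> 'm mvfield) \<Rightarrow> 'm mvfield \<Rightarrow> 'm form \<Rightarrow> bool" where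
  "twisted_poisson A B \<pi> \<phi> \<longleftrightarrow>
     \<pi> \<in> k_vector_fields A 2 \<and> \<phi> \<in> k_forms A 3 \<and>
     (\<lambda>p \<alpha>s. 1/2 * B 2 2 \<pi> \<pi> p \<alpha>s) = sharp3 A \<pi> \<phi> \<and>
     closed_form A 3 \<phi>"

definition nondegenerate_2form :: "('m, 'e::real_normed_vector) atlas \<Rightarrow> 'm form \<Rightarrow> bool" where
  "nondegenerate_2form A \<omega> \<longleftrightarrow> \<omega> \<in> k_forms A 2 \<and> (\<forall>p. nondegenerate_on (tangent_space A p) (\<omega> p))"

definition nondegenerate_2vector :: "('m, 'e::real_normed_vector) atlas \<Rightarrow> 'm mvfield \<Rightarrow> bool" where
  "nondegenerate_2vector A \<pi> \<longleftrightarrow>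
     \<pi> \<in> k_vector_fields A 2 \<and> (\<forall>p. nondegenerate_on (cotangent_space A p) (\<pi> p))"

definition corresponding_2vector ::
  "('m, 'e::real_normed_vector) atlas \<Rightarrow> 'm form \<Rightarrow> 'm mvfield \<Rightarrow> bool" where
  "corresponding_2vector A \<omega> \<pi> \<longleftrightarrow> nondegenerate_2vector A \<pi> \<and>
     (\<forall>p. \<forall>\<alpha>\<in>cotangent_space A p. \<forall>\<beta>\<in>cotangent_space A p.
        \<omega> p [sharp A \<pi> p \<alpha>, sharp A \<pi> p \<beta>] = \<pi> p [\<alpha>, \<beta>])"

definition nijenhuis_bracket :: "'m tensor11 \<Rightarrow> 'm vfield \<Rightarrow> 'm vfield \<Rightarrow> 'm vfield" where
  "nijenhuis_bracket N X Y = (\<lambda>p f.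
     lie_bracket (\<lambda>q. N q (X q)) Y p f + lie_bracket X (\<lambda>q. N q (Y q)) p f
     - N p (lie_bracket X Y p) f)"

definition nijenhuis_structure :: "('m, 'e::real_normed_vector) atlas \<Rightarrow> 'm tensor11 \<Rightarrow> bool" where
  "nijenhuis_structure A N \<longleftrightarrow> N \<in> tensors11 A \<and>
     (\<forall>X\<in>vector_fields A. \<forall>Y\<in>vector_fields A.
        lie_bracket (\<lambda>p. N p (X p)) (\<lambda>p. N p (Y p)) = (\<lambda>p. N p (nijenhuis_bracket N X Y p)))"

text \<open>
  For a bundle map \<open>S : T\<^sup>*M \<rightarrow> TM\<close>, \<open>form_bracket S \<alpha> \<beta> Y\<close> is the value on \<open>Y\<close> of the 1-form
  \<open>\<L>\<^bsub>S\<alpha>\<^esub> \<beta> - \<L>\<^bsub>S\<beta>\<^esub> \<alpha> - d\<langle>S\<alpha>, \<beta>\<rangle>\<close>; for \<open>S = \<pi>\<^sup>\<sharp>\<close> this is \<open>[\<alpha>, \<beta>]\<^sub>\<pi>\<close>.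
\<close>

definition form_bracket ::
  "('m \<Rightarrow> 'm covec \<Rightarrow> 'm tvec) \<Rightarrow> 'm one_form \<Rightarrow> 'm one_form \<Rightarrow> 'm vfield \<Rightarrow> 'm \<Rightarrow> real" where
  "form_bracket S \<alpha> \<beta> Y = (\<lambda>p.
     lie_derivative (\<lambda>q. S q (\<alpha> q)) \<beta> Y p - lie_derivative (\<lambda>q. S q (\<beta> q)) \<alpha> Y p
     - Y p (\<lambda>q. \<beta> q (S q (\<alpha> q))))"

definition compatible ::
  "('m, 'e::real_normed_vector) atlas \<Rightarrow> 'm mvfield \<Rightarrow> 'm tensor11 \<Rightarrow> bool" where
  "compatible A \<pi> N \<longleftrightarrow>
     (\<forall>p. \<forall>\<alpha>\<in>cotangent_space A p. N p (sharp A \<pi> p \<alpha>) = sharp A \<pi> p (dual_map A N p \<alpha>)) \<and>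
     (\<forall>\<alpha>\<in>one_forms A. \<forall>\<beta>\<in>one_forms A. \<forall>Y\<in>vector_fields A.
        form_bracket (\<lambda>p \<xi>. N p (sharp A \<pi> p \<xi>)) \<alpha> \<beta> Y = (\<lambda>p.
          form_bracket (sharp A \<pi>) (\<lambda>q. dual_map A N q (\<alpha> q)) \<beta> Y p
          + form_bracket (sharp A \<pi>) \<alpha> (\<lambda>q. dual_map A N q (\<beta> q)) Y p
          - form_bracket (sharp A \<pi>) \<alpha> \<beta> (\<lambda>q. N q (Y q)) p))"

definition pseudo_symplectic_nijenhuis ::
  "('m, 'e::real_normed_vector) atlas \<Rightarrow> 'm form \<Rightarrow> 'm tensor11 \<Rightarrow> 'm form \<Rightarrow> bool" where
  "pseudo_symplectic_nijenhuis A \<omega> N \<phi> \<longleftrightarrow>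
     nondegenerate_2form A \<omega> \<and>
     nijenhuis_structure A N \<and>
     (\<exists>\<pi>. corresponding_2vector A \<omega> \<pi> \<and> compatible A \<pi> N) \<and>
     closed_form A 3 \<phi> \<and>
     (\<forall>X\<in>vector_fields A. \<forall>Y\<in>vector_fields A. \<forall>Z\<in>vector_fields A.
        ext_deriv \<omega> [X, Y, Z] = (\<lambda>p. \<phi> p [X p, Y p, N p (Z p)]))"

definition pi_N ::
  "('m, 'e::real_normed_vector) atlas \<Rightarrow> 'm mvfield \<Rightarrow> 'm tensor11 \<Rightarrow> 'm mvfield" where
  "pi_N A \<pi> N = (\<lambda>p \<alpha>s. if length \<alpha>s = 2 \<and> set \<alpha>s \<subseteq> cotangent_space A p
     then (\<alpha>s ! 1) (N p (sharp A \<pi> p (\<alpha>s ! 0))) else 0)"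

end

theory Submission
  imports Defs
begin

text \<open>
  Write \<open>Y\<^sub>f = \<pi>\<^sup>\<sharp> df\<close> and \<open>{f, g} = \<pi>\<^sub>N(df, dg) = (N Y\<^sub>f) g\<close>. At a point every covector is the
  differential of a global smooth function, so both sides of the asserted equation are determined
  by their values on exact forms. This splits the theorem into two statements about functions.

  The first one concerns an arbitrary bivector field: half of the bracket \<open>[P, P]\<close>, evaluated on
  \<open>df, dg, dh\<close>, is minus the Jacobiator of \<open>P(df, dg)\<close> (\<open>schouten_eq_jac\<close>). The bracket is known by
  its axioms only. They determine it on wedge products of vector fields, where the formula is a
  polynomial identity, and they make it local: by the Leibniz rule a field \<open>h\<^sup>2 P\<close> with \<open>h(p) = 0\<close> does
  not contribute at \<open>p\<close>. It remains to write \<open>P\<close>, up to such a term, as a sum of wedge products of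
  global vector fields (\<open>bivector_decomposition\<close>). This rests on the fact that derivations at a point
  are combinations of coordinate derivatives, and so on bump functions and on a Taylor expansion with
  smooth coefficients (\<open>hadamard_expansion\<close>, \<open>cutoff_coordinate_frame\<close>).

  The second one is the identity \<open>{{f, g}, h} + cyclic = \<phi>(N Y\<^sub>f, N Y\<^sub>g, N Y\<^sub>h)\<close> (\<open>jacobiator_nham\<close>).
  The form \<open>\<phi>(X, Y, N Z) = d\<omega>(X, Y, Z)\<close> is alternating in \<open>X, Y, Z\<close>, so \<open>N\<close> can be moved between the
  arguments of \<open>\<phi>\<close>, and the right-hand side equals both \<open>d\<omega>(N Y\<^sub>f, N Y\<^sub>g, Y\<^sub>h)\<close> and
  \<open>d\<omega>(Y\<^sub>f, Y\<^sub>g, N\<^sup>2 Y\<^sub>h)\<close>. Expanding \<open>d\<omega>\<close> with \<open>\<omega>(Y\<^sub>f, Z) = - Z f\<close> leaves, besides derivatives of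
  functions, the fields \<open>N [N Y\<^sub>f, Y\<^sub>h]\<close> and \<open>N\<^sup>2 [Y\<^sub>f, Y\<^sub>g]\<close>. The vanishing torsion of \<open>N\<close> and the
  compatibility of \<open>\<pi>\<close> and \<open>N\<close>, applied to \<open>df\<close>, \<open>dg\<close> and \<open>N Y\<^sub>h\<close>, are linear relations between the
  same quantities, and the identity is a linear combination of the cyclic sums of all four.
\<close>

section \<open>Calculus of smooth functions\<close>

lemma Ck_on_cong:
  assumes "open S" "\<And>x. x \<in> S \<Longrightarrow> f x = g x" "Ck_on k S f"
  shows "Ck_on k S g"
  using assms(2,3)
proof (induction k arbitrary: f g)
  case 0
  then show ?case by (simp cong: continuous_on_cong)
next
  case (Suc k)
  have d: "(g has_derivative frechet_derivative f (at x)) (at x)" if "x \<in> S" for x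
  proof (rule has_derivative_transform_within_open[OF _ assms(1) that Suc.prems(1)])
    show "(f has_derivative frechet_derivative f (at x)) (at x)"
      using Suc.prems(2) that by (simp add: frechet_derivative_works)
  qed
  have eq: "frechet_derivative f (at x) v = frechet_derivative g (at x) v" if "x \<in> S" for x v
    using frechet_derivative_at[OF d[OF that]] by simp
  have "Ck_on k S (\<lambda>x. frechet_derivative g (at x) v)" for v
  proof (rule Suc.IH[rotated])
    show "Ck_on k S (\<lambda>x. frechet_derivative f (at x) v)" using Suc.prems(2) by simp
  qed (rule eq)
  then show ?case using d unfolding Ck_on.simps differentiable_def by blast
qed

text \<open>
  Any candidate for the derivative may be used: on an open set the Frechet derivative at each point
  is unique.
\<close>

lemma Ck_on_SucI:
  assumes "\<And>x. x \<in> S \<Longrightarrow> (f has_derivative f' x) (at x)"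
    and "\<And>v. Ck_on k S (\<lambda>x. f' x v)"
    and "open S"
  shows "Ck_on (Suc k) S f"
proof -
  have "f' x v = frechet_derivative f (at x) v" if "x \<in> S" for x v
    using assms(1)[OF that] by (simp add: frechet_derivative_at[symmetric])
  then have "Ck_on k S (\<lambda>x. frechet_derivative f (at x) v)" for v
    by (intro Ck_on_cong[OF assms(3) _ assms(2)])
  then show ?thesis using assms(1) unfolding Ck_on.simps differentiable_def by blast
qed

lemma Ck_on_SucD:
  assumes "Ck_on (Suc k) S f"
  shows "x \<in> S \<Longrightarrow> (f has_derivative frechet_derivative f (at x)) (at x)"
    and "Ck_on k S (\<lambda>x. frechet_derivative f (at x) v)"
  using assms by (auto simp: frechet_derivative_works)

lemma Ck_on_SucD': "Ck_on (Suc k) S f \<Longrightarrow> Ck_on k S f"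
proof (induction k arbitrary: f)
  case 0
  then show ?case
    by (auto intro!: continuous_at_imp_continuous_on differentiable_imp_continuous_within)
next
  case (Suc k)
  then have "\<forall>v. Ck_on k S (\<lambda>x. frechet_derivative f (at x) v)"
    using Ck_on_SucD(2) by blast
  then show ?case using Suc.prems by simp
qed

lemma Ck_on_subset: "Ck_on k S f \<Longrightarrow> T \<subseteq> S \<Longrightarrow> Ck_on k T f"
  by (induction k arbitrary: f) (auto intro: continuous_on_subset)

lemma Ck_on_local:
  assumes "\<And>x. x \<in> S \<Longrightarrow> \<exists>T. open T \<and> x \<in> T \<and> Ck_on k T f"
  shows "Ck_on k S f"
  using assms
proof (induction k arbitrary: f)
  case 0
  have "isCont f x" if "x \<in> S" for x
    using 0[OF that] by (auto simp: continuous_on_eq_continuous_at)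
  then show ?case by (simp add: continuous_at_imp_continuous_on)
next
  case (Suc k)
  have "f differentiable (at x)" if "x \<in> S" for x
    using Suc.prems[OF that] by auto
  moreover have "Ck_on k S (\<lambda>x. frechet_derivative f (at x) v)" for v
    using Suc.prems by (intro Suc.IH) (metis Ck_on.simps(2))
  ultimately show ?case by simp
qed

lemma Ck_on_const [simp]: "Ck_on k S (\<lambda>_. c)"
  by (induction k arbitrary: c) (auto simp: frechet_derivative_const)

lemma Ck_on_add:
  assumes "open S" "Ck_on k S f" "Ck_on k S g"
  shows "Ck_on k S (\<lambda>x. f x + g x)"
  using assms(2,3)
proof (induction k arbitrary: f g)
  case 0
  then show ?case by (auto intro: continuous_intros)
next
  case (Suc k)
  show ?case
  proof (rule Ck_on_SucI[OF _ _ assms(1)])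
    show "((\<lambda>x. f x + g x) has_derivative
        (\<lambda>v. frechet_derivative f (at x) v + frechet_derivative g (at x) v)) (at x)"
      if "x \<in> S" for x
      using Suc.prems[THEN Ck_on_SucD(1)] that by (intro has_derivative_add) auto
  qed (intro Suc.IH Suc.prems[THEN Ck_on_SucD(2)])
qed

lemma Ck_on_sum:
  assumes "open S" "\<And>i. i \<in> I \<Longrightarrow> Ck_on k S (f i)"
  shows "Ck_on k S (\<lambda>x. \<Sum>i\<in>I. f i x)"
  using assms(2) by (induction I rule: infinite_finite_induct) (auto intro: Ck_on_add[OF assms(1)])

lemma Ck_on_linear:
  assumes "open S" "bounded_linear L" "Ck_on k S f"
  shows "Ck_on k S (\<lambda>x. L (f x))"
  using assms(3)
proof (induction k arbitrary: f)
  case 0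
  then show ?case using bounded_linear.continuous_on[OF assms(2)] by auto
next
  case (Suc k)
  show ?case
  proof (rule Ck_on_SucI[OF _ _ assms(1)])
    show "((\<lambda>x. L (f x)) has_derivative (\<lambda>v. L (frechet_derivative f (at x) v))) (at x)"
      if "x \<in> S" for x
      using Suc.prems[THEN Ck_on_SucD(1), OF that] by (rule bounded_linear.has_derivative[OF assms(2)])
  qed (intro Suc.IH Suc.prems[THEN Ck_on_SucD(2)])
qed

lemma Ck_on_mult:
  fixes f g :: "'a::real_normed_vector \<Rightarrow> real"
  assumes "open S" "Ck_on k S f" "Ck_on k S g"
  shows "Ck_on k S (\<lambda>x. f x * g x)"
  using assms(2,3)
proof (induction k arbitrary: f g)
  case 0
  then show ?case by (auto intro: continuous_intros)
next
  case (Suc k)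
  note [simp] = Suc.prems[THEN Ck_on_SucD']
  show ?case
  proof (rule Ck_on_SucI[OF _ _ assms(1)])
    show "((\<lambda>x. f x * g x) has_derivative
        (\<lambda>v. f x * frechet_derivative g (at x) v + frechet_derivative f (at x) v * g x)) (at x)"
      if "x \<in> S" for x
      using Suc.prems[THEN Ck_on_SucD(1)] that by (intro has_derivative_mult) auto
  qed (auto intro!: Ck_on_add[OF assms(1)] Suc.IH Suc.prems[THEN Ck_on_SucD(2)])
qed

lemma Ck_on_ident: "Ck_on k S (\<lambda>x. x)"
  by (cases k) (auto simp: frechet_derivative_ident)

text \<open>
  The expansion of every vector, rather than spanning, is part of the definition because it is what
  coordinate computations use. The model space may have dimension \<open>0\<close>, where \<open>J\<close> is empty.
\<close>

definition orthonormal_basis :: "'a::real_inner set \<Rightarrow> bool" where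
  "orthonormal_basis J \<longleftrightarrow> finite J \<and> (\<forall>i\<in>J. \<forall>j\<in>J. i \<bullet> j = (if i = j then 1 else 0)) \<and>
     (\<forall>x. x = (\<Sum>j\<in>J. (x \<bullet> j) *\<^sub>R j))"

lemma orthonormal_basis_exists:
  fixes B :: "'a::real_inner set"
  assumes "finite B" "span B = UNIV"
  obtains J :: "'a set" where "orthonormal_basis J"
proof -
  obtain C where C: "finite C" "span C = (UNIV :: 'a set)" "pairwise orthogonal C"
    using basis_orthogonal[OF assms(1)] assms(2) by auto
  define J where "J = (\<lambda>x. x /\<^sub>R norm x) ` (C - {0})"
  have fin: "finite J" using C by (simp add: J_def)
  have ort: "i \<bullet> j = (if i = j then 1 else 0)" if "i \<in> J" "j \<in> J" for i j
  proof -
    obtain a b where ab: "a \<in> C" "b \<in> C" "a \<noteq> 0" "b \<noteq> 0" "i = a /\<^sub>R norm a" "j = b /\<^sub>R norm b"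
      using \<open>i \<in> J\<close> \<open>j \<in> J\<close> unfolding J_def by blast
    show ?thesis
    proof (cases "a = b")
      case True
      then show ?thesis using ab by (simp add: dot_square_norm power2_eq_square)
    next
      case False
      then have "a \<bullet> b = 0" using C(3) ab by (auto simp: pairwise_def orthogonal_def)
      then have "i \<bullet> j = 0" using ab by simp
      moreover have "i \<bullet> i = 1" using ab by (simp add: dot_square_norm power2_eq_square)
      ultimately show ?thesis by auto
    qed
  qed
  have "x = (\<Sum>j\<in>J. (x \<bullet> j) *\<^sub>R j)" for x
  proof -
    have "C \<subseteq> span J"
    proof
      fix a assume "a \<in> C"
      show "a \<in> span J"
      proof (cases "a = 0")
        case False
        then have "a /\<^sub>R norm a \<in> J" using \<open>a \<in> C\<close> by (auto simp: J_def)
        then have "norm a *\<^sub>R (a /\<^sub>R norm a) \<in> span J" by (intro span_scale span_base)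
        then show ?thesis using False by simp
      qed (simp add: span_zero)
    qed
    then have "span C \<subseteq> span J" by (simp add: span_minimal)
    then have "x \<in> span J" using C(2) by blast
    then obtain r where x: "x = (\<Sum>j\<in>J. r j *\<^sub>R j)" using span_finite[OF fin] by auto
    have "x \<bullet> j = r j" if "j \<in> J" for j
      using that fin by (simp add: x inner_sum_left ort if_distrib cong: if_cong sum.cong)
    then have "(\<Sum>j\<in>J. (x \<bullet> j) *\<^sub>R j) = (\<Sum>j\<in>J. r j *\<^sub>R j)" by (intro sum.cong) auto
    with x show ?thesis by (rule trans[OF _ sym])
  qed
  then show ?thesis using that[of J] fin ort unfolding orthonormal_basis_def by blast
qed

lemma orthonormal_basis_real: "orthonormal_basis {1::real}"
  by (auto simp: orthonormal_basis_def)

lemma linear_orthonormal_sum: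
  assumes "orthonormal_basis J" "linear L"
  shows "L v = (\<Sum>j\<in>J. (v \<bullet> j) *\<^sub>R L j)"
proof -
  have "v = (\<Sum>j\<in>J. (v \<bullet> j) *\<^sub>R j)" using assms(1) unfolding orthonormal_basis_def by blast
  then have "L v = L (\<Sum>j\<in>J. (v \<bullet> j) *\<^sub>R j)" by (rule arg_cong)
  also have "\<dots> = (\<Sum>j\<in>J. (v \<bullet> j) *\<^sub>R L j)"
    using assms(2) by (simp add: linear_sum linear_scale)
  finally show ?thesis .
qed

text \<open>
  The chain rule expands the derivative of the outer function along an orthonormal basis of the
  middle space, so that only products of \<open>C\<^sup>k\<close> functions are differentiated again.
\<close>

lemma Ck_on_compose:
  fixes f :: "'a::real_normed_vector \<Rightarrow> 'b::real_inner" and g :: "'b \<Rightarrow> real"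
    and J :: "'b set"
  assumes J: "orthonormal_basis J"
    and "open S" "Ck_on k S f" "Ck_on k T g" "f ` S \<subseteq> T"
  shows "Ck_on k S (\<lambda>x. g (f x))"
  using assms(3,4)
proof (induction k arbitrary: g)
  case 0
  then show ?case using assms(5) by (auto intro: continuous_on_compose2)
next
  case (Suc k)
  let ?D = "\<lambda>x v. \<Sum>j\<in>J. (frechet_derivative f (at x) v \<bullet> j) * frechet_derivative g (at (f x)) j"
  show ?case
  proof (rule Ck_on_SucI[OF _ _ assms(2)])
    fix x assume x: "x \<in> S"
    have g: "(g has_derivative frechet_derivative g (at (f x))) (at (f x))"
      using Ck_on_SucD(1)[OF Suc.prems(2)] x assms(5) by auto
    have "((\<lambda>x. g (f x)) has_derivative
        (\<lambda>v. frechet_derivative g (at (f x)) (frechet_derivative f (at x) v))) (at x)"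
      using has_derivative_compose[OF Ck_on_SucD(1)[OF Suc.prems(1) x] g] .
    moreover have "frechet_derivative g (at (f x)) (frechet_derivative f (at x) v) = ?D x v" for v
      using linear_orthonormal_sum[OF J has_derivative_linear[OF g],
          of "frechet_derivative f (at x) v"] unfolding real_scaleR_def .
    ultimately show "((\<lambda>x. g (f x)) has_derivative ?D x) (at x)" by simp
  next
    fix v
    show "Ck_on k S (\<lambda>x. ?D x v)"
      by (intro Ck_on_sum Ck_on_mult Suc.IH[OF _ Ck_on_SucD(2)[OF Suc.prems(2)]]
          Ck_on_linear[OF assms(2) bounded_linear_inner_left] assms(2)
          Ck_on_SucD(2)[OF Suc.prems(1)] Ck_on_SucD'[OF Suc.prems(1)])
  qed
qed

lemma smooth_on_frechet_derivative:
  assumes "smooth_on S f"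
  shows "smooth_on S (\<lambda>x. frechet_derivative f (at x) v)"
    and "x \<in> S \<Longrightarrow> (f has_derivative frechet_derivative f (at x)) (at x)"
  using assms Ck_on_SucD[of _ S f] unfolding smooth_on_def by blast+

lemma smooth_on_const [simp]: "smooth_on S (\<lambda>_. c)"
  by (simp add: smooth_on_def)

lemma smooth_on_ident: "smooth_on S (\<lambda>x. x)"
  by (simp add: smooth_on_def Ck_on_ident)

lemma smooth_on_subset: "smooth_on S f \<Longrightarrow> T \<subseteq> S \<Longrightarrow> smooth_on T f"
  by (auto simp: smooth_on_def intro: Ck_on_subset)

lemma smooth_on_cong: "open S \<Longrightarrow> (\<And>x. x \<in> S \<Longrightarrow> f x = g x) \<Longrightarrow> smooth_on S f \<Longrightarrow> smooth_on S g"
  unfolding smooth_on_def using Ck_on_cong by blast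

lemma smooth_on_local:
  "(\<And>x. x \<in> S \<Longrightarrow> \<exists>T. open T \<and> x \<in> T \<and> smooth_on T f) \<Longrightarrow> smooth_on S f"
  unfolding smooth_on_def by (meson Ck_on_local)

lemma smooth_on_add: "open S \<Longrightarrow> smooth_on S f \<Longrightarrow> smooth_on S g \<Longrightarrow> smooth_on S (\<lambda>x. f x + g x)"
  by (simp add: smooth_on_def Ck_on_add)

lemma smooth_on_linear:
  "open S \<Longrightarrow> bounded_linear L \<Longrightarrow> smooth_on S f \<Longrightarrow> smooth_on S (\<lambda>x. L (f x))"
  by (simp add: smooth_on_def Ck_on_linear)

lemma smooth_on_mult:
  fixes f g :: "'a::real_normed_vector \<Rightarrow> real"
  shows "open S \<Longrightarrow> smooth_on S f \<Longrightarrow> smooth_on S g \<Longrightarrow> smooth_on S (\<lambda>x. f x * g x)"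
  by (simp add: smooth_on_def Ck_on_mult)

lemma smooth_on_compose:
  fixes f :: "'a::real_normed_vector \<Rightarrow> 'b::real_inner" and g :: "'b \<Rightarrow> real"
  assumes "orthonormal_basis (J :: 'b set)"
    and "open S" "smooth_on S f" "smooth_on T g" "f ` S \<subseteq> T"
  shows "smooth_on S (\<lambda>x. g (f x))"
  using assms by (auto simp: smooth_on_def intro: Ck_on_compose)

lemma smooth_on_continuous_on: "smooth_on S f \<Longrightarrow> continuous_on S f"
  unfolding smooth_on_def using Ck_on.simps(1) by blast

section \<open>A smooth bump function\<close>

text \<open>
  The derivative of \<open>p(1/x) exp(-1/x)\<close> has the same shape, with the polynomial
  \<open>y\<^sup>2 (p - p')\<close> evaluated at \<open>y = 1/x\<close>; so the family is closed under differentiation, also at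
  the origin, where the exponential beats every polynomial in \<open>1/x\<close>.
\<close>

definition flat_exp :: "real poly \<Rightarrow> real \<Rightarrow> real" where
  "flat_exp p x = (if x > 0 then poly p (inverse x) * exp (- inverse x) else 0)"

lemma poly_times_exp_minus_tendsto_0:
  "((\<lambda>y::real. poly p y * exp (- y)) \<longlongrightarrow> 0) at_top"
proof -
  have "((\<lambda>y::real. \<Sum>i\<le>degree p. coeff p i * (y ^ i / exp y)) \<longlongrightarrow> (\<Sum>i\<le>degree p. coeff p i * 0)) at_top"
    by (intro tendsto_sum tendsto_mult tendsto_const tendsto_power_div_exp_0)
  moreover have "(\<Sum>i\<le>degree p. coeff p i * (y ^ i / exp y)) = poly p y * exp (- y)" for y :: real
    by (simp add: poly_altdef sum_distrib_right exp_minus divide_inverse mult.assoc)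
  ultimately show ?thesis by simp
qed

lemma flat_exp_has_derivative:
  "(flat_exp p has_real_derivative flat_exp ([:0, 0, 1:] * (p - pderiv p)) x) (at x)"
proof -
  consider "x > 0" | "x < 0" | "x = 0" by linarith
  then show ?thesis
  proof cases
    case 1
    have "((\<lambda>x. poly p (inverse x) * exp (- inverse x)) has_real_derivative
        flat_exp ([:0, 0, 1:] * (p - pderiv p)) x) (at x)"
      using 1 by (auto intro!: derivative_eq_intros DERIV_chain2[OF poly_DERIV]
          simp: flat_exp_def power2_eq_square algebra_simps)
    then show ?thesis
      by (rule has_field_derivative_transform_within_open[of _ _ _ "{0<..}"])
        (use 1 in \<open>auto simp: flat_exp_def\<close>)
  next
    case 2
    have "((\<lambda>x::real. 0::real) has_real_derivative
        flat_exp ([:0, 0, 1:] * (p - pderiv p)) x) (at x)"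
      using 2 by (simp add: flat_exp_def)
    then show ?thesis
      by (rule has_field_derivative_transform_within_open[of _ _ _ "{..<0}"])
        (use 2 in \<open>auto simp: flat_exp_def\<close>)
  next
    case 3
    have "((\<lambda>y. flat_exp p y / y) \<longlongrightarrow> 0) (at_left 0)"
    proof (rule Lim_transform_eventually[OF tendsto_const])
      show "\<forall>\<^sub>F y in at_left 0. 0 = flat_exp p y / y"
        by (auto simp: eventually_at_filter flat_exp_def)
    qed
    moreover have "((\<lambda>y. flat_exp p y / y) \<longlongrightarrow> 0) (at_right 0)"
    proof (rule Lim_transform_eventually)
      show "((\<lambda>y. poly ([:0, 1:] * p) (inverse y) * exp (- inverse y)) \<longlongrightarrow> 0) (at_right (0::real))"
        by (rule filterlim_compose[OF poly_times_exp_minus_tendsto_0 filterlim_inverse_at_top_right])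
      show "\<forall>\<^sub>F y in at_right 0. poly ([:0, 1:] * p) (inverse y) * exp (- inverse y) = flat_exp p y / y"
        by (auto simp: eventually_at_filter flat_exp_def divide_inverse)
    qed
    ultimately have "((\<lambda>y. flat_exp p y / y) \<longlongrightarrow> 0) (at 0)"
      by (rule filterlim_split_at)
    then show ?thesis using 3 by (simp add: has_field_derivative_iff flat_exp_def)
  qed
qed

lemma smooth_flat_exp: "smooth_on UNIV (flat_exp p)"
  unfolding smooth_on_def
proof
  fix k show "Ck_on k UNIV (flat_exp p)"
  proof (induction k arbitrary: p)
    case 0
    then show ?case
      using flat_exp_has_derivative[THEN DERIV_isCont]
      by (simp add: continuous_on_eq_continuous_at)
  next
    case (Suc k)
    show ?case
    proof (rule Ck_on_SucI)
      show "(flat_exp p has_derivative (\<lambda>v. flat_exp ([:0, 0, 1:] * (p - pderiv p)) x * v)) (at x)" for x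
        using flat_exp_has_derivative[of p x] by (simp add: has_field_derivative_def)
      show "Ck_on k UNIV (\<lambda>x. flat_exp ([:0, 0, 1:] * (p - pderiv p)) x * v)" for v
        by (rule Ck_on_linear[OF _ bounded_linear_mult_left Suc.IH]) simp
    qed simp
  qed
qed

text \<open>
  The squared distance to \<open>c\<close> is smooth in every inner product space, so that
  \<open>exp (- 1 / (r\<^sup>2 - |y - c|\<^sup>2))\<close>, cut off at the sphere and normalised at \<open>c\<close>, is a bump function.
\<close>

lemma smooth_bump:
  fixes c :: "'a::real_inner"
  assumes "r > 0"
  obtains b :: "'a \<Rightarrow> real" where "smooth_on UNIV b" "b c = 1" "\<And>y. y \<notin> cball c r \<Longrightarrow> b y = 0"
proof -
  define s where "s y = r\<^sup>2 - (y - c) \<bullet> (y - c)" for y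
  have "Ck_on k UNIV s" for k
  proof (cases k)
    case 0
    then show ?thesis by (auto simp: s_def intro!: continuous_intros)
  next
    case (Suc n)
    have "Ck_on (Suc n) UNIV s"
    proof (rule Ck_on_SucI)
      show "(s has_derivative (\<lambda>v. - 2 * ((y - c) \<bullet> v))) (at y)" for y
        unfolding s_def by (auto intro!: derivative_eq_intros simp: inner_commute)
      show "Ck_on n UNIV (\<lambda>y. - 2 * ((y - c) \<bullet> v))" for v
      proof (rule Ck_on_linear[OF _ bounded_linear_mult_right])
        have "Ck_on n UNIV (\<lambda>y. y \<bullet> v + (- (c \<bullet> v)))"
          by (intro Ck_on_add Ck_on_linear[OF _ bounded_linear_inner_left] Ck_on_ident) auto
        then show "Ck_on n UNIV (\<lambda>y. (y - c) \<bullet> v)" by (simp add: inner_diff_left)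
      qed simp
    qed simp
    then show ?thesis using Suc by simp
  qed
  then have "smooth_on UNIV s" by (simp add: smooth_on_def)
  define b where "b y = inverse (flat_exp 1 (r\<^sup>2)) * flat_exp 1 (s y)" for y
  have "smooth_on UNIV b"
    unfolding b_def
    by (intro smooth_on_mult smooth_on_compose[OF orthonormal_basis_real _ \<open>smooth_on UNIV s\<close> smooth_flat_exp])
      auto
  moreover have "b c = 1" using assms by (simp add: b_def s_def flat_exp_def)
  moreover have "b y = 0" if "y \<notin> cball c r" for y
  proof -
    have "r < norm (y - c)" using that by (simp add: dist_norm norm_minus_commute)
    then have "r\<^sup>2 \<le> (norm (y - c))\<^sup>2" using assms by (intro power_mono) auto
    then show ?thesis by (simp add: b_def s_def flat_exp_def power2_norm_eq_inner)
  qed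
  ultimately show ?thesis using that by blast
qed

section \<open>First order Taylor expansion with smooth coefficients\<close>

definition ray_average :: "'a::real_normed_vector \<Rightarrow> nat \<Rightarrow> ('a \<Rightarrow> real) \<Rightarrow> 'a \<Rightarrow> real" where
  "ray_average y0 n H y = integral (cbox 0 1) (\<lambda>t. t ^ n * H (y0 + t *\<^sub>R (y - y0)))"

lemma ray_mem:
  fixes y0 :: "'a::real_normed_vector"
  assumes "convex S" "y0 \<in> S" "y \<in> S" "t \<in> cbox 0 (1::real)"
  shows "y0 + t *\<^sub>R (y - y0) \<in> S"
proof -
  have "(1 - t) *\<^sub>R y0 + t *\<^sub>R y \<in> S" using assms by (intro convexD) auto
  then show ?thesis by (simp add: algebra_simps)
qed

lemma continuous_on_ray:
  fixes y0 :: "'a::real_normed_vector"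
  assumes "convex S" "y0 \<in> S" "continuous_on S (H :: 'a \<Rightarrow> real)"
  shows "continuous_on (S \<times> cbox 0 1) (\<lambda>(x, t). H (y0 + t *\<^sub>R (x - y0)))"
  unfolding split_beta
  by (rule continuous_on_compose2[OF assms(3)])
    (use ray_mem[OF assms(1,2)] in \<open>auto intro!: continuous_intros\<close>)

lemma continuous_on_one_ray:
  fixes y0 :: "'a::real_normed_vector"
  assumes "convex S" "y0 \<in> S" "y \<in> S" "continuous_on S (H :: 'a \<Rightarrow> real)"
  shows "continuous_on (cbox 0 1) (\<lambda>t. H (y0 + t *\<^sub>R (y - y0)))"
  by (rule continuous_on_compose2[OF assms(4)])
    (use ray_mem[OF assms(1,2,3)] in \<open>auto intro!: continuous_intros\<close>)

text \<open>
  Differentiation under the integral sign: each derivative raises the power of \<open>t\<close> by one and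
  replaces \<open>H\<close> by a directional derivative, so averages of smooth functions are smooth.
\<close>

lemma ray_average_has_derivative:
  fixes y0 :: "'a::{real_inner,banach}" and J :: "'a set"
  assumes J: "orthonormal_basis J" and S: "open S" "convex S" "y0 \<in> S"
    and H: "smooth_on S H" and y: "y \<in> S"
  shows "(ray_average y0 n H has_derivative
    (\<lambda>v. \<Sum>j\<in>J. ray_average y0 (Suc n) (\<lambda>x. frechet_derivative H (at x) j) y * (v \<bullet> j))) (at y)"
proof -
  let ?d = "\<lambda>j x. frechet_derivative H (at x) j"
  define fx where "fx x t = (\<Sum>j\<in>J. (t ^ Suc n * ?d j (y0 + t *\<^sub>R (x - y0))) *\<^sub>R blinfun_inner_left j)"
    for x :: 'a and t :: real
  have contd: "continuous_on S (?d j)" for j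
    using smooth_on_frechet_derivative(1)[OF H] by (rule smooth_on_continuous_on)
  have app: "blinfun_apply (fx x t) v = (\<Sum>j\<in>J. (t ^ Suc n * ?d j (y0 + t *\<^sub>R (x - y0))) * (v \<bullet> j))" for x t v
    by (simp add: fx_def blinfun.sum_left blinfun.scaleR_left inner_commute)
  have "(ray_average y0 n H has_derivative integral (cbox 0 1) (fx y)) (at y within S)"
    unfolding ray_average_def
  proof (rule leibniz_rule)
    fix x t assume x: "x \<in> S" and t: "t \<in> cbox 0 (1::real)"
    let ?z = "y0 + t *\<^sub>R (x - y0)"
    have D: "(H has_derivative frechet_derivative H (at ?z)) (at ?z)"
      using smooth_on_frechet_derivative(2)[OF H ray_mem[OF S(2,3) x t]] .
    have inner: "((\<lambda>x. y0 + t *\<^sub>R (x - y0)) has_derivative (\<lambda>v. t *\<^sub>R v)) (at x)"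
      by (auto intro!: derivative_eq_intros)
    have "((\<lambda>x. t ^ n * H (y0 + t *\<^sub>R (x - y0))) has_derivative
        (\<lambda>v. t ^ n * frechet_derivative H (at ?z) (t *\<^sub>R v))) (at x)"
      by (intro has_derivative_mult_right has_derivative_compose[OF inner D])
    moreover have "t ^ n * frechet_derivative H (at ?z) (t *\<^sub>R v) = blinfun_apply (fx x t) v" for v
    proof -
      have "frechet_derivative H (at ?z) v = (\<Sum>j\<in>J. (v \<bullet> j) *\<^sub>R ?d j ?z)"
        by (rule linear_orthonormal_sum[OF J has_derivative_linear[OF D]])
      then show ?thesis
        using linear_scale[OF has_derivative_linear[OF D], of t v]
        by (simp add: app sum_distrib_left mult_ac)
    qed
    ultimately show "((\<lambda>x. t ^ n * H (y0 + t *\<^sub>R (x - y0))) has_derivative blinfun_apply (fx x t)) (at x within S)"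
      by (simp add: has_derivative_at_withinI)
  next
    fix x assume "x \<in> S"
    then show "(\<lambda>t. t ^ n * H (y0 + t *\<^sub>R (x - y0))) integrable_on cbox 0 1"
      by (intro integrable_continuous continuous_intros
          continuous_on_one_ray[OF S(2,3)] smooth_on_continuous_on[OF H])
  next
    show "continuous_on (S \<times> cbox 0 1) (\<lambda>(x, t). fx x t)"
      using continuous_on_ray[OF S(2,3) contd] unfolding fx_def split_beta
      by (intro continuous_intros)
  qed (use y S in auto)
  then have D: "(ray_average y0 n H has_derivative integral (cbox 0 1) (fx y)) (at y)"
    using at_within_open[OF y S(1)] by simp
  have cont: "continuous_on (cbox 0 1) (fx y)"
    unfolding fx_def by (intro continuous_intros continuous_on_one_ray[OF S(2,3) y contd])
  have "blinfun_apply (integral (cbox 0 1) (fx y)) v =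
      (\<Sum>j\<in>J. ray_average y0 (Suc n) (?d j) y * (v \<bullet> j))" for v
  proof -
    have "blinfun_apply (integral (cbox 0 1) (fx y)) v = integral (cbox 0 1) (\<lambda>t. blinfun_apply (fx y t) v)"
      using integral_linear[OF integrable_continuous[OF cont] blinfun.bounded_linear_left[of v]]
      by (simp add: o_def)
    also have "\<dots> = (\<Sum>j\<in>J. integral (cbox 0 1) (\<lambda>t. (t ^ Suc n * ?d j (y0 + t *\<^sub>R (y - y0))) * (v \<bullet> j)))"
      unfolding app
    proof (rule integral_sum)
      show "finite J" using J by (simp add: orthonormal_basis_def)
      show "(\<lambda>t. (t ^ Suc n * ?d j (y0 + t *\<^sub>R (y - y0))) * (v \<bullet> j)) integrable_on cbox 0 1" for j
        by (intro integrable_continuous continuous_intros continuous_on_one_ray[OF S(2,3) y contd])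
    qed
    finally show ?thesis by (simp add: ray_average_def)
  qed
  then have "blinfun_apply (integral (cbox 0 1) (fx y)) =
      (\<lambda>v. \<Sum>j\<in>J. ray_average y0 (Suc n) (?d j) y * (v \<bullet> j))" by (intro ext)
  then show ?thesis using D by simp
qed

lemma smooth_ray_average:
  fixes y0 :: "'a::{real_inner,banach}" and J :: "'a set"
  assumes J: "orthonormal_basis J" and S: "open S" "convex S" "y0 \<in> S" and H: "smooth_on S H"
  shows "smooth_on S (ray_average y0 n H)"
  unfolding smooth_on_def
proof
  fix k show "Ck_on k S (ray_average y0 n H)" using H
  proof (induction k arbitrary: n H)
    case 0
    then show ?case
      using ray_average_has_derivative[OF J S 0, THEN has_derivative_continuous]
      by (simp add: continuous_at_imp_continuous_on)
  next
    case (Suc k)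
    show ?case
    proof (rule Ck_on_SucI[OF ray_average_has_derivative[OF J S Suc.prems]])
      fix v
      show "Ck_on k S (\<lambda>x. \<Sum>j\<in>J.
          ray_average y0 (Suc n) (\<lambda>x. frechet_derivative H (at x) j) x * (v \<bullet> j))"
        by (intro Ck_on_sum Ck_on_linear[OF _ bounded_linear_mult_left] Suc.IH S(1)
            smooth_on_frechet_derivative(1)[OF Suc.prems])
    qed (use S in auto)
  qed
qed

text \<open>
  The fundamental theorem of calculus along the segment from \<open>y\<^sub>0\<close> to \<open>y\<close> expresses the remainder
  by averages of the partial derivatives over the segment; these are smooth, and at \<open>y\<^sub>0\<close> they are
  the partial derivatives themselves.
\<close>

lemma hadamard_expansion:
  fixes y0 :: "'a::{real_inner,banach}" and J :: "'a set"
  assumes J: "orthonormal_basis J" and S: "open S" "convex S" "y0 \<in> S" and F: "smooth_on S F"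
  obtains g where "\<And>j. smooth_on S (g j)" "\<And>j. g j y0 = frechet_derivative F (at y0) j"
    and "\<And>y. y \<in> S \<Longrightarrow> F y = F y0 + (\<Sum>j\<in>J. ((y - y0) \<bullet> j) * g j y)"
proof -
  let ?d = "\<lambda>j x. frechet_derivative F (at x) j"
  define g where "g j = ray_average y0 0 (?d j)" for j
  have contd: "continuous_on S (?d j)" for j
    using smooth_on_frechet_derivative(1)[OF F] by (rule smooth_on_continuous_on)
  show ?thesis
  proof
    show "smooth_on S (g j)" for j
      unfolding g_def by (intro smooth_ray_average[OF J S] smooth_on_frechet_derivative(1) F)
    show "g j y0 = frechet_derivative F (at y0) j" for j
      by (simp add: g_def ray_average_def)
    fix y assume y: "y \<in> S"
    let ?r = "\<lambda>t. y0 + t *\<^sub>R (y - y0)"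
    have "((\<lambda>t. frechet_derivative F (at (?r t)) (y - y0)) has_integral F (?r 1) - F (?r 0)) {0..1}"
    proof (rule fundamental_theorem_of_calculus)
      fix t :: real assume t: "t \<in> {0..1}"
      have D: "(F has_derivative frechet_derivative F (at (?r t))) (at (?r t))"
        using smooth_on_frechet_derivative(2)[OF F ray_mem[OF S(2,3) y]] t by simp
      have "(?r has_derivative (\<lambda>s. s *\<^sub>R (y - y0))) (at t)"
        by (auto intro!: derivative_eq_intros)
      from has_derivative_compose[OF this D]
      have "((\<lambda>t. F (?r t)) has_vector_derivative frechet_derivative F (at (?r t)) (y - y0)) (at t)"
        using linear_scale[OF has_derivative_linear[OF D]] by (simp add: has_vector_derivative_def)
      then show "((\<lambda>t. F (?r t)) has_vector_derivative frechet_derivative F (at (?r t)) (y - y0))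
          (at t within {0..1})" by (rule has_vector_derivative_at_within)
    qed simp
    moreover have "((\<lambda>t. frechet_derivative F (at (?r t)) (y - y0)) has_integral
        (\<Sum>j\<in>J. ((y - y0) \<bullet> j) * g j y)) {0..1}"
    proof (rule has_integral_eq)
      show "((\<lambda>t. \<Sum>j\<in>J. ((y - y0) \<bullet> j) * ?d j (?r t)) has_integral
          (\<Sum>j\<in>J. ((y - y0) \<bullet> j) * g j y)) {0..1}"
      proof (intro has_integral_sum has_integral_mult_right)
        show "finite J" using J by (simp add: orthonormal_basis_def)
        show "((\<lambda>t. ?d j (?r t)) has_integral g j y) {0..1}" for j
          using integrable_continuous[OF continuous_on_one_ray[OF S(2,3) y contd], of j]
          by (simp add: g_def ray_average_def has_integral_integral)
      qed
      fix t :: real assume t: "t \<in> {0..1}"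
      have D: "(F has_derivative frechet_derivative F (at (?r t))) (at (?r t))"
        using smooth_on_frechet_derivative(2)[OF F ray_mem[OF S(2,3) y]] t by simp
      show "(\<Sum>j\<in>J. ((y - y0) \<bullet> j) * ?d j (?r t)) = frechet_derivative F (at (?r t)) (y - y0)"
        using linear_orthonormal_sum[OF J has_derivative_linear[OF D], of "y - y0"] by simp
    qed
    ultimately have "F (?r 1) - F (?r 0) = (\<Sum>j\<in>J. ((y - y0) \<bullet> j) * g j y)"
      by (rule has_integral_unique)
    then show "F y = F y0 + (\<Sum>j\<in>J. ((y - y0) \<bullet> j) * g j y)" by simp
  qed
qed

section \<open>Smooth functions, tangent vectors and frames\<close>

locale smooth_manifold =
  fixes A :: "('m::{t2_space,second_countable_topology}, 'e::{real_inner,banach,heine_borel}) atlas"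
  assumes atlas: "smooth_atlas A"
begin

abbreviation "\<S> \<equiv> smooth_funs A"
abbreviation "\<T> \<equiv> tangent_space A"
abbreviation "\<T>' \<equiv> cotangent_space A"
abbreviation "\<V> \<equiv> vector_fields A"

lemma model_basis: obtains J :: "'e set" where "orthonormal_basis J"
proof -
  obtain B :: "'e set" where "finite B" "span B = UNIV"
    using atlas unfolding smooth_atlas_def by (elim conjE exE) (rule that)
  then show ?thesis by (rule orthonormal_basis_exists) (rule that)
qed

lemma chart_around: obtains U \<phi> where "(U, \<phi>) \<in> A" "p \<in> U"
proof -
  have "(\<Union>(U, \<phi>)\<in>A. U) = UNIV"
    using atlas unfolding smooth_atlas_def by (elim conjE) assumption
  then have "p \<in> (\<Union>(U, \<phi>)\<in>A. U)" by (simp only: UNIV_I)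
  then obtain c where c: "c \<in> A" "p \<in> (case c of (U, \<phi>) \<Rightarrow> U)" by (rule UN_E)
  obtain U \<phi> where "c = (U, \<phi>)" by (cases c)
  then show ?thesis using that[of U \<phi>] c by simp
qed

lemma chart:
  assumes "(U, \<phi>) \<in> A"
  shows "open U" "open (\<phi> ` U)" "homeomorphism U (\<phi> ` U) \<phi> (inv_into U \<phi>)"
proof -
  have "\<forall>(U, \<phi>)\<in>A. open U \<and> open (\<phi> ` U) \<and> homeomorphism U (\<phi> ` U) \<phi> (inv_into U \<phi>)"
    using atlas unfolding smooth_atlas_def by (elim conjE) assumption
  from bspec[OF this assms]
  show "open U" "open (\<phi> ` U)" "homeomorphism U (\<phi> ` U) \<phi> (inv_into U \<phi>)" by simp_all
qed

lemma chart_inv [simp]: "(U, \<phi>) \<in> A \<Longrightarrow> q \<in> U \<Longrightarrow> inv_into U \<phi> (\<phi> q) = q"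
  by (rule homeomorphism_apply1[OF chart(3)])

lemma chart_image_open:
  assumes "(U, \<phi>) \<in> A" "open W" "W \<subseteq> U"
  shows "open (\<phi> ` W)"
proof -
  have "\<phi> ` W = \<phi> ` U \<inter> inv_into U \<phi> -` W"
  proof (intro equalityI subsetI)
    fix y assume "y \<in> \<phi> ` W"
    then obtain q where "q \<in> W" "y = \<phi> q" by blast
    then show "y \<in> \<phi> ` U \<inter> inv_into U \<phi> -` W"
      using chart_inv[OF assms(1), of q] assms(3) by auto
  next
    fix y assume y: "y \<in> \<phi> ` U \<inter> inv_into U \<phi> -` W"
    then obtain q where "q \<in> U" "y = \<phi> q" by blast
    then show "y \<in> \<phi> ` W" using chart_inv[OF assms(1), of q] y by auto
  qed
  then show ?thesis
    using continuous_open_preimage[OF homeomorphism_cont2[OF chart(3)[OF assms(1)]]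
        chart(2)[OF assms(1)] assms(2)] by simp
qed

lemma transition_smooth:
  assumes "(U, \<phi>) \<in> A" "(V, \<psi>) \<in> A"
  shows "smooth_on (\<psi> ` (V \<inter> U)) (\<lambda>y. \<phi> (inv_into V \<psi> y))"
proof -
  have "\<forall>(U, \<phi>)\<in>A. \<forall>(V, \<psi>)\<in>A. smooth_on (\<phi> ` (U \<inter> V)) (\<psi> \<circ> inv_into U \<phi>)"
    using atlas unfolding smooth_atlas_def by (elim conjE) assumption
  from bspec[OF this assms(2)]
  have "\<forall>(U, \<phi>)\<in>A. smooth_on (\<psi> ` (V \<inter> U)) (\<phi> \<circ> inv_into V \<psi>)" by (simp only: prod.case)
  from bspec[OF this assms(1)] show ?thesis by (simp only: prod.case o_def)
qed

lemma smooth_in_chart: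
  assumes "f \<in> \<S>" "(U, \<phi>) \<in> A"
  shows "smooth_on (\<phi> ` U) (\<lambda>y. f (inv_into U \<phi> y))"
  using bspec[OF _ assms(2), of "\<lambda>(U, \<phi>). smooth_on (\<phi> ` U) (f \<circ> inv_into U \<phi>)"] assms(1)
  by (simp add: smooth_funs_def o_def)

lemma smooth_funI:
  assumes "\<And>U \<phi>. (U, \<phi>) \<in> A \<Longrightarrow> smooth_on (\<phi> ` U) (\<lambda>y. f (inv_into U \<phi> y))"
  shows "f \<in> \<S>"
  using assms by (auto simp: smooth_funs_def o_def)

lemma fun_const [simp, intro]: "(\<lambda>_. c) \<in> \<S>"
  by (rule smooth_funI) simp

lemma fun_add [simp, intro]: "f \<in> \<S> \<Longrightarrow> g \<in> \<S> \<Longrightarrow> (\<lambda>x. f x + g x) \<in> \<S>"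
  by (rule smooth_funI) (simp add: smooth_on_add chart smooth_in_chart)

lemma fun_mult [simp, intro]: "f \<in> \<S> \<Longrightarrow> g \<in> \<S> \<Longrightarrow> (\<lambda>x. f x * g x) \<in> \<S>"
  by (rule smooth_funI) (simp add: smooth_on_mult chart smooth_in_chart)

lemma fun_minus [simp, intro]: "f \<in> \<S> \<Longrightarrow> (\<lambda>x. - f x) \<in> \<S>"
  using fun_mult[OF fun_const[of "-1"]] by simp

lemma fun_diff [simp, intro]: "f \<in> \<S> \<Longrightarrow> g \<in> \<S> \<Longrightarrow> (\<lambda>x. f x - g x) \<in> \<S>"
  using fun_add[of f "\<lambda>x. - g x"] by simp

lemma fun_sum [simp, intro]: "(\<And>i. i \<in> I \<Longrightarrow> f i \<in> \<S>) \<Longrightarrow> (\<lambda>x. \<Sum>i\<in>I. f i x) \<in> \<S>"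
  by (induction I rule: infinite_finite_induct) auto

subsection \<open>Tangent vectors\<close>

lemma tangent_rules:
  assumes "v \<in> \<T> p"
  shows tangent_outside: "f \<notin> \<S> \<Longrightarrow> v f = 0"
    and tangent_add: "f \<in> \<S> \<Longrightarrow> g \<in> \<S> \<Longrightarrow> v (\<lambda>x. f x + g x) = v f + v g"
    and tangent_cmult: "f \<in> \<S> \<Longrightarrow> v (\<lambda>x. c * f x) = c * v f"
    and tangent_mult: "f \<in> \<S> \<Longrightarrow> g \<in> \<S> \<Longrightarrow> v (\<lambda>x. f x * g x) = f p * v g + g p * v f"
  using assms unfolding tangent_space_def by blast+

lemma tangent_const: assumes "v \<in> \<T> p" shows "v (\<lambda>_. c) = 0"
proof -
  have "v (\<lambda>_. 1) = 0"
    using tangent_mult[OF assms, of "\<lambda>_. 1" "\<lambda>_. 1"] by simp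
  then show ?thesis using tangent_cmult[OF assms, of "\<lambda>_. 1" c] by simp
qed

lemma tangent_minus: "v \<in> \<T> p \<Longrightarrow> f \<in> \<S> \<Longrightarrow> v (\<lambda>x. - f x) = - v f"
  using tangent_cmult[of v p f "-1"] by simp

lemma tangent_diff: "v \<in> \<T> p \<Longrightarrow> f \<in> \<S> \<Longrightarrow> g \<in> \<S> \<Longrightarrow> v (\<lambda>x. f x - g x) = v f - v g"
  using tangent_add[of v p f "\<lambda>x. - g x"] tangent_minus[of v p g] by simp

lemma tangent_sum:
  assumes "v \<in> \<T> p" "\<And>i. i \<in> I \<Longrightarrow> f i \<in> \<S>"
  shows "v (\<lambda>x. \<Sum>i\<in>I. f i x) = (\<Sum>i\<in>I. v (f i))"
  using assms(2)
  by (induction I rule: infinite_finite_induct)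
    (simp_all add: tangent_add[OF assms(1)] tangent_const[OF assms(1)])

lemma tangent_lin [simp, intro]:
  shows tangent_space_zero: "(\<lambda>_. 0) \<in> \<T> p"
    and tangent_space_add: "u \<in> \<T> p \<Longrightarrow> w \<in> \<T> p \<Longrightarrow> (\<lambda>f. u f + w f) \<in> \<T> p"
    and tangent_space_cmult: "u \<in> \<T> p \<Longrightarrow> (\<lambda>f. c * u f) \<in> \<T> p"
  unfolding tangent_space_def by (auto simp: algebra_simps)

lemma tangent_space_sum [simp, intro]:
  "(\<And>i. i \<in> I \<Longrightarrow> u i \<in> \<T> p) \<Longrightarrow> (\<lambda>f. \<Sum>i\<in>I. u i f) \<in> \<T> p"
  by (induction I rule: infinite_finite_induct) auto

lemma field_at: "X \<in> \<V> \<Longrightarrow> X p \<in> \<T> p"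
  and field_smooth: "X \<in> \<V> \<Longrightarrow> f \<in> \<S> \<Longrightarrow> (\<lambda>p. X p f) \<in> \<S>"
  by (auto simp: vector_fields_def)

lemma field_outside: "X \<in> \<V> \<Longrightarrow> f \<notin> \<S> \<Longrightarrow> X p f = 0"
  using tangent_outside[OF field_at] .

lemma lie_bracket_field [simp, intro]:
  assumes "X \<in> \<V>" "Y \<in> \<V>"
  shows "lie_bracket X Y \<in> \<V>"
proof -
  note X = field_at[OF assms(1)] and Y = field_at[OF assms(2)]
  note [simp] = field_smooth[OF assms(1)] field_smooth[OF assms(2)]
  have "lie_bracket X Y p \<in> \<T> p" for p
    unfolding tangent_space_def
  proof (clarify, intro conjI allI ballI impI)
    fix f assume "f \<notin> \<S>"
    then show "lie_bracket X Y p f = 0"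
      using assms by (simp add: lie_bracket_def field_outside tangent_const[OF X] tangent_const[OF Y])
  next
    fix f g assume fg: "f \<in> \<S>" "g \<in> \<S>"
    show "lie_bracket X Y p (\<lambda>x. f x + g x) = lie_bracket X Y p f + lie_bracket X Y p g"
      using fg assms by (simp add: lie_bracket_def tangent_add[OF X] tangent_add[OF Y])
    show "lie_bracket X Y p (\<lambda>x. f x * g x) = f p * lie_bracket X Y p g + g p * lie_bracket X Y p f"
      using fg assms
      by (simp add: lie_bracket_def tangent_add[OF X] tangent_add[OF Y] tangent_mult[OF X] tangent_mult[OF Y] algebra_simps)
  next
    fix c f assume "f \<in> \<S>"
    then show "lie_bracket X Y p (\<lambda>x. c * f x) = c * lie_bracket X Y p f"
      using assms by (simp add: lie_bracket_def tangent_cmult[OF X] tangent_cmult[OF Y] algebra_simps)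
  qed
  moreover have "(\<lambda>p. lie_bracket X Y p f) \<in> \<S>" if "f \<in> \<S>" for f
    using assms that by (simp add: lie_bracket_def)
  ultimately show ?thesis by (auto simp: vector_fields_def)
qed

lemma field_fun_mult [simp, intro]:
  assumes "h \<in> \<S>" "X \<in> \<V>"
  shows "(\<lambda>p f. h p * X p f) \<in> \<V>"
  using tangent_space_cmult[OF field_at[OF assms(2)]] fun_mult[OF assms(1) field_smooth[OF assms(2)]]
  unfolding vector_fields_def by blast

subsection \<open>Extending functions from a chart\<close>

text \<open>
  \<open>S\<close> is an open set of coordinates on which \<open>F\<close> is smooth; it may be smaller than the range of the
  chart, so that \<open>F\<close> need only make sense on a ball.
\<close>

definition chart_ext :: "'m set \<Rightarrow> ('m \<Rightarrow> 'e) \<Rightarrow> 'e set \<Rightarrow> ('e \<Rightarrow> real) \<Rightarrow> 'm \<Rightarrow> real" where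
  "chart_ext U \<phi> S F q = (if q \<in> U \<and> \<phi> q \<in> S then F (\<phi> q) else 0)"

text \<open>
  The compact support is closed in the Hausdorff space \<open>'m\<close>, so that its complement and the chart
  domain form an open cover, and on both the extension is smooth.
\<close>

lemma chart_ext_smooth:
  assumes U: "(U, \<phi>) \<in> A" and S: "open S" "S \<subseteq> \<phi> ` U" and K: "compact K" "K \<subseteq> S"
    and F: "smooth_on S F" "\<And>y. y \<in> S - K \<Longrightarrow> F y = 0"
  shows "chart_ext U \<phi> S F \<in> \<S>"
proof (rule smooth_funI, rule smooth_on_local)
  fix V \<psi> x assume V: "(V, \<psi>) \<in> A" and "x \<in> \<psi> ` V"
  then obtain q where q: "q \<in> V" "x = \<psi> q" by blast
  obtain J :: "'e set" where J: "orthonormal_basis J" by (rule model_basis)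
  let ?g = "\<lambda>y. chart_ext U \<phi> S F (inv_into V \<psi> y)"
  show "\<exists>T. open T \<and> x \<in> T \<and> smooth_on T ?g"
  proof (cases "q \<in> U \<and> \<phi> q \<in> S")
    case True
    define W where "W = V \<inter> (U \<inter> \<phi> -` S)"
    have "open W"
      using continuous_open_preimage[OF homeomorphism_cont1[OF chart(3)[OF U]] chart(1)[OF U] S(1)]
        chart(1)[OF V] by (auto simp: W_def)
    then have oT: "open (\<psi> ` W)" by (rule chart_image_open[OF V]) (auto simp: W_def)
    have "smooth_on (\<psi> ` W) (\<lambda>y. F (\<phi> (inv_into V \<psi> y)))"
      by (rule smooth_on_compose[OF J oT smooth_on_subset[OF transition_smooth[OF U V]] F(1)])
        (auto simp: W_def V)
    then have "smooth_on (\<psi> ` W) ?g"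
      by (rule smooth_on_cong[OF oT, rotated]) (auto simp: W_def V chart_ext_def)
    then show ?thesis using oT True q by (auto simp: W_def)
  next
    case False
    define L where "L = inv_into U \<phi> ` K"
    have "compact L"
      unfolding L_def using K S(2) homeomorphism_cont2[OF chart(3)[OF U]]
      by (intro compact_continuous_image) (auto intro: continuous_on_subset)
    then have "closed L" by (rule compact_imp_closed)
    then have oT: "open (\<psi> ` (V - L))"
      using chart(1)[OF V] by (intro chart_image_open[OF V]) auto
    have L: "r \<in> U \<and> \<phi> r \<in> K" if "r \<in> L" for r
      using that K S(2) by (auto simp: L_def U f_inv_into_f inv_into_into subset_iff)
    have "F (\<phi> r) = 0" if "r \<notin> L" "r \<in> U" "\<phi> r \<in> S" for r
    proof (rule F(2))
      have "\<phi> r \<notin> K" using that U unfolding L_def by (metis chart_inv imageI)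
      then show "\<phi> r \<in> S - K" using that by simp
    qed
    then have "0 = ?g y" if "y \<in> \<psi> ` (V - L)" for y
      using that V by (auto simp: chart_ext_def)
    then have "smooth_on (\<psi> ` (V - L)) ?g"
      by (rule smooth_on_cong[OF oT]) auto
    moreover have "q \<notin> L" using False L K(2) by auto
    ultimately show ?thesis using oT q by blast
  qed
qed

subsection \<open>Frames with a cut-off\<close>

text \<open>
  Multiplying the expansion of a function to first order around \<open>q\<close> by the square of a bump function
  \<open>\<rho>\<close> makes both the coordinates and the coefficients global smooth functions, so that a tangent
  vector \<open>v\<close> at \<open>q\<close> can be applied to the expansion. In each term the coordinate difference vanishes
  at \<open>q\<close>, so that by the product rule only the value at \<open>q\<close> of the coefficient enters, which is a
  coordinate derivative. The terms with \<open>v \<rho>\<close> correct for applying \<open>v\<close> to the cut-off coordinate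
  \<open>\<rho> y\<^sub>j\<close> instead of \<open>y\<^sub>j\<close>; with coordinates centred at \<open>p\<close> they vanish there.
\<close>

lemma cutoff_coordinate_frame:
  obtains J :: "'e set" and x E E' \<rho> where
    "finite J" "\<rho> \<in> \<S>" "\<rho> p = 1"
    "\<And>j. x j \<in> \<S>" "\<And>j. E j \<in> \<V>" "\<And>j. E' j \<in> \<V>"
    "\<And>q v f. v \<in> \<T> q \<Longrightarrow>
       \<rho> q * \<rho> q * v f = (\<Sum>j\<in>J. v (x j) * E j q f) + (\<Sum>j\<in>J. v \<rho> * E' j q f)"
    "\<And>j f. E' j p f = 0"
    "\<And>i j. i \<in> J \<Longrightarrow> j \<in> J \<Longrightarrow> E i p (x j) = (if i = j then 1 else 0)"
    "orthonormal_basis J"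
proof -
  obtain J :: "'e set" where J: "orthonormal_basis J" by (rule model_basis)
  obtain U \<phi> where U: "(U, \<phi>) \<in> A" "p \<in> U" by (rule chart_around)
  define c where "c = \<phi> p"
  obtain R where R: "R > 0" "cball c R \<subseteq> \<phi> ` U"
    using chart(2)[OF U(1)] U(2) open_contains_cball unfolding c_def by blast
  define r where "r = R / 2"
  define S where "S = ball c R"
  define K where "K = cball c r"
  have S: "open S" "S \<subseteq> \<phi> ` U" "convex S" and K: "compact K" "K \<subseteq> S" and r: "r > 0" "c \<in> S"
    using R by (auto simp: S_def K_def r_def)
  note ext_smooth = chart_ext_smooth[OF U(1) S(1,2) K]
  obtain b :: "'e \<Rightarrow> real" where b: "smooth_on UNIV b" "b c = 1" "\<And>y. y \<notin> K \<Longrightarrow> b y = 0"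
    using smooth_bump[OF r(1), of c] unfolding K_def by metis
  have bS: "smooth_on S b" using b(1) smooth_on_subset by blast
  define co where "co j y = (y - c) \<bullet> j" for j y
  have coS: "smooth_on S (co j)" for j
  proof -
    have "smooth_on S (\<lambda>y. y \<bullet> j + (- (c \<bullet> j)))"
      by (intro smooth_on_add smooth_on_linear[OF _ bounded_linear_inner_left] smooth_on_ident
          S(1) smooth_on_const)
    then show ?thesis by (simp add: co_def[abs_def] inner_diff_left)
  qed
  let ?ext = "chart_ext U \<phi> S"
  define D where "D f j y = frechet_derivative (\<lambda>y. f (inv_into U \<phi> y)) (at y) j"
    for f :: "'m \<Rightarrow> real" and j y
  have f_der: "((\<lambda>y. f (inv_into U \<phi> y)) has_derivative (\<lambda>v. frechet_derivative (\<lambda>y. f (inv_into U \<phi> y)) (at y) v)) (at y)"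
    if "f \<in> \<S>" "y \<in> S" for f :: "'m \<Rightarrow> real" and y
    using smooth_on_frechet_derivative(2)[OF smooth_in_chart[OF that(1) U(1)]] that(2) S(2) by auto
  have DS: "smooth_on S (D f j)" if "f \<in> \<S>" for f j
    unfolding D_def[abs_def]
    using smooth_on_frechet_derivative(1)[OF smooth_in_chart[OF that U(1)]] S(2)
    by (blast intro: smooth_on_subset)
  have D_eq: "D f j y = L j"
    if "((\<lambda>y. f (inv_into U \<phi> y)) has_derivative L) (at y)" for f j y L
    using frechet_derivative_at[OF that] by (simp add: D_def)
  have D_add: "D (\<lambda>x. f x + g x) j y = D f j y + D g j y" if "f \<in> \<S>" "g \<in> \<S>" "y \<in> S" for f g j y
    using D_eq[of "\<lambda>x. f x + g x", OF has_derivative_add[OF f_der[OF that(1,3)] f_der[OF that(2,3)]]] by (simp add: D_def)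
  have D_cmult: "D (\<lambda>x. k * f x) j y = k * D f j y" if "f \<in> \<S>" "y \<in> S" for f k j y
    using D_eq[of "\<lambda>x. k * f x", OF has_derivative_mult_right[OF f_der[OF that]]] by (simp add: D_def)
  have D_mult: "D (\<lambda>x. f x * g x) j y = f (inv_into U \<phi> y) * D g j y + D f j y * g (inv_into U \<phi> y)"
    if "f \<in> \<S>" "g \<in> \<S>" "y \<in> S" for f g j y
    using D_eq[of "\<lambda>x. f x * g x", OF has_derivative_mult[OF f_der[OF that(1,3)] f_der[OF that(2,3)]]] by (simp add: D_def)
  define Vf where "Vf a j q f = (if f \<in> \<S> then ?ext (\<lambda>y. a y * D f j y) q else 0)" for a j q f
  have Vf: "Vf a j \<in> \<V>" if a: "smooth_on S a" "\<And>y. y \<notin> K \<Longrightarrow> a y = 0" for a j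
  proof -
    have "Vf a j q \<in> \<T> q" for q
      unfolding tangent_space_def using U(1)
      by (auto simp: Vf_def chart_ext_def D_add D_cmult D_mult algebra_simps)
    moreover have "(\<lambda>q. Vf a j q f) \<in> \<S>" if "f \<in> \<S>" for f
    proof -
      have "?ext (\<lambda>y. a y * D f j y) \<in> \<S>"
        by (rule ext_smooth) (auto intro: smooth_on_mult S a DS that)
      then show ?thesis using that by (simp add: Vf_def)
    qed
    ultimately show ?thesis by (simp add: vector_fields_def)
  qed
  define \<rho> where "\<rho> = ?ext b"
  define x where "x j = ?ext (\<lambda>y. co j y * b y)" for j
  define E where "E j = Vf b j" for j
  define E' where "E' j = Vf (\<lambda>y. - co j y * b y) j" for j
  have \<rho>S: "\<rho> \<in> \<S>" unfolding \<rho>_def by (rule ext_smooth) (auto intro: bS b)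
  have xS: "x j \<in> \<S>" for j
    unfolding x_def by (rule ext_smooth) (auto intro: smooth_on_mult S coS bS b)
  show ?thesis
  proof
    show "finite J" using J by (simp add: orthonormal_basis_def)
    show "\<rho> \<in> \<S>" by fact
    show "x j \<in> \<S>" for j by fact
    show "\<rho> p = 1" using U r b by (simp add: \<rho>_def chart_ext_def c_def[symmetric])
    show "E j \<in> \<V>" for j unfolding E_def by (rule Vf) (auto intro: bS b)
    have "smooth_on S (\<lambda>y. (- 1) * (co j y * b y))" for j
      by (intro smooth_on_mult S coS bS smooth_on_const)
    then show "E' j \<in> \<V>" for j unfolding E'_def by (intro Vf) (auto simp: b)
    show "E' j p f = 0" for j f
      by (simp add: E'_def Vf_def chart_ext_def c_def[symmetric] co_def)
    show "orthonormal_basis J" by fact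
  next
    fix i j assume ij: "i \<in> J" "j \<in> J"
    have "((\<lambda>y. co j y * b y) has_derivative
        (\<lambda>v. co j c * frechet_derivative b (at c) v + (v \<bullet> j) * b c)) (at c)"
      unfolding co_def
      by (intro has_derivative_mult smooth_on_frechet_derivative(2)[OF b(1)])
        (auto intro!: derivative_eq_intros)
    then have "((\<lambda>y. x j (inv_into U \<phi> y)) has_derivative
        (\<lambda>v. co j c * frechet_derivative b (at c) v + (v \<bullet> j) * b c)) (at c)"
      by (rule has_derivative_transform_within_open[OF _ S(1) r(2)])
        (use S(2) U(1) in \<open>auto simp: x_def chart_ext_def subset_iff image_iff\<close>)
    from D_eq[OF this, of i] have "D (x j) i c = i \<bullet> j" by (simp add: co_def b)
    then show "E i p (x j) = (if i = j then 1 else 0)"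
      using J ij U r xS b
      by (simp add: E_def Vf_def chart_ext_def c_def[symmetric] orthonormal_basis_def)
  next
    fix q v f assume v: "v \<in> \<T> q"
    show "\<rho> q * \<rho> q * v f = (\<Sum>j\<in>J. v (x j) * E j q f) + (\<Sum>j\<in>J. v \<rho> * E' j q f)"
    proof (cases "f \<in> \<S> \<and> q \<in> U \<and> \<phi> q \<in> S")
      case False
      then have "E j q f = 0" "E' j q f = 0" for j
        by (auto simp: E_def E'_def Vf_def chart_ext_def)
      moreover have "\<rho> q * \<rho> q * v f = 0"
        using False tangent_outside[OF v] by (auto simp: \<rho>_def chart_ext_def)
      ultimately show ?thesis by simp
    next
      case True
      then have f: "f \<in> \<S>" and q: "q \<in> U" "\<phi> q \<in> S" by auto
      have "smooth_on S (\<lambda>y. f (inv_into U \<phi> y))"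
        using smooth_in_chart[OF f U(1)] S(2) smooth_on_subset by blast
      then obtain g where g: "\<And>j. smooth_on S (g j)" "\<And>j. g j (\<phi> q) = D f j (\<phi> q)"
        "\<And>y. y \<in> S \<Longrightarrow> f (inv_into U \<phi> y) = f (inv_into U \<phi> (\<phi> q)) + (\<Sum>j\<in>J. ((y - \<phi> q) \<bullet> j) * g j y)"
        using hadamard_expansion[OF J S(1,3) q(2), of "\<lambda>y. f (inv_into U \<phi> y)"]
        unfolding D_def by blast
      define G where "G j = ?ext (\<lambda>y. b y * g j y)" for j
      have GS: "G j \<in> \<S>" for j
        unfolding G_def by (rule ext_smooth) (auto intro: smooth_on_mult S g bS b)
      define a where "a j = co j (\<phi> q)" for j
      have eq: "\<rho> q' * \<rho> q' * f q' = f q * (\<rho> q' * \<rho> q') + (\<Sum>j\<in>J. (x j q' - a j * \<rho> q') * G j q')" for q'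
      proof (cases "q' \<in> U \<and> \<phi> q' \<in> S")
        case True
        then have "f q' = f q + (\<Sum>j\<in>J. ((\<phi> q' - \<phi> q) \<bullet> j) * g j (\<phi> q'))"
          using g(3)[of "\<phi> q'"] q U(1) by simp
        then show ?thesis using True
          by (simp add: \<rho>_def x_def G_def chart_ext_def a_def co_def inner_diff_left
              sum_distrib_left algebra_simps)
      qed (auto simp: \<rho>_def x_def G_def chart_ext_def)
      have z: "x j q - a j * \<rho> q = 0" for j
        using q by (simp add: x_def a_def \<rho>_def chart_ext_def)
      have "v (\<lambda>q'. \<rho> q' * \<rho> q' * f q') = \<rho> q * \<rho> q * v f + f q * v (\<lambda>q'. \<rho> q' * \<rho> q')"
        using tangent_mult[OF v fun_mult[OF \<rho>S \<rho>S] f] by simp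
      moreover have "v (\<lambda>q'. \<rho> q' * \<rho> q' * f q') =
          f q * v (\<lambda>q'. \<rho> q' * \<rho> q') + (\<Sum>j\<in>J. G j q * (v (x j) - a j * v \<rho>))"
      proof -
        let ?d = "\<lambda>j q'. x j q' - a j * \<rho> q'"
        have d: "?d j \<in> \<S>" for j using xS \<rho>S by simp
        have "v (?d j) = v (x j) - a j * v \<rho>" for j
          using tangent_diff[OF v xS[of j], of "\<lambda>q'. a j * \<rho> q'"] tangent_cmult[OF v \<rho>S] \<rho>S by simp
        then have "v (\<lambda>q'. ?d j q' * G j q') = G j q * (v (x j) - a j * v \<rho>)" for j
          using tangent_mult[OF v d[of j] GS[of j]] z[of j] by simp
        then have "v (\<lambda>q'. \<Sum>j\<in>J. ?d j q' * G j q') = (\<Sum>j\<in>J. G j q * (v (x j) - a j * v \<rho>))"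
          using tangent_sum[OF v, of J "\<lambda>j q'. ?d j q' * G j q'"] d GS by simp
        moreover have "v (\<lambda>q'. f q * (\<rho> q' * \<rho> q')) = f q * v (\<lambda>q'. \<rho> q' * \<rho> q')"
          using tangent_cmult[OF v] \<rho>S by simp
        ultimately show ?thesis
          unfolding eq
          using tangent_add[OF v, of "\<lambda>q'. f q * (\<rho> q' * \<rho> q')" "\<lambda>q'. \<Sum>j\<in>J. ?d j q' * G j q'"]
            \<rho>S d GS by simp
      qed
      ultimately have "\<rho> q * \<rho> q * v f = (\<Sum>j\<in>J. G j q * (v (x j) - a j * v \<rho>))" by simp
      moreover have "E j q f = G j q" "E' j q f = - a j * G j q" for j
        using q f g(2) by (simp_all add: E_def E'_def Vf_def G_def chart_ext_def a_def)
      ultimately show ?thesis by (simp add: sum.distrib[symmetric] algebra_simps)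
    qed
  qed
qed

end

section \<open>Alternating forms in two and three arguments\<close>

text \<open>
  Tangent spaces and their duals are sets of real functions with pointwise operations; one lemma on
  subspaces of a function space serves both.
\<close>

definition fun_subspace :: "('b \<Rightarrow> real) set \<Rightarrow> bool" where
  "fun_subspace V \<longleftrightarrow> (\<lambda>_. 0) \<in> V \<and> (\<forall>u\<in>V. \<forall>w\<in>V. (\<lambda>x. u x + w x) \<in> V) \<and>
     (\<forall>c. \<forall>u\<in>V. (\<lambda>x. c * u x) \<in> V)"

lemma fun_subspace_sum:
  assumes "fun_subspace V" "\<And>i. i \<in> I \<Longrightarrow> u i \<in> V"
  shows "(\<lambda>x. \<Sum>i\<in>I. c i * u i x) \<in> V"
  using assms(2)
  by (induction I rule: infinite_finite_induct) (use assms(1) in \<open>auto simp: fun_subspace_def\<close>)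

lemma fun_subspace_dual_space: "fun_subspace V \<Longrightarrow> fun_subspace (dual_space V)"
  by (auto simp: fun_subspace_def dual_space_def algebra_simps)

lemma dual_space_sum:
  assumes "fun_subspace V" "\<alpha> \<in> dual_space V" "\<And>i. i \<in> I \<Longrightarrow> u i \<in> V"
  shows "\<alpha> (\<lambda>x. \<Sum>i\<in>I. c i * u i x) = (\<Sum>i\<in>I. c i * \<alpha> (u i))"
  using assms(3)
proof (induction I rule: infinite_finite_induct)
  case (insert j I)
  have "\<alpha> (\<lambda>x. c j * u j x + (\<Sum>i\<in>I. c i * u i x)) = \<alpha> (\<lambda>x. c j * u j x) + \<alpha> (\<lambda>x. \<Sum>i\<in>I. c i * u i x)"
    using assms(1,2) insert.prems fun_subspace_sum[OF assms(1), of I u c]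
    by (auto simp: dual_space_def fun_subspace_def)
  moreover have "\<alpha> (\<lambda>x. c j * u j x) = c j * \<alpha> (u j)"
    using assms(2) insert.prems by (auto simp: dual_space_def)
  ultimately show ?case using insert by simp
next
  have z: "\<alpha> (\<lambda>_. 0) = 0"
  proof -
    have "\<forall>c. \<forall>u\<in>V. \<alpha> (\<lambda>x. c * u x) = c * \<alpha> u" "(\<lambda>_. 0) \<in> V"
      using assms(1,2) unfolding dual_space_def fun_subspace_def by auto
    from bspec[OF spec[OF this(1), of 0] this(2)] have "\<alpha> (\<lambda>x. 0 * 0) = 0 * \<alpha> (\<lambda>_. 0)" .
    then show ?thesis by simp
  qed
  { case (infinite I) then show ?case using z by simp }
  { case empty then show ?case using z by simp }
qed

lemma alternating_outside:
  "T \<in> alternating_forms k V \<Longrightarrow> \<not> (length us = k \<and> set us \<subseteq> V) \<Longrightarrow> T us = 0"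
  unfolding alternating_forms_def by blast

lemma alternating_add:
  assumes "T \<in> alternating_forms k V" "length us = k" "set us \<subseteq> V" "i < k" "u \<in> V" "w \<in> V"
  shows "T (us[i := (\<lambda>x. u x + w x)]) = T (us[i := u]) + T (us[i := w])"
  using assms unfolding alternating_forms_def by blast

lemma alternating_cmult:
  assumes "T \<in> alternating_forms k V" "length us = k" "set us \<subseteq> V" "i < k" "u \<in> V"
  shows "T (us[i := (\<lambda>x. c * u x)]) = c * T (us[i := u])"
  using assms unfolding alternating_forms_def by blast

lemma alternating_eq_0:
  assumes "T \<in> alternating_forms k V" "length us = k" "set us \<subseteq> V" "i < j" "j < k" "us ! i = us ! j"
  shows "T us = 0"
  using assms unfolding alternating_forms_def by blast

lemma alternating2:
  assumes T: "T \<in> alternating_forms 2 V" and V: "fun_subspace V" and "u \<in> V" "w \<in> V" "a \<in> V"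
  shows alternating2_add_left: "T [\<lambda>x. u x + w x, a] = T [u, a] + T [w, a]"
    and alternating2_cmult_left: "T [\<lambda>x. c * u x, a] = c * T [u, a]"
    and alternating2_swap: "T [w, u] = - T [u, w]"
proof -
  have add0: "T [\<lambda>x. u x + w x, a] = T [u, a] + T [w, a]" if "u \<in> V" "w \<in> V" "a \<in> V" for u w a
    using alternating_add[OF T, of "[a, a]" 0] that by simp
  have add1: "T [a, \<lambda>x. u x + w x] = T [a, u] + T [a, w]" if "u \<in> V" "w \<in> V" "a \<in> V" for u w a
    using alternating_add[OF T, of "[a, a]" 1] that by simp
  have diag: "T [u, u] = 0" if "u \<in> V" for u
    using alternating_eq_0[OF T, of "[u, u]" 0 1] that by simp
  show "T [\<lambda>x. u x + w x, a] = T [u, a] + T [w, a]"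
    using add0 assms by auto
  show "T [\<lambda>x. c * u x, a] = c * T [u, a]"
    using alternating_cmult[OF T, of "[a, a]" 0] assms by simp
  have "(\<lambda>x. u x + w x) \<in> V" using V assms by (auto simp: fun_subspace_def)
  then have "0 = T [u, u] + T [w, u] + (T [u, w] + T [w, w])"
    using diag[of "\<lambda>x. u x + w x"] add0 add1 assms by simp
  then show "T [w, u] = - T [u, w]" using diag[of u] diag[of w] assms by simp
qed

lemma alternating3_swap:
  assumes T: "T \<in> alternating_forms 3 V" and V: "fun_subspace V" and "u \<in> V" "w \<in> V" "a \<in> V"
  shows "T [w, u, a] = - T [u, w, a]" and "T [a, w, u] = - T [a, u, w]"
proof -
  let ?s = "\<lambda>x. u x + w x"
  have s: "?s \<in> V" using V assms by (auto simp: fun_subspace_def)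
  have 1: "T [?s, ?s, a] = T [u, ?s, a] + T [w, ?s, a]"
    using alternating_add[OF T, of "[a, ?s, a]" 0] s assms by simp
  have 2: "T [b, ?s, a] = T [b, u, a] + T [b, w, a]" if "b \<in> V" for b
    using alternating_add[OF T, of "[b, a, a]" 1] that assms by simp
  have 3: "T [b, b, a] = 0" if "b \<in> V" for b
    using alternating_eq_0[OF T, of "[b, b, a]" 0 1] that assms by simp
  show "T [w, u, a] = - T [u, w, a]"
    using 1 2[of u] 2[of w] 3[of ?s] 3[of u] 3[of w] s assms by simp
  have 4: "T [a, ?s, ?s] = T [a, u, ?s] + T [a, w, ?s]"
    using alternating_add[OF T, of "[a, a, ?s]" 1] s assms by simp
  have 5: "T [a, b, ?s] = T [a, b, u] + T [a, b, w]" if "b \<in> V" for b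
    using alternating_add[OF T, of "[a, b, a]" 2] that assms by simp
  have 6: "T [a, b, b] = 0" if "b \<in> V" for b
    using alternating_eq_0[OF T, of "[a, b, b]" 1 2] that assms by simp
  show "T [a, w, u] = - T [a, u, w]"
    using 4 5[of u] 5[of w] 6[of ?s] 6[of u] 6[of w] s assms by simp
qed

lemma alternating2_sum:
  assumes T: "T \<in> alternating_forms 2 V" and V: "fun_subspace V" and "a \<in> V" "\<And>i. i \<in> I \<Longrightarrow> u i \<in> V"
  shows "T [\<lambda>x. \<Sum>i\<in>I. c i * u i x, a] = (\<Sum>i\<in>I. c i * T [u i, a])"
  using assms(4)
proof (induction I rule: infinite_finite_induct)
  case (insert j I)
  have "(\<lambda>x. c j * u j x) \<in> V" using V insert.prems by (auto simp: fun_subspace_def)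
  then have "T [\<lambda>x. c j * u j x + (\<Sum>i\<in>I. c i * u i x), a] =
      T [\<lambda>x. c j * u j x, a] + T [\<lambda>x. \<Sum>i\<in>I. c i * u i x, a]"
    using insert.prems assms(3)
    by (intro alternating2_add_left[OF T V] fun_subspace_sum[OF V]) auto
  moreover have "T [\<lambda>x. c j * u j x, a] = c j * T [u j, a]"
    using alternating2_cmult_left[OF T V, of "u j" "u j" a] insert.prems assms(3) by simp
  ultimately show ?case using insert by simp
next
  have z: "T [\<lambda>_. 0, a] = 0"
    using alternating2_cmult_left[OF T V, of a a a 0] assms(3) by simp
  { case (infinite I) then show ?case using z by simp }
  { case empty then show ?case using z by simp }
qed

lemma permutations_2: "{\<sigma>. \<sigma> permutes {..<2::nat}} = {id, Transposition.transpose 0 1}"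
  using permutes_doubleton_iff[of _ "0::nat" 1] by (auto simp: lessThan_Suc numeral_2_eq_2 insert_commute)

lemma wedge_2:
  assumes "k + l = 2"
  shows "wedge k l P Q p [a, b] =
    (P p (take k [a, b]) * Q p (drop k [a, b]) - P p (take k [b, a]) * Q p (drop k [b, a])) / (fact k * fact l)"
proof -
  have "Transposition.transpose 0 (1::nat) \<noteq> id" by (metis id_apply transpose_apply_first zero_neq_one)
  then have eq: "wedge k l P Q p [a, b] =
     (P p (map (\<lambda>i. [a, b] ! i) [0..<k]) * Q p (map (\<lambda>i. [a, b] ! i) [k..<2]) -
      P p (map (\<lambda>i. [a, b] ! (Transposition.transpose 0 1 i)) [0..<k]) *
      Q p (map (\<lambda>i. [a, b] ! (Transposition.transpose 0 1 i)) [k..<2])) / (fact k * fact l)"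
    unfolding wedge_def assms permutations_2 by (simp add: sign_swap_id)
  have upt: "[0..<2] = [0, Suc 0]" "[Suc 0..<2] = [Suc 0]" by (simp_all add: upt_rec)
  consider "k = 0" "l = 2" | "k = 1" "l = 1" | "k = 2" "l = 0" using assms by linarith
  then show ?thesis unfolding eq by cases (simp_all add: upt)
qed

section \<open>Differentials and decomposition of bivector fields\<close>

context smooth_manifold begin

lemma tangent_subspace: "fun_subspace (\<T> p)"
  by (simp add: fun_subspace_def)

lemma cotangent_subspace: "fun_subspace (\<T>' p)"
  unfolding cotangent_space_def by (rule fun_subspace_dual_space[OF tangent_subspace])

lemma covector_add: "\<alpha> \<in> \<T>' p \<Longrightarrow> u \<in> \<T> p \<Longrightarrow> w \<in> \<T> p \<Longrightarrow> \<alpha> (\<lambda>f. u f + w f) = \<alpha> u + \<alpha> w"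
  and covector_cmult: "\<alpha> \<in> \<T>' p \<Longrightarrow> u \<in> \<T> p \<Longrightarrow> \<alpha> (\<lambda>f. c * u f) = c * \<alpha> u"
  and covector_outside: "\<alpha> \<in> \<T>' p \<Longrightarrow> u \<notin> \<T> p \<Longrightarrow> \<alpha> u = 0"
  unfolding cotangent_space_def dual_space_def by blast+

lemma covector_sum:
  "\<alpha> \<in> \<T>' p \<Longrightarrow> (\<And>i. i \<in> I \<Longrightarrow> u i \<in> \<T> p) \<Longrightarrow> \<alpha> (\<lambda>f. \<Sum>i\<in>I. c i * u i f) = (\<Sum>i\<in>I. c i * \<alpha> (u i))"
  unfolding cotangent_space_def by (rule dual_space_sum[OF tangent_subspace])

definition differential :: "('m \<Rightarrow> real) \<Rightarrow> 'm one_form" where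
  "differential f p = (\<lambda>u. if u \<in> \<T> p then u f else 0)"

lemma differential_apply [simp]: "u \<in> \<T> p \<Longrightarrow> differential f p u = u f"
  by (simp add: differential_def)

lemma differential_cotangent [simp, intro]: "differential f p \<in> \<T>' p"
  by (auto simp: differential_def cotangent_space_def dual_space_def)

lemma differential_one_form [simp, intro]: "f \<in> \<S> \<Longrightarrow> differential f \<in> one_forms A"
  by (simp add: one_forms_def field_at field_smooth)

lemma differential_add:
  "f \<in> \<S> \<Longrightarrow> g \<in> \<S> \<Longrightarrow> differential (\<lambda>x. f x + g x) p = (\<lambda>u. differential f p u + differential g p u)"
  by (auto simp: differential_def tangent_add)

lemma differential_mult:
  "f \<in> \<S> \<Longrightarrow> g \<in> \<S> \<Longrightarrow>
    differential (\<lambda>x. f x * g x) p = (\<lambda>u. f p * differential g p u + g p * differential f p u)"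
  by (auto simp: differential_def tangent_mult)

text \<open>
  The indices \<open>(j, False)\<close> carry the cut-off coordinates and \<open>(j, True)\<close> the correction terms of the
  cut-off frame. A single index set makes this a finite expansion of the identity of every tangent
  space, scaled by \<open>w\<close>, which replaces a partition of unity: evaluation at \<open>p\<close> only needs \<open>w p = 1\<close>.
\<close>

lemma weighted_frame:
  obtains I :: "('e \<times> bool) set" and x E w where
    "finite I" "w \<in> \<S>" "w p = 1" "\<And>i. x i \<in> \<S>" "\<And>i. E i \<in> \<V>"
    "\<And>q v f. v \<in> \<T> q \<Longrightarrow> w q * v f = (\<Sum>i\<in>I. v (x i) * E i q f)"
proof -
  obtain J :: "'e set" and x E E' \<rho> where J: "finite J" and \<rho>: "\<rho> \<in> \<S>" "\<rho> p = 1"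
    and xE: "\<And>j. x j \<in> \<S>" "\<And>j. E j \<in> \<V>" "\<And>j. E' j \<in> \<V>"
    and fr: "\<And>q v f. v \<in> \<T> q \<Longrightarrow>
       \<rho> q * \<rho> q * v f = (\<Sum>j\<in>J. v (x j) * E j q f) + (\<Sum>j\<in>J. v \<rho> * E' j q f)"
    by (rule cutoff_coordinate_frame[of p]) (rule that, assumption+)
  let ?x = "\<lambda>(j, s). if s then \<rho> else x j" and ?E = "\<lambda>(j, s). if s then E' j else E j"
  show ?thesis
  proof (rule that[of "J \<times> UNIV" "\<lambda>q. \<rho> q * \<rho> q" ?x ?E])
    show "finite (J \<times> (UNIV :: bool set))" using J by simp
    fix q v f assume v: "v \<in> \<T> q"
    show "\<rho> q * \<rho> q * v f = (\<Sum>i\<in>J \<times> UNIV. v (?x i) * ?E i q f)"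
    proof -
      have "(\<Sum>i\<in>J \<times> UNIV. v (?x i) * ?E i q f) = (\<Sum>j\<in>J. \<Sum>s\<in>UNIV. v (?x (j, s)) * ?E (j, s) q f)"
        unfolding sum.cartesian_product by (intro sum.cong) auto
      then show ?thesis unfolding fr[OF v] by (simp add: UNIV_bool sum.distrib)
    qed
  qed (use \<rho> xE in \<open>auto split: prod.split\<close>)
qed

text \<open>At the point itself the cut-off coordinates differentiate to a dual pair of bases.\<close>

lemma dual_bases_at:
  obtains J :: "'e set" and x e where "orthonormal_basis J" "\<And>j. x j \<in> \<S>" "\<And>j. e j \<in> \<T> p"
    "\<And>v. v \<in> \<T> p \<Longrightarrow> v = (\<lambda>f. \<Sum>j\<in>J. v (x j) * e j f)"
    "\<And>i j. i \<in> J \<Longrightarrow> j \<in> J \<Longrightarrow> e i (x j) = (if i = j then 1 else 0)"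
proof -
  obtain J :: "'e set" and x E E' \<rho> where \<rho>: "\<rho> p = 1"
    and xE: "\<And>j. x j \<in> \<S>" "\<And>j. E j \<in> \<V>"
    and fr: "\<And>q v f. v \<in> \<T> q \<Longrightarrow>
       \<rho> q * \<rho> q * v f = (\<Sum>j\<in>J. v (x j) * E j q f) + (\<Sum>j\<in>J. v \<rho> * E' j q f)"
    and z: "\<And>j f. E' j p f = 0"
    and dl: "\<And>i j. i \<in> J \<Longrightarrow> j \<in> J \<Longrightarrow> E i p (x j) = (if i = j then 1 else 0)"
    and J: "orthonormal_basis J"
    by (rule cutoff_coordinate_frame[of p]) (rule that, assumption+)
  show ?thesis
  proof (rule that[of J x "\<lambda>j. E j p"])
    show "v = (\<lambda>f. \<Sum>j\<in>J. v (x j) * E j p f)" if "v \<in> \<T> p" for v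
    proof
      fix f
      have "\<rho> p * \<rho> p * v f = (\<Sum>j\<in>J. v (x j) * E j p f) + (\<Sum>j\<in>J. v \<rho> * E' j p f)"
        by (rule fr[OF that])
      then show "v f = (\<Sum>j\<in>J. v (x j) * E j p f)" unfolding \<rho> z by simp
    qed
  qed (use J xE dl field_at[OF xE(2)] in auto)
qed

text \<open>
  By this lemma it suffices to evaluate alternating forms on differentials of global functions, for
  which Lie derivatives and brackets reduce to derivatives of functions.
\<close>

lemma covector_is_differential:
  assumes "\<alpha> \<in> \<T>' p"
  obtains f where "f \<in> \<S>" "\<alpha> = differential f p"
proof -
  obtain J :: "'e set" and x e where x: "\<And>j. x j \<in> \<S>" and e: "\<And>j. e j \<in> \<T> p"
    and fr: "\<And>v. v \<in> \<T> p \<Longrightarrow> v = (\<lambda>f. \<Sum>j\<in>J. v (x j) * e j f)"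
    by (rule dual_bases_at[of p]) (rule that, assumption+)
  define f where "f = (\<lambda>q. \<Sum>j\<in>J. \<alpha> (e j) * x j q)"
  have f: "f \<in> \<S>" using x by (simp add: f_def)
  have "\<alpha> v = v f" if v: "v \<in> \<T> p" for v
  proof -
    have "\<alpha> v = \<alpha> (\<lambda>f. \<Sum>j\<in>J. v (x j) * e j f)" using fr[OF v] by (rule arg_cong)
    also have "\<dots> = (\<Sum>j\<in>J. v (x j) * \<alpha> (e j))" using e by (intro covector_sum[OF assms])
    also have "\<dots> = v f"
      unfolding f_def using x
      by (subst tangent_sum[OF v]) (auto simp: tangent_cmult[OF v] mult.commute)
    finally show ?thesis .
  qed
  then have "\<alpha> = differential f p"
    using covector_outside[OF assms] by (auto simp: differential_def)
  then show ?thesis using that f by blast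
qed

abbreviation "\<X> k \<equiv> k_vector_fields A k"

lemma kvf_at: "P \<in> \<X> k \<Longrightarrow> P p \<in> alternating_forms k (\<T>' p)"
  and kvf_smooth: "P \<in> \<X> k \<Longrightarrow> length \<alpha>s = k \<Longrightarrow> set \<alpha>s \<subseteq> one_forms A \<Longrightarrow>
    (\<lambda>p. P p (map (\<lambda>\<alpha>. \<alpha> p) \<alpha>s)) \<in> \<S>"
  unfolding k_vector_fields_def by blast+

lemmas bivector_swap = alternating2_swap[OF kvf_at cotangent_subspace]
lemmas bivector_sum = alternating2_sum[OF kvf_at cotangent_subspace]

lemma wedge_vec:
  assumes "X \<in> \<V>" "Y \<in> \<V>"
  shows "wedge 1 1 (mv_vec A X) (mv_vec A Y) p \<alpha>s =
    (if length \<alpha>s = 2 \<and> set \<alpha>s \<subseteq> \<T>' p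
     then (\<alpha>s ! 0) (X p) * (\<alpha>s ! 1) (Y p) - (\<alpha>s ! 1) (X p) * (\<alpha>s ! 0) (Y p) else 0)"
proof (cases "length \<alpha>s = 2")
  case True
  then obtain a b where "\<alpha>s = [a, b]" by (auto simp: length_Suc_conv numeral_2_eq_2)
  then show ?thesis by (simp add: wedge_2 mv_vec_def)
next
  case False
  then show ?thesis by (simp add: wedge_def)
qed

text \<open>
  Multiplied by a function with value \<open>1\<close> at \<open>p\<close>, a bivector field is a finite sum of wedge
  products of global vector fields, \<open>w\<^sup>2 P = \<Sum> 1/2 P(dx\<^sub>i, dx\<^sub>j) E\<^sub>i \<and> E\<^sub>j\<close>.
\<close>

lemma bivector_decomposition:
  assumes P: "P \<in> \<X> 2"
  obtains I :: "(('e \<times> bool) \<times> ('e \<times> bool)) set" and a b w where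
    "finite I" "w \<in> \<S>" "w p = 1" "\<And>i. a i \<in> \<V>" "\<And>i. b i \<in> \<V>"
    "(\<lambda>q \<alpha>s. w q * P q \<alpha>s) = (\<lambda>q \<alpha>s. \<Sum>i\<in>I. wedge 1 1 (mv_vec A (a i)) (mv_vec A (b i)) q \<alpha>s)"
proof -
  obtain I :: "('e \<times> bool) set" and x E w where I: "finite I" and w: "w \<in> \<S>" "w p = 1"
    and xE: "\<And>i. x i \<in> \<S>" "\<And>i. E i \<in> \<V>"
    and fr: "\<And>q v f. v \<in> \<T> q \<Longrightarrow> w q * v f = (\<Sum>i\<in>I. v (x i) * E i q f)"
    by (rule weighted_frame[of p]) (rule that, assumption+)
  define c where "c i j q = P q [differential (x i) q, differential (x j) q]" for i j q
  have c: "c i j \<in> \<S>" for i j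
    using kvf_smooth[OF P, of "[differential (x i), differential (x j)]"] xE
    by (simp add: c_def[abs_def])
  have cs: "c j i q = - c i j q" for i j q
    unfolding c_def by (rule bivector_swap[OF P differential_cotangent differential_cotangent differential_cotangent])
  define a where "a = (\<lambda>(i, j) q f. (1/2 * c i j q) * E i q f)"
  define b where "b = (\<lambda>(i :: 'e \<times> bool, j). E j)"
  have aV: "a i \<in> \<V>" and bV: "b i \<in> \<V>" for i
    by (cases i; simp only: a_def b_def prod.case field_fun_mult fun_mult fun_const c xE)+
  have cov: "(\<lambda>u. w q * \<alpha> u) = (\<lambda>u. \<Sum>i\<in>I. \<alpha> (E i q) * differential (x i) q u)" if \<alpha>: "\<alpha> \<in> \<T>' q" for q \<alpha>
  proof
    fix u
    show "w q * \<alpha> u = (\<Sum>i\<in>I. \<alpha> (E i q) * differential (x i) q u)"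
    proof (cases "u \<in> \<T> q")
      case True
      have "w q * \<alpha> u = \<alpha> (\<lambda>f. w q * u f)" using covector_cmult[OF \<alpha> True] by simp
      also have "\<dots> = \<alpha> (\<lambda>f. \<Sum>i\<in>I. u (x i) * E i q f)" using fr[OF True] by simp
      also have "\<dots> = (\<Sum>i\<in>I. u (x i) * \<alpha> (E i q))" using field_at[OF xE(2)] by (intro covector_sum[OF \<alpha>]) auto
      finally show ?thesis using True by (simp add: mult.commute)
    qed (simp add: covector_outside[OF \<alpha>] differential_def)
  qed
  have exp: "w q * w q * P q [\<alpha>, \<beta>] = (\<Sum>i\<in>I. \<Sum>j\<in>I. \<alpha> (E i q) * \<beta> (E j q) * c i j q)"
    if \<alpha>: "\<alpha> \<in> \<T>' q" and \<beta>: "\<beta> \<in> \<T>' q" for q \<alpha> \<beta>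
  proof -
    have left: "w q * P q [\<alpha>, \<gamma>] = (\<Sum>i\<in>I. \<alpha> (E i q) * P q [differential (x i) q, \<gamma>])"
      if "\<alpha> \<in> \<T>' q" "\<gamma> \<in> \<T>' q" for \<alpha> \<gamma>
    proof -
      have "w q * P q [\<alpha>, \<gamma>] = P q [\<lambda>u. w q * \<alpha> u, \<gamma>]"
        using alternating2_cmult_left[OF kvf_at[OF P] cotangent_subspace that(1) that(1) that(2)] by simp
      also have "\<dots> = (\<Sum>i\<in>I. \<alpha> (E i q) * P q [differential (x i) q, \<gamma>])"
        unfolding cov[OF that(1)] by (intro bivector_sum[OF P]) (use that in auto)
      finally show ?thesis .
    qed
    have "w q * P q [differential (x i) q, \<beta>] = (\<Sum>j\<in>I. \<beta> (E j q) * c i j q)" for i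
    proof -
      have "w q * P q [differential (x i) q, \<beta>] = - (w q * P q [\<beta>, differential (x i) q])"
        using bivector_swap[OF P \<beta> differential_cotangent \<beta>] by simp
      also have "\<dots> = (\<Sum>j\<in>I. \<beta> (E j q) * c i j q)"
        unfolding left[OF \<beta> differential_cotangent] c_def[symmetric]
        by (simp add: cs[of _ i] sum_negf)
      finally show ?thesis .
    qed
    then show ?thesis
      using left[OF \<alpha> \<beta>] by (simp add: mult.assoc sum_distrib_left mult.left_commute[of "w q"])
  qed
  have "w q * w q * P q \<alpha>s = (\<Sum>i\<in>I \<times> I. wedge 1 1 (mv_vec A (a i)) (mv_vec A (b i)) q \<alpha>s)" for q \<alpha>s
  proof (cases "length \<alpha>s = 2 \<and> set \<alpha>s \<subseteq> \<T>' q")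
    case True
    then obtain \<alpha> \<beta> where \<alpha>s: "\<alpha>s = [\<alpha>, \<beta>]" by (auto simp: length_Suc_conv numeral_2_eq_2)
    with True have \<alpha>: "\<alpha> \<in> \<T>' q" and \<beta>: "\<beta> \<in> \<T>' q" by auto
    have av: "\<gamma> (a (i, j) q) = 1/2 * c i j q * \<gamma> (E i q)" if "\<gamma> \<in> \<T>' q" for \<gamma> i j
      unfolding a_def using covector_cmult[OF that field_at[OF xE(2)], of "1/2 * c i j q" i] by simp
    have "(\<Sum>i\<in>I \<times> I. wedge 1 1 (mv_vec A (a i)) (mv_vec A (b i)) q \<alpha>s) =
       (\<Sum>i\<in>I. \<Sum>j\<in>I. 1/2 * (\<alpha> (E i q) * \<beta> (E j q) * c i j q)) + (\<Sum>i\<in>I. \<Sum>j\<in>I. 1/2 * (\<alpha> (E j q) * \<beta> (E i q) * c j i q))"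
    proof -
      have "wedge 1 1 (mv_vec A (a (i, j))) (mv_vec A (b (i, j))) q \<alpha>s =
          1/2 * (\<alpha> (E i q) * \<beta> (E j q) * c i j q) + 1/2 * (\<alpha> (E j q) * \<beta> (E i q) * c j i q)" for i j
        unfolding wedge_vec[OF aV bV]
        by (simp add: \<alpha>s \<alpha> \<beta> b_def cs[of j i] av[OF \<alpha>, of i j] av[OF \<beta>, of i j] mult_ac)
      then show ?thesis by (simp add: sum.cartesian_product' sum.distrib)
    qed
    also have "(\<Sum>i\<in>I. \<Sum>j\<in>I. 1/2 * (\<alpha> (E j q) * \<beta> (E i q) * c j i q)) =
        (\<Sum>i\<in>I. \<Sum>j\<in>I. 1/2 * (\<alpha> (E i q) * \<beta> (E j q) * c i j q))"
      by (rule sum.swap)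
    finally show ?thesis using exp[OF \<alpha> \<beta>] by (simp add: \<alpha>s sum_divide_distrib[symmetric])
  next
    case False
    then have "wedge 1 1 (mv_vec A (a i)) (mv_vec A (b i)) q \<alpha>s = 0" for i
      unfolding wedge_vec[OF aV bV] by (simp only: if_False)
    then show ?thesis using alternating_outside[OF kvf_at[OF P] False] by simp
  qed
  then show ?thesis
    using that[of "I \<times> I" "\<lambda>q. w q * w q" a b] I w aV bV by simp
qed

end

section \<open>The Schouten bracket of two bivector fields\<close>

lemma sum_permutations_3:
  "(\<Sum>\<sigma> | \<sigma> permutes {..<3::nat}. of_int (sign \<sigma>) * (G (\<sigma> 0) (\<sigma> 1) (\<sigma> 2) :: real)) =
    G 0 1 2 - G 1 0 2 - G 2 1 0 - G 0 2 1 + G 1 2 0 + G 2 0 1"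
proof -
  have ins: "{..<3::nat} = insert 2 {..<2}" by auto
  have ne: "Transposition.transpose 0 (1::nat) \<noteq> id" by (metis id_apply transpose_apply_first zero_neq_one)
  have perm: "permutation (Transposition.transpose a b)" for a b :: nat
    by (rule permutation_swap_id)
  have two: "{..<2} = {0, 1::nat}" by auto
  show ?thesis
    unfolding ins sum_over_permutations_insert[OF finite_lessThan, of "2::nat" 2, simplified] permutations_2
    using ne
    by (simp add: two sign_compose[OF perm perm] sign_swap_id Transposition.transpose_def)
qed

lemma wedge_2_1:
  assumes "R p \<in> alternating_forms 2 V" "fun_subspace V" "\<alpha> \<in> V" "\<beta> \<in> V" "\<gamma> \<in> V"
  shows "wedge 2 1 R Q p [\<alpha>, \<beta>, \<gamma>] =
      R p [\<alpha>, \<beta>] * Q p [\<gamma>] - R p [\<alpha>, \<gamma>] * Q p [\<beta>] + R p [\<beta>, \<gamma>] * Q p [\<alpha>]"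
    and "wedge 1 2 Q R p [\<alpha>, \<beta>, \<gamma>] =
      Q p [\<alpha>] * R p [\<beta>, \<gamma>] - Q p [\<beta>] * R p [\<alpha>, \<gamma>] + Q p [\<gamma>] * R p [\<alpha>, \<beta>]"
proof -
  note sw = alternating2_swap[OF assms(1,2)]
  have upt: "[0..<2] = [0, 1]" "[2..<3] = [2]" "[0..<1] = [0]" "[1..<3] = [1, 2]"
    by (simp_all add: upt_rec)
  have "wedge 2 1 R Q p [\<alpha>, \<beta>, \<gamma>] = (\<Sum>\<sigma> | \<sigma> permutes {..<3::nat}. of_int (sign \<sigma>) *
      (R p [[\<alpha>, \<beta>, \<gamma>] ! \<sigma> 0, [\<alpha>, \<beta>, \<gamma>] ! \<sigma> 1] * Q p [[\<alpha>, \<beta>, \<gamma>] ! \<sigma> 2])) / 2"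
    using upt by (simp add: wedge_def mult.assoc)
  then show "wedge 2 1 R Q p [\<alpha>, \<beta>, \<gamma>] =
      R p [\<alpha>, \<beta>] * Q p [\<gamma>] - R p [\<alpha>, \<gamma>] * Q p [\<beta>] + R p [\<beta>, \<gamma>] * Q p [\<alpha>]"
    using sw[of \<alpha> \<beta> \<alpha>] sw[of \<alpha> \<gamma> \<alpha>] sw[of \<beta> \<gamma> \<alpha>] assms(3-)
    unfolding sum_permutations_3[of "\<lambda>i j k. R p [[\<alpha>, \<beta>, \<gamma>] ! i, [\<alpha>, \<beta>, \<gamma>] ! j] * Q p [[\<alpha>, \<beta>, \<gamma>] ! k]"] by (simp add: algebra_simps)
  have "wedge 1 2 Q R p [\<alpha>, \<beta>, \<gamma>] = (\<Sum>\<sigma> | \<sigma> permutes {..<3::nat}. of_int (sign \<sigma>) *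
      (Q p [[\<alpha>, \<beta>, \<gamma>] ! \<sigma> 0] * R p [[\<alpha>, \<beta>, \<gamma>] ! \<sigma> 1, [\<alpha>, \<beta>, \<gamma>] ! \<sigma> 2])) / 2"
    using upt by (simp add: wedge_def mult.assoc numeral_2_eq_2 numeral_3_eq_3)
  then show "wedge 1 2 Q R p [\<alpha>, \<beta>, \<gamma>] =
      Q p [\<alpha>] * R p [\<beta>, \<gamma>] - Q p [\<beta>] * R p [\<alpha>, \<gamma>] + Q p [\<gamma>] * R p [\<alpha>, \<beta>]"
    using sw[of \<alpha> \<beta> \<alpha>] sw[of \<alpha> \<gamma> \<alpha>] sw[of \<beta> \<gamma> \<alpha>] assms(3-)
    unfolding sum_permutations_3[of "\<lambda>i j k. Q p [[\<alpha>, \<beta>, \<gamma>] ! i] * R p [[\<alpha>, \<beta>, \<gamma>] ! j, [\<alpha>, \<beta>, \<gamma>] ! k]"] by (simp add: algebra_simps)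
qed

lemma alternating_forms_2I:
  assumes "\<And>us. \<not> (length us = 2 \<and> set us \<subseteq> V) \<Longrightarrow> T us = 0"
    and "\<And>u w a. u \<in> V \<Longrightarrow> w \<in> V \<Longrightarrow> a \<in> V \<Longrightarrow> T [\<lambda>x. u x + w x, a] = T [u, a] + T [w, a]"
    and "\<And>u w a. u \<in> V \<Longrightarrow> w \<in> V \<Longrightarrow> a \<in> V \<Longrightarrow> T [a, \<lambda>x. u x + w x] = T [a, u] + T [a, w]"
    and "\<And>c u a. u \<in> V \<Longrightarrow> a \<in> V \<Longrightarrow> T [\<lambda>x. c * u x, a] = c * T [u, a]"
    and "\<And>c u a. u \<in> V \<Longrightarrow> a \<in> V \<Longrightarrow> T [a, \<lambda>x. c * u x] = c * T [a, u]"
    and "\<And>a. a \<in> V \<Longrightarrow> T [a, a] = 0"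
  shows "T \<in> alternating_forms 2 V"
  unfolding alternating_forms_def
proof (intro CollectI conjI allI impI)
  fix us assume "\<not> (length us = 2 \<and> set us \<subseteq> V)"
  then show "T us = 0" by (rule assms(1))
next
  fix us and i :: nat and u w assume a: "length us = 2 \<and> set us \<subseteq> V \<and> i < 2 \<and> u \<in> V \<and> w \<in> V"
  then obtain a b where us: "us = [a, b]" by (auto simp: length_Suc_conv numeral_2_eq_2)
  from a have "i = 0 \<or> i = 1" by auto
  then show "T (us[i := \<lambda>x. u x + w x]) = T (us[i := u]) + T (us[i := w])"
    using a assms(2,3) us by auto
next
  fix us and i :: nat and c u assume a: "length us = 2 \<and> set us \<subseteq> V \<and> i < 2 \<and> u \<in> V"
  then obtain a b where us: "us = [a, b]" by (auto simp: length_Suc_conv numeral_2_eq_2)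
  from a have "i = 0 \<or> i = 1" by auto
  then show "T (us[i := \<lambda>x. c * u x]) = c * T (us[i := u])"
    using a assms(4,5) us by auto
next
  fix us and i j :: nat assume a: "length us = 2 \<and> set us \<subseteq> V \<and> i < j \<and> j < 2 \<and> us ! i = us ! j"
  then obtain a b where us: "us = [a, b]" by (auto simp: length_Suc_conv numeral_2_eq_2)
  from a have ij: "i = 0" "j = 1" by auto
  have "us ! i = us ! j" using a by blast
  then have "a = b" unfolding ij us by simp
  moreover have "a \<in> V" using a us by simp
  ultimately show "T us = 0" using assms(6) us by simp
qed

context smooth_manifold begin

lemma kvf_2I:
  assumes "\<And>p. P p \<in> alternating_forms 2 (\<T>' p)"
    and "\<And>\<alpha> \<beta>. \<alpha> \<in> one_forms A \<Longrightarrow> \<beta> \<in> one_forms A \<Longrightarrow> (\<lambda>p. P p [\<alpha> p, \<beta> p]) \<in> \<S>"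
  shows "P \<in> \<X> 2"
  unfolding k_vector_fields_def
proof (intro CollectI conjI allI impI assms(1))
  fix \<alpha>s assume a: "length \<alpha>s = 2 \<and> set \<alpha>s \<subseteq> one_forms A"
  then obtain \<alpha> \<beta> where "\<alpha>s = [\<alpha>, \<beta>]" by (auto simp: length_Suc_conv numeral_2_eq_2)
  then show "(\<lambda>p. P p (map (\<lambda>\<alpha>. \<alpha> p) \<alpha>s)) \<in> \<S>" using a assms(2) by simp
qed

lemma one_form_smooth: "\<alpha> \<in> one_forms A \<Longrightarrow> X \<in> \<V> \<Longrightarrow> (\<lambda>p. \<alpha> p (X p)) \<in> \<S>"
  and one_form_at: "\<alpha> \<in> one_forms A \<Longrightarrow> \<alpha> p \<in> \<T>' p"
  by (simp_all add: one_forms_def)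

lemma mv_fun_kvf: "h \<in> \<S> \<Longrightarrow> mv_fun h \<in> \<X> 0"
  by (simp add: k_vector_fields_def alternating_forms_def mv_fun_def)

lemma mv_vec_kvf: assumes "X \<in> \<V>" shows "mv_vec A X \<in> \<X> 1"
proof -
  have sub: "\<And>u w. u \<in> \<T>' p \<Longrightarrow> w \<in> \<T>' p \<Longrightarrow> (\<lambda>x. u x + w x) \<in> \<T>' p"
    "\<And>c u. u \<in> \<T>' p \<Longrightarrow> (\<lambda>x. c * u x) \<in> \<T>' p" for p
    using cotangent_subspace by (auto simp: fun_subspace_def)
  have "mv_vec A X p \<in> alternating_forms 1 (\<T>' p)" for p
    unfolding alternating_forms_def
    by (auto simp: mv_vec_def length_Suc_conv sub)
  moreover have "(\<lambda>p. mv_vec A X p (map (\<lambda>\<alpha>. \<alpha> p) \<alpha>s)) \<in> \<S>"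
    if \<alpha>s: "length \<alpha>s = 1 \<and> set \<alpha>s \<subseteq> one_forms A" for \<alpha>s
  proof -
    obtain \<alpha> where "\<alpha>s = [\<alpha>]" "\<alpha> \<in> one_forms A" using \<alpha>s by (auto simp: length_Suc_conv)
    then show ?thesis using one_form_smooth[OF _ assms] one_form_at by (simp add: mv_vec_def)
  qed
  ultimately show ?thesis by (simp add: k_vector_fields_def)
qed

lemma wedge_vec_kvf: assumes "X \<in> \<V>" "Y \<in> \<V>" shows "wedge 1 1 (mv_vec A X) (mv_vec A Y) \<in> \<X> 2"
proof (rule kvf_2I)
  have sub: "\<And>u w. u \<in> \<T>' p \<Longrightarrow> w \<in> \<T>' p \<Longrightarrow> (\<lambda>x. u x + w x) \<in> \<T>' p"
    "\<And>c u. u \<in> \<T>' p \<Longrightarrow> (\<lambda>x. c * u x) \<in> \<T>' p" for p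
    using cotangent_subspace by (auto simp: fun_subspace_def)
  show "wedge 1 1 (mv_vec A X) (mv_vec A Y) p \<in> alternating_forms 2 (\<T>' p)" for p
    by (rule alternating_forms_2I) (simp_all only: wedge_vec[OF assms], auto simp: sub algebra_simps)
  show "(\<lambda>p. wedge 1 1 (mv_vec A X) (mv_vec A Y) p [\<alpha> p, \<beta> p]) \<in> \<S>"
    if "\<alpha> \<in> one_forms A" "\<beta> \<in> one_forms A" for \<alpha> \<beta>
    unfolding wedge_vec[OF assms]
    using that by (simp add: one_form_at one_form_smooth assms)
qed

lemma kvf_add:
  assumes "P \<in> \<X> k" "Q \<in> \<X> k" shows "(\<lambda>q \<alpha>s. P q \<alpha>s + Q q \<alpha>s) \<in> \<X> k"
  using assms by (simp add: k_vector_fields_def alternating_forms_def algebra_simps)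

lemma kvf_scale:
  assumes "h \<in> \<S>" "P \<in> \<X> k" shows "(\<lambda>q \<alpha>s. h q * P q \<alpha>s) \<in> \<X> k"
  using assms by (simp add: k_vector_fields_def alternating_forms_def algebra_simps)

lemma kvf_zero: "(\<lambda>q \<alpha>s. 0) \<in> \<X> k"
  by (simp add: k_vector_fields_def alternating_forms_def)

lemma kvf_sum:
  "(\<And>i. i \<in> I \<Longrightarrow> P i \<in> \<X> k) \<Longrightarrow> (\<lambda>q \<alpha>s. \<Sum>i\<in>I. P i q \<alpha>s) \<in> \<X> k"
  by (induction I rule: infinite_finite_induct) (simp_all add: kvf_zero kvf_add)

lemma wedge_fun:
  assumes "P \<in> \<X> 2" shows "wedge 0 2 (mv_fun h) P = (\<lambda>q \<alpha>s. h q * P q \<alpha>s)"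
proof (intro ext)
  fix q \<alpha>s
  show "wedge 0 2 (mv_fun h) P q \<alpha>s = h q * P q \<alpha>s"
  proof (cases "length \<alpha>s = 2")
    case True
    then obtain \<alpha> \<beta> where \<alpha>s: "\<alpha>s = [\<alpha>, \<beta>]" by (auto simp: length_Suc_conv numeral_2_eq_2)
    have "P q [\<beta>, \<alpha>] = - P q [\<alpha>, \<beta>]"
      using bivector_swap[OF assms, of \<alpha> q \<beta> \<alpha>] alternating_outside[OF kvf_at[OF assms, of q]]
      by (cases "\<alpha> \<in> \<T>' q \<and> \<beta> \<in> \<T>' q") auto
    then show ?thesis by (simp add: \<alpha>s wedge_2 mv_fun_def)
  next
    case False
    then show ?thesis using alternating_outside[OF kvf_at[OF assms]] by (simp add: wedge_def)
  qed
qed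

lemma wedge_eq_0:
  "(\<And>us. P p us = 0) \<Longrightarrow> wedge k l P Q p \<alpha>s = 0" "(\<And>us. Q p us = 0) \<Longrightarrow> wedge k l P Q p \<alpha>s = 0"
  by (simp_all add: wedge_def)

subsection \<open>The bracket of functions of a bivector field\<close>

definition pbr :: "'m mvfield \<Rightarrow> ('m \<Rightarrow> real) \<Rightarrow> ('m \<Rightarrow> real) \<Rightarrow> 'm \<Rightarrow> real" where
  "pbr P f g q = P q [differential f q, differential g q]"

lemma pbr_smooth: "P \<in> \<X> 2 \<Longrightarrow> f \<in> \<S> \<Longrightarrow> g \<in> \<S> \<Longrightarrow> pbr P f g \<in> \<S>"
  using kvf_smooth[of P 2 "[differential f, differential g]"] by (simp add: pbr_def[abs_def])

lemma pbr_add: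
  assumes "P \<in> \<X> 2" "f \<in> \<S>" "f' \<in> \<S>"
  shows "pbr P (\<lambda>x. f x + f' x) g q = pbr P f g q + pbr P f' g q"
  unfolding pbr_def differential_add[OF assms(2,3)]
  by (rule alternating2_add_left[OF kvf_at[OF assms(1)] cotangent_subspace]) auto

lemma pbr_mult:
  assumes "P \<in> \<X> 2" "f \<in> \<S>" "f' \<in> \<S>"
  shows "pbr P (\<lambda>x. f x * f' x) g q = f q * pbr P f' g q + f' q * pbr P f g q"
proof -
  note r = kvf_at[OF assms(1)] cotangent_subspace
  have c: "(\<lambda>u. k * differential h q u) \<in> \<T>' q" for k h
    using cotangent_subspace by (auto simp: fun_subspace_def)
  show ?thesis
    unfolding pbr_def differential_mult[OF assms(2,3)]
      alternating2_add_left[OF r c c differential_cotangent]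
    using alternating2_cmult_left[OF r differential_cotangent differential_cotangent differential_cotangent]
    by simp
qed

text \<open>The polarisation of the Jacobiator: \<open>jac P P\<close> is twice the Jacobiator of \<open>pbr P\<close>.\<close>

definition jac :: "'m mvfield \<Rightarrow> 'm mvfield \<Rightarrow> ('m \<Rightarrow> real) \<Rightarrow> ('m \<Rightarrow> real) \<Rightarrow> ('m \<Rightarrow> real) \<Rightarrow> 'm \<Rightarrow> real" where
  "jac P Q f g h p =
     pbr P (pbr Q f g) h p + pbr P (pbr Q g h) f p + pbr P (pbr Q h f) g p +
     pbr Q (pbr P f g) h p + pbr Q (pbr P g h) f p + pbr Q (pbr P h f) g p"

lemma jac_sym: "jac P Q f g h p = jac Q P f g h p"
  by (simp add: jac_def)

lemma jac_add:
  assumes "P \<in> \<X> 2" "P' \<in> \<X> 2" "Q \<in> \<X> 2" "f \<in> \<S>" "g \<in> \<S>" "h \<in> \<S>"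
  shows "jac (\<lambda>q \<alpha>s. P q \<alpha>s + P' q \<alpha>s) Q f g h p = jac P Q f g h p + jac P' Q f g h p"
proof -
  have "pbr (\<lambda>q \<alpha>s. P q \<alpha>s + P' q \<alpha>s) f g = (\<lambda>q. pbr P f g q + pbr P' f g q)" for f g
    by (simp add: pbr_def[abs_def])
  then show ?thesis using assms by (simp add: jac_def pbr_add pbr_smooth)
qed

end

locale schouten = smooth_manifold A
  for A :: "('m::{t2_space,second_countable_topology}, 'e::{real_inner,banach,heine_borel}) atlas" +
  fixes B :: "nat \<Rightarrow> nat \<Rightarrow> 'm mvfield \<Rightarrow> 'm mvfield \<Rightarrow> 'm mvfield"
  assumes bracket: "schouten_bracket A B"
begin

lemma bracket_closed: "P \<in> \<X> k \<Longrightarrow> Q \<in> \<X> l \<Longrightarrow> B k l P Q \<in> \<X> (k + l - 1)"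
  and bracket_add: "P \<in> \<X> k \<Longrightarrow> P' \<in> \<X> k \<Longrightarrow> Q \<in> \<X> l \<Longrightarrow>
    B k l (\<lambda>p \<alpha>s. P p \<alpha>s + P' p \<alpha>s) Q = (\<lambda>p \<alpha>s. B k l P Q p \<alpha>s + B k l P' Q p \<alpha>s)"
  and bracket_cmult: "P \<in> \<X> k \<Longrightarrow> Q \<in> \<X> l \<Longrightarrow>
    B k l (\<lambda>p \<alpha>s. c * P p \<alpha>s) Q = (\<lambda>p \<alpha>s. c * B k l P Q p \<alpha>s)"
  and bracket_vec: "X \<in> \<V> \<Longrightarrow> Y \<in> \<V> \<Longrightarrow> B 1 1 (mv_vec A X) (mv_vec A Y) = mv_vec A (lie_bracket X Y)"
  and bracket_wedge: "P \<in> \<X> k \<Longrightarrow> Q \<in> \<X> l \<Longrightarrow> R \<in> \<X> m \<Longrightarrow>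
    B k (l + m) P (wedge l m Q R) = (\<lambda>p \<alpha>s.
          wedge (k + l - 1) m (B k l P Q) R p \<alpha>s +
          (-1) ^ ((k + 1) * l) * wedge l (k + m - 1) Q (B k m P R) p \<alpha>s)"
  and bracket_swap: "P \<in> \<X> k \<Longrightarrow> Q \<in> \<X> l \<Longrightarrow>
    B k l P Q = (\<lambda>p \<alpha>s. - ((-1) ^ ((k + 1) * (l + 1))) * B l k Q P p \<alpha>s)"
proof -
  note ax = bracket[unfolded schouten_bracket_def]
  note ax2 = ax[THEN conjunct2] note ax3 = ax2[THEN conjunct2] note ax4 = ax3[THEN conjunct2]
  note ax5 = ax4[THEN conjunct2] note ax6 = ax5[THEN conjunct2] note ax7 = ax6[THEN conjunct2]
  note ax8 = ax7[THEN conjunct2] note ax9 = ax8[THEN conjunct2]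
  show "P \<in> \<X> k \<Longrightarrow> Q \<in> \<X> l \<Longrightarrow> B k l P Q \<in> \<X> (k + l - 1)"
    using ax[THEN conjunct1, rule_format] .
  show "P \<in> \<X> k \<Longrightarrow> P' \<in> \<X> k \<Longrightarrow> Q \<in> \<X> l \<Longrightarrow>
    B k l (\<lambda>p \<alpha>s. P p \<alpha>s + P' p \<alpha>s) Q = (\<lambda>p \<alpha>s. B k l P Q p \<alpha>s + B k l P' Q p \<alpha>s)"
    using ax2[THEN conjunct1, rule_format] .
  show "P \<in> \<X> k \<Longrightarrow> Q \<in> \<X> l \<Longrightarrow>
    B k l (\<lambda>p \<alpha>s. c * P p \<alpha>s) Q = (\<lambda>p \<alpha>s. c * B k l P Q p \<alpha>s)"
    using ax4[THEN conjunct1, rule_format, THEN conjunct1] .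
  show "X \<in> \<V> \<Longrightarrow> Y \<in> \<V> \<Longrightarrow> B 1 1 (mv_vec A X) (mv_vec A Y) = mv_vec A (lie_bracket X Y)"
    using ax7[THEN conjunct1, rule_format] .
  show "P \<in> \<X> k \<Longrightarrow> Q \<in> \<X> l \<Longrightarrow> R \<in> \<X> m \<Longrightarrow>
    B k (l + m) P (wedge l m Q R) = (\<lambda>p \<alpha>s.
          wedge (k + l - 1) m (B k l P Q) R p \<alpha>s +
          (-1) ^ ((k + 1) * l) * wedge l (k + m - 1) Q (B k m P R) p \<alpha>s)"
    using ax8[THEN conjunct1, rule_format] .
  show "P \<in> \<X> k \<Longrightarrow> Q \<in> \<X> l \<Longrightarrow>
    B k l P Q = (\<lambda>p \<alpha>s. - ((-1) ^ ((k + 1) * (l + 1))) * B l k Q P p \<alpha>s)"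
    using ax9[rule_format] .
qed

text \<open>
  The relation is kept for a fixed point and a pair of bivector fields, since each of the two
  arguments is reduced to wedge products separately.
\<close>

definition matches_jac :: "'m \<Rightarrow> 'm mvfield \<Rightarrow> 'm mvfield \<Rightarrow> bool" where
  "matches_jac p P Q \<longleftrightarrow> (\<forall>f\<in>\<S>. \<forall>g\<in>\<S>. \<forall>h\<in>\<S>.
     B 2 2 P Q p [differential f p, differential g p, differential h p] = - jac P Q f g h p)"

lemma matches_jac_sym:
  assumes "P \<in> \<X> 2" "Q \<in> \<X> 2" "matches_jac p P Q" shows "matches_jac p Q P"
  using assms bracket_swap[OF assms(2,1)] by (simp add: matches_jac_def jac_sym[of Q P])

lemma matches_jac_add:
  assumes "P \<in> \<X> 2" "P' \<in> \<X> 2" "Q \<in> \<X> 2" "matches_jac p P Q" "matches_jac p P' Q"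
  shows "matches_jac p (\<lambda>q \<alpha>s. P q \<alpha>s + P' q \<alpha>s) Q"
  using assms(4,5) by (simp add: matches_jac_def jac_add assms(1-3) bracket_add)

lemma matches_jac_zero:
  assumes "Q \<in> \<X> 2" shows "matches_jac p (\<lambda>q \<alpha>s. 0) Q"
proof -
  have "pbr (\<lambda>q \<alpha>s. 0) f g = (\<lambda>_. 0)" for f g by (simp add: pbr_def[abs_def])
  moreover have "pbr Q (\<lambda>_. 0) g p = 0" for g
    using pbr_mult[OF assms, of "\<lambda>_. 0" "\<lambda>_. 0" g p] by simp
  ultimately show ?thesis
    using bracket_cmult[OF kvf_zero assms, where c = 0] by (simp add: matches_jac_def jac_def)
qed

lemma matches_jac_sum:
  assumes "Q \<in> \<X> 2" "\<And>i. i \<in> I \<Longrightarrow> P i \<in> \<X> 2" "\<And>i. i \<in> I \<Longrightarrow> matches_jac p (P i) Q"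
  shows "matches_jac p (\<lambda>q \<alpha>s. \<Sum>i\<in>I. P i q \<alpha>s) Q"
  using assms(2,3)
  by (induction I rule: infinite_finite_induct)
    (simp_all add: matches_jac_zero assms(1) matches_jac_add kvf_sum)

text \<open>
  Both sides are differential operators of order one in each bivector field, and so vanish at \<open>p\<close>
  on a field with a double zero there; for the bracket this follows from the Leibniz rule for
  the product of \<open>h\<close> and \<open>h P\<close>.
\<close>

lemma matches_jac_double_zero:
  assumes P: "P \<in> \<X> 2" and Q: "Q \<in> \<X> 2" and h: "h \<in> \<S>" "h p = 0"
  shows "matches_jac p (\<lambda>q \<alpha>s. h q * (h q * P q \<alpha>s)) Q"
proof -
  let ?R = "\<lambda>q \<alpha>s. h q * P q \<alpha>s" and ?RR = "\<lambda>q \<alpha>s. h q * (h q * P q \<alpha>s)"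
  have R: "?R \<in> \<X> 2" and RR: "?RR \<in> \<X> 2" using P h by (simp_all add: kvf_scale)
  have "B 2 2 Q ?RR p \<alpha>s = 0" for \<alpha>s
  proof -
    have "wedge (2 + 0 - 1) 2 (B 2 0 Q (mv_fun h)) ?R p \<alpha>s = 0"
      by (rule wedge_eq_0(2)) (simp add: h(2))
    moreover have "wedge 0 (2 + 2 - 1) (mv_fun h) (B 2 2 Q ?R) p \<alpha>s = 0"
      by (rule wedge_eq_0(1)) (simp add: mv_fun_def h(2))
    ultimately show ?thesis
      using bracket_wedge[OF Q mv_fun_kvf[OF h(1)] R, THEN fun_cong, THEN fun_cong, of p \<alpha>s]
      unfolding wedge_fun[OF R] add_0 by simp
  qed
  then have br: "B 2 2 ?RR Q p \<alpha>s = 0" for \<alpha>s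
    using bracket_swap[OF RR Q] by simp
  have e: "pbr ?RR f g = (\<lambda>q. h q * (h q * pbr P f g q))" for f g
    by (simp add: pbr_def[abs_def])
  have "pbr Q (\<lambda>q. h q * (h q * u q)) k p = 0" if "u \<in> \<S>" for u k
    using pbr_mult[OF Q h(1) fun_mult[OF h(1) that]] h(2) by simp
  then have "jac ?RR Q f g k p = 0" if "f \<in> \<S>" "g \<in> \<S>" "k \<in> \<S>" for f g k
    using that h(2) P by (simp add: jac_def e pbr_smooth)
  then show ?thesis using br by (simp add: matches_jac_def)
qed

text \<open>
  For wedge products of vector fields the Leibniz rule reduces the bracket to Lie brackets, and both
  sides become polynomials in the first and second derivatives of \<open>f\<close>, \<open>g\<close> and \<open>h\<close> along the four
  fields.
\<close>

lemma matches_jac_decomposable: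
  assumes V: "a \<in> \<V>" "b \<in> \<V>" "c \<in> \<V>" "d \<in> \<V>"
  shows "matches_jac p (wedge 1 1 (mv_vec A a) (mv_vec A b)) (wedge 1 1 (mv_vec A c) (mv_vec A d))"
proof -
  let ?ab = "wedge 1 1 (mv_vec A a) (mv_vec A b)" and ?cd = "wedge 1 1 (mv_vec A c) (mv_vec A d)"
  note V1 = V[THEN mv_vec_kvf]
  have ab: "?ab \<in> \<X> 2" by (rule wedge_vec_kvf) fact+
  have B21: "B 2 1 ?ab (mv_vec A x) p [\<alpha>, \<beta>] =
      - ((\<alpha> (lie_bracket x a p) * \<beta> (b p) - \<beta> (lie_bracket x a p) * \<alpha> (b p)) +
         (\<alpha> (a p) * \<beta> (lie_bracket x b p) - \<beta> (a p) * \<alpha> (lie_bracket x b p)))"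
    if "x \<in> \<V>" "\<alpha> \<in> \<T>' p" "\<beta> \<in> \<T>' p" for x \<alpha> \<beta>
  proof -
    have "B 1 2 (mv_vec A x) ?ab = (\<lambda>p \<alpha>s.
        wedge 1 1 (mv_vec A (lie_bracket x a)) (mv_vec A b) p \<alpha>s +
        wedge 1 1 (mv_vec A a) (mv_vec A (lie_bracket x b)) p \<alpha>s)"
      using bracket_wedge[OF mv_vec_kvf[OF that(1)] V1(1,2)]
      by (simp add: bracket_vec[unfolded One_nat_def] that V numeral_2_eq_2)
    then have "B 2 1 ?ab (mv_vec A x) p [\<alpha>, \<beta>] =
      - (wedge 1 1 (mv_vec A (lie_bracket x a)) (mv_vec A b) p [\<alpha>, \<beta>] +
        wedge 1 1 (mv_vec A a) (mv_vec A (lie_bracket x b)) p [\<alpha>, \<beta>])"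
      using bracket_swap[OF ab mv_vec_kvf[OF that(1)]] by simp
    also have "\<dots> = - ((\<alpha> (lie_bracket x a p) * \<beta> (b p) - \<beta> (lie_bracket x a p) * \<alpha> (b p)) +
         (\<alpha> (a p) * \<beta> (lie_bracket x b p) - \<beta> (a p) * \<alpha> (lie_bracket x b p)))"
      unfolding wedge_vec[OF lie_bracket_field[OF that(1) V(1)] V(2)]
        wedge_vec[OF V(1) lie_bracket_field[OF that(1) V(2)]]
      using that by simp
    finally show ?thesis .
  qed
  have B21k: "B 2 1 ?ab (mv_vec A x) \<in> \<X> 2" if "x \<in> \<V>" for x
    using bracket_closed[OF ab mv_vec_kvf[OF that]] by simp
  have B22: "B 2 2 ?ab ?cd p \<alpha>s = wedge 2 1 (B 2 1 ?ab (mv_vec A c)) (mv_vec A d) p \<alpha>s -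
      wedge 1 2 (mv_vec A c) (B 2 1 ?ab (mv_vec A d)) p \<alpha>s" for \<alpha>s
    using bracket_wedge[OF ab V1(3,4)] by (simp add: numeral_2_eq_2)
  have pw: "pbr (wedge 1 1 (mv_vec A x) (mv_vec A y)) f g q = x q f * y q g - x q g * y q f"
    if "x \<in> \<V>" "y \<in> \<V>" for x y f g q
    unfolding pbr_def wedge_vec[OF that] using that by (simp add: field_at)
  have pp: "pbr (wedge 1 1 (mv_vec A x) (mv_vec A y)) (pbr (wedge 1 1 (mv_vec A z) (mv_vec A u)) f g) k p =
      (z p f * x p (\<lambda>q. u q g) + u p g * x p (\<lambda>q. z q f) - z p g * x p (\<lambda>q. u q f) - u p f * x p (\<lambda>q. z q g)) * y p k -
      x p k * (z p f * y p (\<lambda>q. u q g) + u p g * y p (\<lambda>q. z q f) - z p g * y p (\<lambda>q. u q f) - u p f * y p (\<lambda>q. z q g))"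
    if W: "x \<in> \<V>" "y \<in> \<V>" "z \<in> \<V>" "u \<in> \<V>" and F: "f \<in> \<S>" "g \<in> \<S>" for x y z u f g k
  proof -
    have e: "pbr (wedge 1 1 (mv_vec A z) (mv_vec A u)) f g = (\<lambda>q. z q f * u q g - z q g * u q f)"
      using pw[OF W(3,4)] by (intro ext)
    have "v (\<lambda>q. z q f * u q g - z q g * u q f) =
        z p f * v (\<lambda>q. u q g) + u p g * v (\<lambda>q. z q f) - z p g * v (\<lambda>q. u q f) - u p f * v (\<lambda>q. z q g)"
      if v: "v \<in> \<T> p" for v
      using W F by (simp add: tangent_diff[OF v] tangent_mult[OF v] field_smooth)
    from this[OF field_at[OF W(1)]] this[OF field_at[OF W(2)]] show ?thesis
      unfolding pw[OF W(1,2)] e by simp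
  qed
  show ?thesis
    unfolding matches_jac_def
  proof (intro ballI)
    fix f g h assume F: "f \<in> \<S>" "g \<in> \<S>" "h \<in> \<S>"
    have mv: "mv_vec A x p [differential k p] = x p k" if "x \<in> \<V>" for x k
      using that by (simp add: mv_vec_def field_at)
    have lb: "differential k p (lie_bracket x y p) = x p (\<lambda>q. y q k) - y p (\<lambda>q. x q k)"
      if "x \<in> \<V>" "y \<in> \<V>" for x y k
      unfolding differential_apply[OF field_at[OF lie_bracket_field[OF that]]]
      by (simp add: lie_bracket_def)
    have df: "differential k p (x p) = x p k" if "x \<in> \<V>" for x k
      using that by (simp add: field_at)
    show "B 2 2 ?ab ?cd p [differential f p, differential g p, differential h p] = - jac ?ab ?cd f g h p"
      unfolding B22 wedge_2_1(1)[where R = "B 2 1 ?ab (mv_vec A c)" and p = p, OF kvf_at[OF B21k[OF V(3)]] cotangent_subspace differential_cotangent differential_cotangent differential_cotangent]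
        wedge_2_1(2)[where R = "B 2 1 ?ab (mv_vec A d)" and p = p, OF kvf_at[OF B21k[OF V(4)]] cotangent_subspace differential_cotangent differential_cotangent differential_cotangent]
        B21[OF V(3) differential_cotangent differential_cotangent]
        B21[OF V(4) differential_cotangent differential_cotangent]
        mv[OF V(3)] mv[OF V(4)] jac_def
        lb[OF V(3,1)] lb[OF V(3,2)] lb[OF V(4,1)] lb[OF V(4,2)] df[OF V(1)] df[OF V(2)]
        pp[OF V F(1,2)] pp[OF V F(2,3)] pp[OF V F(3,1)]
        pp[OF V(3,4,1,2) F(1,2)] pp[OF V(3,4,1,2) F(2,3)] pp[OF V(3,4,1,2) F(3,1)]
      by algebra
  qed
qed

text \<open>
  With \<open>g = 1 - h\<^sup>2\<close>, \<open>h = 1 - w\<close> and \<open>w p = 1\<close>, the function \<open>g\<close> is a multiple of \<open>w\<close>, so that \<open>g P\<close>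
  is a sum of wedge products, and \<open>P - g P\<close> has a double zero at \<open>p\<close>.
\<close>

lemma matches_jac_if_decomposable:
  assumes Q: "Q \<in> \<X> 2" and P: "P \<in> \<X> 2"
    and dec: "\<And>a b. a \<in> \<V> \<Longrightarrow> b \<in> \<V> \<Longrightarrow> matches_jac p (wedge 1 1 (mv_vec A a) (mv_vec A b)) Q"
  shows "matches_jac p P Q"
proof -
  obtain I :: "(('e \<times> bool) \<times> ('e \<times> bool)) set" and a b w where w: "w \<in> \<S>" "w p = 1"
    and ab: "\<And>i. a i \<in> \<V>" "\<And>i. b i \<in> \<V>"
    and eq: "(\<lambda>q \<alpha>s. w q * P q \<alpha>s) = (\<lambda>q \<alpha>s. \<Sum>i\<in>I. wedge 1 1 (mv_vec A (a i)) (mv_vec A (b i)) q \<alpha>s)"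
    by (rule bivector_decomposition[OF P, of p]) (rule that, assumption+)
  define h where "h q = 1 - w q" for q
  define a' where "a' i q f = (1 + h q) * a i q f" for i q f
  have h: "h \<in> \<S>" "h p = 0" using w by (simp_all add: h_def[abs_def])
  have a': "a' i \<in> \<V>" for i
    unfolding a'_def[abs_def] using h(1) ab by (intro field_fun_mult fun_add fun_const)
  have "(1 - h q * h q) * P q \<alpha>s = (\<Sum>i\<in>I. wedge 1 1 (mv_vec A (a' i)) (mv_vec A (b i)) q \<alpha>s)" for q \<alpha>s
  proof -
    have "(1 - h q * h q) * P q \<alpha>s = (1 + h q) * (w q * P q \<alpha>s)" by (simp add: h_def algebra_simps)
    also have "\<dots> = (\<Sum>i\<in>I. (1 + h q) * wedge 1 1 (mv_vec A (a i)) (mv_vec A (b i)) q \<alpha>s)"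
      using fun_cong[OF fun_cong[OF eq]] by (simp add: sum_distrib_left)
    also have "\<dots> = (\<Sum>i\<in>I. wedge 1 1 (mv_vec A (a' i)) (mv_vec A (b i)) q \<alpha>s)"
    proof (rule sum.cong[OF refl])
      fix i
      have e: "\<gamma> (a' i q) = (1 + h q) * \<gamma> (a i q)" if "\<gamma> \<in> \<T>' q" for \<gamma>
        unfolding a'_def using covector_cmult[OF that field_at[OF ab(1)]] .
      show "(1 + h q) * wedge 1 1 (mv_vec A (a i)) (mv_vec A (b i)) q \<alpha>s =
          wedge 1 1 (mv_vec A (a' i)) (mv_vec A (b i)) q \<alpha>s"
      proof (cases "length \<alpha>s = 2 \<and> set \<alpha>s \<subseteq> \<T>' q")
        case True
        then have "\<alpha>s ! 0 \<in> \<T>' q" "\<alpha>s ! 1 \<in> \<T>' q" by (auto simp: subset_iff)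
        from e[OF this(1)] e[OF this(2)] show ?thesis
          unfolding wedge_vec[OF ab] wedge_vec[OF a' ab(2)] by (simp add: algebra_simps)
      next
        case False
        then show ?thesis unfolding wedge_vec[OF ab] wedge_vec[OF a' ab(2)] by (simp only: if_False mult_zero_right)
      qed
    qed
    finally show ?thesis .
  qed
  then have "P = (\<lambda>q \<alpha>s. (\<Sum>i\<in>I. wedge 1 1 (mv_vec A (a' i)) (mv_vec A (b i)) q \<alpha>s) + h q * (h q * P q \<alpha>s))"
    by (intro ext) (simp add: algebra_simps)
  moreover have "matches_jac p (\<lambda>q \<alpha>s. (\<Sum>i\<in>I. wedge 1 1 (mv_vec A (a' i)) (mv_vec A (b i)) q \<alpha>s) + h q * (h q * P q \<alpha>s)) Q"
    by (intro matches_jac_add matches_jac_sum matches_jac_double_zero kvf_sum kvf_scale wedge_vec_kvf dec a' ab h P Q)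
  ultimately show ?thesis by simp
qed

text \<open>
  The first argument is reduced to a wedge product while the second one is arbitrary, and for a wedge
  product in one argument the other is reduced in the same way, using symmetry.
\<close>

lemma schouten_eq_jac:
  assumes P: "P \<in> \<X> 2" and Q: "Q \<in> \<X> 2" and F: "f \<in> \<S>" "g \<in> \<S>" "h \<in> \<S>"
  shows "B 2 2 P Q p [differential f p, differential g p, differential h p] = - jac P Q f g h p"
proof -
  have "matches_jac p (wedge 1 1 (mv_vec A a) (mv_vec A b)) Q" if "a \<in> \<V>" "b \<in> \<V>" for a b
    by (intro matches_jac_sym[OF Q] matches_jac_if_decomposable[OF _ Q] matches_jac_decomposable
        wedge_vec_kvf that)
  then have "matches_jac p P Q" by (rule matches_jac_if_decomposable[OF Q P])
  then show ?thesis using F by (simp add: matches_jac_def)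
qed

end

section \<open>The bundle map of a bivector field\<close>

text \<open>
  A vector outside the image of a basis would give more independent vectors than the basis has.
\<close>

lemma linear_inj_imp_surj_orthonormal:
  assumes J: "orthonormal_basis (J :: 'a::real_inner set)" and L: "linear (L :: 'a \<Rightarrow> 'a)" "inj L"
  shows "surj L"
proof -
  have fin: "finite J" using J by (simp add: orthonormal_basis_def)
  have ort: "i \<bullet> j = (if i = j then 1 else 0)" if "i \<in> J" "j \<in> J" for i j
    using J that unfolding orthonormal_basis_def by blast
  have span: "span J = UNIV"
  proof -
    have "x \<in> span J" for x
    proof -
      have "(\<Sum>j\<in>J. (x \<bullet> j) *\<^sub>R j) \<in> span J" by (intro span_sum span_scale span_base)
      moreover have "x = (\<Sum>j\<in>J. (x \<bullet> j) *\<^sub>R j)" using J unfolding orthonormal_basis_def by blast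
      ultimately show ?thesis by (rule ssubst[rotated])
    qed
    then show ?thesis by blast
  qed
  have "0 \<notin> J" using ort[of 0 0] by auto
  moreover have "pairwise orthogonal J" using ort by (auto simp: pairwise_def orthogonal_def)
  ultimately have "independent J" by (intro pairwise_orthogonal_independent)
  then have indep: "independent (L ` J)"
    by (rule linear_independent_injective_image[OF L(1) _ inj_on_subset[OF L(2) subset_UNIV]])
  have card: "card (L ` J) = card J" by (rule card_image[OF inj_on_subset[OF L(2) subset_UNIV]])
  have "y \<in> span (L ` J)" for y
  proof (rule ccontr)
    assume y: "y \<notin> span (L ` J)"
    then have "independent (insert y (L ` J))" using indep by (rule independent_insertI)
    then have "card (insert y (L ` J)) \<le> card J"
      using independent_span_bound[OF fin, of "insert y (L ` J)"] span by simp
    moreover have "y \<notin> L ` J" using y span_base[of y "L ` J"] by auto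
    ultimately show False using fin card by simp
  qed
  then have "span (L ` J) = UNIV" by blast
  then show ?thesis using linear_span_image[OF L(1), of J] span by simp
qed

context smooth_manifold begin

lemma tangent_eqI:
  assumes "u \<in> \<T> p" "w \<in> \<T> p" "\<And>f. f \<in> \<S> \<Longrightarrow> u f = w f" shows "u = w"
proof
  fix f show "u f = w f" 
    using assms(3) tangent_outside[OF assms(1)] tangent_outside[OF assms(2)] by (cases "f \<in> \<S>") auto
qed

text \<open>
  The vector is given by its components \<open>P(\<alpha>, dx\<^sub>j)\<close> in a basis of the tangent space. It is unique because differentials separate tangent vectors.
\<close>

lemma sharp:
  assumes P: "P \<in> \<X> 2" and \<alpha>: "\<alpha> \<in> \<T>' p"
  shows sharp_tangent: "sharp A P p \<alpha> \<in> \<T> p"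
    and sharp_pairing: "\<beta> \<in> \<T>' p \<Longrightarrow> \<beta> (sharp A P p \<alpha>) = P p [\<alpha>, \<beta>]"
proof -
  obtain J :: "'e set" and x e where x: "\<And>j. x j \<in> \<S>" and e: "\<And>j. e j \<in> \<T> p"
    and fr: "\<And>v. v \<in> \<T> p \<Longrightarrow> v = (\<lambda>f. \<Sum>j\<in>J. v (x j) * e j f)"
    by (rule dual_bases_at[of p]) (rule that, assumption+)
  define v where "v = (\<lambda>f. \<Sum>j\<in>J. P p [\<alpha>, differential (x j) p] * e j f)"
  have v: "v \<in> \<T> p" unfolding v_def using e by simp
  have pair: "\<beta> v = P p [\<alpha>, \<beta>]" if \<beta>: "\<beta> \<in> \<T>' p" for \<beta>
  proof -
    have "\<beta> = (\<lambda>u. \<Sum>j\<in>J. \<beta> (e j) * differential (x j) p u)"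
    proof
      fix u
      show "\<beta> u = (\<Sum>j\<in>J. \<beta> (e j) * differential (x j) p u)"
      proof (cases "u \<in> \<T> p")
        case True
        have "\<beta> u = \<beta> (\<lambda>f. \<Sum>j\<in>J. u (x j) * e j f)" using fr[OF True] by (rule arg_cong)
        also have "\<dots> = (\<Sum>j\<in>J. u (x j) * \<beta> (e j))" using e by (intro covector_sum[OF \<beta>])
        finally show ?thesis using True by (simp add: mult.commute)
      qed (simp add: covector_outside[OF \<beta>] differential_def)
    qed
    then have "P p [\<beta>, \<alpha>] = P p [\<lambda>u. \<Sum>j\<in>J. \<beta> (e j) * differential (x j) p u, \<alpha>]"
      by (rule arg_cong)
    also have "\<dots> = (\<Sum>j\<in>J. \<beta> (e j) * P p [differential (x j) p, \<alpha>])"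
      by (rule bivector_sum[OF P \<alpha>]) simp
    finally have "P p [\<alpha>, \<beta>] = (\<Sum>j\<in>J. \<beta> (e j) * P p [\<alpha>, differential (x j) p])"
      using bivector_swap[OF P \<alpha> \<beta> \<alpha>] bivector_swap[OF P \<alpha> differential_cotangent \<alpha>]
      by (simp add: sum_negf)
    also have "\<dots> = \<beta> v"
      unfolding v_def using e by (subst covector_sum[OF \<beta>]) (auto simp: mult.commute)
    finally show ?thesis by simp
  qed
  have "sharp A P p \<alpha> = v"
    unfolding sharp_def
  proof (rule the_equality)
    show "v \<in> \<T> p \<and> (\<forall>\<beta>\<in>\<T>' p. \<beta> v = P p [\<alpha>, \<beta>])" using v pair by blast
    fix u assume u: "u \<in> \<T> p \<and> (\<forall>\<beta>\<in>\<T>' p. \<beta> u = P p [\<alpha>, \<beta>])"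
    show "u = v"
    proof (rule tangent_eqI[OF _ v])
      show "u \<in> \<T> p" using u by blast
      fix f
      have "differential f p u = P p [\<alpha>, differential f p]" using u differential_cotangent by blast
      moreover have "differential f p v = P p [\<alpha>, differential f p]" by (rule pair) simp
      moreover have "differential f p u = u f" "differential f p v = v f" using u v by simp_all
      ultimately show "u f = v f" by metis
    qed
  qed
  then show "sharp A P p \<alpha> \<in> \<T> p" "\<beta> \<in> \<T>' p \<Longrightarrow> \<beta> (sharp A P p \<alpha>) = P p [\<alpha>, \<beta>]"
    using v pair by auto
qed

lemma sharp_apply:
  "P \<in> \<X> 2 \<Longrightarrow> \<alpha> \<in> \<T>' p \<Longrightarrow> sharp A P p \<alpha> f = P p [\<alpha>, differential f p]"
  using sharp_pairing[of P \<alpha> p "differential f p"] sharp_tangent[of P \<alpha> p] by simp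

lemma sharp_eqI:
  assumes "P \<in> \<X> 2" "\<alpha> \<in> \<T>' p" "v \<in> \<T> p" "\<And>\<beta>. \<beta> \<in> \<T>' p \<Longrightarrow> \<beta> v = P p [\<alpha>, \<beta>]"
  shows "sharp A P p \<alpha> = v"
proof (rule tangent_eqI[OF sharp_tangent[OF assms(1,2)] assms(3)])
  fix f
  show "sharp A P p \<alpha> f = v f"
    using sharp_apply[OF assms(1,2)] assms(4)[of "differential f p"] assms(3) by simp
qed

lemma sharp_field:
  assumes P: "P \<in> \<X> 2" and \<alpha>: "\<alpha> \<in> one_forms A"
  shows "(\<lambda>p. sharp A P p (\<alpha> p)) \<in> \<V>"
proof -
  have "(\<lambda>p. sharp A P p (\<alpha> p) f) \<in> \<S>" if "f \<in> \<S>" for f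
    using kvf_smooth[OF P, of "[\<alpha>, differential f]"] that \<alpha>
    by (simp add: sharp_apply[OF P one_form_at[OF \<alpha>]])
  then show ?thesis using sharp_tangent[OF P one_form_at[OF \<alpha>]] by (simp add: vector_fields_def)
qed

text \<open>
  Nondegeneracy gives injectivity; surjectivity is a dimension count, carried out on coordinate
  vectors in the model space.
\<close>

lemma sharp_surj:
  assumes P: "P \<in> \<X> 2" and nd: "nondegenerate_on (\<T>' p) (P p)" and v: "v \<in> \<T> p"
  obtains \<alpha> where "\<alpha> \<in> \<T>' p" "v = sharp A P p \<alpha>"
proof -
  obtain J :: "'e set" and x e where J: "orthonormal_basis J"
    and x: "\<And>j. x j \<in> \<S>" and e: "\<And>j. e j \<in> \<T> p"
    and fr: "\<And>v. v \<in> \<T> p \<Longrightarrow> v = (\<lambda>f. \<Sum>j\<in>J. v (x j) * e j f)"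
    and dl: "\<And>i j. i \<in> J \<Longrightarrow> j \<in> J \<Longrightarrow> e i (x j) = (if i = j then 1 else 0)"
    by (rule dual_bases_at[of p]) (rule that, assumption+)
  have fin: "finite J" using J by (simp add: orthonormal_basis_def)
  have ort: "i \<bullet> j = (if i = j then 1 else 0)" if "i \<in> J" "j \<in> J" for i j
    using J that unfolding orthonormal_basis_def by blast
  have coord: "(\<Sum>i\<in>J. c i *\<^sub>R i) \<bullet> j = c j" if "j \<in> J" for c j
    using that fin by (simp add: inner_sum_left ort if_distrib cong: if_cong sum.cong)
  define \<alpha> where "\<alpha> a = (\<lambda>u. \<Sum>j\<in>J. (a \<bullet> j) * differential (x j) p u)" for a :: 'e
  have \<alpha>: "\<alpha> a \<in> \<T>' p" for a
    unfolding \<alpha>_def by (rule fun_subspace_sum[OF cotangent_subspace]) simp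
  define c where "c j i = P p [differential (x j) p, differential (x i) p]" for i j
  define L where "L a = (\<Sum>i\<in>J. (\<Sum>j\<in>J. (a \<bullet> j) * c j i) *\<^sub>R i)" for a :: 'e
  have L: "(\<Sum>j\<in>J. (a \<bullet> j) * c j i) = P p [\<alpha> a, differential (x i) p]" for a i
    unfolding \<alpha>_def c_def by (rule bivector_sum[OF P, symmetric]) simp_all
  have linL: "linear L"
    unfolding L_def by (rule linearI)
      (simp_all add: inner_add_left algebra_simps sum.distrib scaleR_add_left sum_distrib_left[symmetric]
        scaleR_sum_right)
  have eq: "sharp A P p (\<alpha> a) = w" if w: "w \<in> \<T> p" "\<And>i. i \<in> J \<Longrightarrow> L a \<bullet> i = w (x i)" for a w
  proof -
    have "sharp A P p (\<alpha> a) (x i) = w (x i)" if "i \<in> J" for i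
      using w(2)[OF that] sharp_apply[OF P \<alpha>] coord[OF that] by (simp add: L_def L)
    then have "(\<lambda>f. \<Sum>j\<in>J. sharp A P p (\<alpha> a) (x j) * e j f) = (\<lambda>f. \<Sum>j\<in>J. w (x j) * e j f)"
      by simp
    then show ?thesis using fr[OF sharp_tangent[OF P \<alpha>]] fr[OF w(1)] by metis
  qed
  have "inj L"
  proof (rule linear_injective_0[OF linL, THEN iffD2], intro allI impI)
    fix a assume "L a = 0"
    then have "sharp A P p (\<alpha> a) = (\<lambda>_. 0)" by (intro eq) auto
    then have "P p [\<alpha> a, \<beta>] = 0" if "\<beta> \<in> \<T>' p" for \<beta>
      using sharp_pairing[OF P \<alpha>[of a] that] covector_cmult[OF that, of "\<lambda>_. 0" 0] by simp
    then have "\<alpha> a = (\<lambda>_. 0)" using nd \<alpha> unfolding nondegenerate_on_def by blast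
    then have "0 = \<alpha> a (e j)" for j by simp
    moreover have "\<alpha> a (e j) = a \<bullet> j" if "j \<in> J" for j
      using that fin e by (simp add: \<alpha>_def dl if_distrib cong: if_cong sum.cong)
    ultimately have "(\<Sum>j\<in>J. (a \<bullet> j) *\<^sub>R j) = 0" by (intro sum.neutral) auto
    moreover have "a = (\<Sum>j\<in>J. (a \<bullet> j) *\<^sub>R j)" using J unfolding orthonormal_basis_def by blast
    ultimately show "a = 0" by (rule trans[rotated])
  qed
  then have "surj L" by (rule linear_inj_imp_surj_orthonormal[OF J linL])
  then obtain a where "L a = (\<Sum>i\<in>J. v (x i) *\<^sub>R i)" by (metis surjE)
  then have "sharp A P p (\<alpha> a) = v" by (intro eq v) (simp add: coord)
  then show ?thesis using that \<alpha> by blast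
qed

subsection \<open>Two-forms and their bivector fields\<close>

lemma form_at: "\<omega> \<in> k_forms A k \<Longrightarrow> \<omega> p \<in> alternating_forms k (\<T> p)"
  by (simp add: k_forms_def)

lemma two_form_smooth:
  assumes "\<omega> \<in> k_forms A 2" "X \<in> \<V>" "Y \<in> \<V>" shows "(\<lambda>p. \<omega> p [X p, Y p]) \<in> \<S>"
proof -
  have "\<forall>Xs. length Xs = 2 \<and> set Xs \<subseteq> \<V> \<longrightarrow> (\<lambda>p. \<omega> p (map (\<lambda>X. X p) Xs)) \<in> \<S>"
    using assms(1) unfolding k_forms_def by blast
  from this[rule_format, of "[X, Y]"] show ?thesis using assms by simp
qed

lemma corresponding_sharp:
  assumes c: "corresponding_2vector A \<omega> P" and \<alpha>: "\<alpha> \<in> \<T>' p" and v: "v \<in> \<T> p"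
  shows "\<omega> p [sharp A P p \<alpha>, v] = - \<alpha> v"
proof -
  have P: "P \<in> \<X> 2" and nd: "nondegenerate_on (\<T>' p) (P p)"
    using c by (auto simp: corresponding_2vector_def nondegenerate_2vector_def)
  obtain \<beta> where \<beta>: "\<beta> \<in> \<T>' p" "v = sharp A P p \<beta>" using sharp_surj[OF P nd v] .
  have "\<omega> p [sharp A P p \<alpha>, v] = P p [\<alpha>, \<beta>]"
    using c \<alpha> \<beta> unfolding corresponding_2vector_def by simp
  also have "\<dots> = - \<alpha> v" using bivector_swap[OF P \<beta>(1) \<alpha> \<alpha>] sharp_pairing[OF P \<beta>(1) \<alpha>] \<beta>(2) by simp
  finally show ?thesis .
qed

text \<open>
  Both maps \<open>P\<^sup>\<sharp>\<close> and \<open>Q\<^sup>\<sharp>\<close> are inverse to \<open>- \<omega>\<^sup>\<flat>\<close>. Hence the compatibility of \<open>N\<close> with some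
  bivector field corresponding to \<open>\<omega>\<close> is compatibility with any given one.
\<close>

lemma corresponding_unique:
  assumes \<omega>: "nondegenerate_2form A \<omega>"
    and c: "corresponding_2vector A \<omega> P" "corresponding_2vector A \<omega> Q"
  shows "P = Q"
proof -
  have P: "P \<in> \<X> 2" and Q: "Q \<in> \<X> 2"
    using c by (auto simp: corresponding_2vector_def nondegenerate_2vector_def)
  have om: "\<omega> p \<in> alternating_forms 2 (\<T> p)" and nd: "nondegenerate_on (\<T> p) (\<omega> p)" for p
    using \<omega> form_at by (auto simp: nondegenerate_2form_def)
  have sh: "sharp A P p \<alpha> = sharp A Q p \<alpha>" if \<alpha>: "\<alpha> \<in> \<T>' p" for p \<alpha>
  proof -
    let ?u = "sharp A P p \<alpha>" and ?w = "sharp A Q p \<alpha>"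
    have uw: "?u \<in> \<T> p" "?w \<in> \<T> p" using sharp_tangent P Q \<alpha> by auto
    have m: "(\<lambda>f. (-1) * ?w f) \<in> \<T> p" using uw by (intro tangent_space_cmult)
    have "\<omega> p [\<lambda>f. ?u f + (-1) * ?w f, v] = 0" if "v \<in> \<T> p" for v
      using alternating2_add_left[OF om tangent_subspace uw(1) m that]
        alternating2_cmult_left[OF om tangent_subspace uw(2) uw(2) that, of "-1"]
        corresponding_sharp[OF c(1) \<alpha> that] corresponding_sharp[OF c(2) \<alpha> that] by simp
    moreover have "(\<lambda>f. ?u f + (-1) * ?w f) \<in> \<T> p" using uw m by (intro tangent_space_add)
    ultimately have z: "(\<lambda>f. ?u f + (-1) * ?w f) = (\<lambda>_. 0)"
      using nd unfolding nondegenerate_on_def by blast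
    show ?thesis
    proof
      fix f show "?u f = ?w f" using fun_cong[OF z, of f] by simp
    qed
  qed
  show ?thesis
  proof (intro ext)
    fix p \<alpha>s
    show "P p \<alpha>s = Q p \<alpha>s"
    proof (cases "length \<alpha>s = 2 \<and> set \<alpha>s \<subseteq> \<T>' p")
      case True
      then obtain \<alpha> \<beta> where \<alpha>s: "\<alpha>s = [\<alpha>, \<beta>]" by (auto simp: length_Suc_conv numeral_2_eq_2)
      with True have "\<alpha> \<in> \<T>' p" "\<beta> \<in> \<T>' p" by auto
      then show ?thesis
        using sharp_pairing[OF P, of \<alpha> p \<beta>] sharp_pairing[OF Q, of \<alpha> p \<beta>] sh \<alpha>s by simp
    next
      case False
      then show ?thesis using alternating_outside[OF kvf_at[OF P]] alternating_outside[OF kvf_at[OF Q]] by metis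
    qed
  qed
qed

lemma ext_deriv_2form:
  "ext_deriv \<omega> [U, V, W] p =
     U p (\<lambda>q. \<omega> q [V q, W q]) - V p (\<lambda>q. \<omega> q [U q, W q]) + W p (\<lambda>q. \<omega> q [U q, V q])
     - \<omega> p [lie_bracket U V p, W p] + \<omega> p [lie_bracket U W p, V p] - \<omega> p [lie_bracket V W p, U p]"
proof -
  have s3: "(\<Sum>i<3. F i) = F 0 + F 1 + F 2" for F :: "nat \<Rightarrow> real"
    by (simp add: numeral_3_eq_3 numeral_2_eq_2)
  have s2: "(\<Sum>i<2. F i) = F 0 + F 1" "(\<Sum>i<1. F i) = F 0" for F :: "nat \<Rightarrow> real"
    by (simp_all add: numeral_2_eq_2)
  show ?thesis
    by (simp add: ext_deriv_def s3 s2 nths_Cons del: One_nat_def)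
qed

lemma lie_bracket_swap: "lie_bracket W V p = (\<lambda>f. (-1) * lie_bracket V W p f)"
  by (simp add: lie_bracket_def fun_eq_iff)

lemma ext_deriv_2form_swap:
  assumes \<omega>: "\<omega> \<in> k_forms A 2" and V: "U \<in> \<V>" "V \<in> \<V>" "W \<in> \<V>"
  shows "ext_deriv \<omega> [U, W, V] p = - ext_deriv \<omega> [U, V, W] p"
proof -
  note om = form_at[OF \<omega>] and at = V[THEN field_at]
  note LB = lie_bracket_field[THEN field_at]
  have "(\<lambda>q. \<omega> q [W q, V q]) = (\<lambda>q. - \<omega> q [V q, W q])"
    using alternating2_swap[OF om tangent_subspace at(2,3) at(3)] by (intro ext)
  then have "U p (\<lambda>q. \<omega> q [W q, V q]) = - U p (\<lambda>q. \<omega> q [V q, W q])"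
    using tangent_minus[OF at(1) two_form_smooth[OF \<omega> V(2,3)]] by simp
  moreover have "\<omega> p [lie_bracket W V p, U p] = - \<omega> p [lie_bracket V W p, U p]"
    using alternating2_cmult_left[OF om tangent_subspace LB[OF V(2,3)] LB[OF V(2,3)] at(1), where c = "-1"]
    unfolding lie_bracket_swap[of W V] by simp
  ultimately show ?thesis unfolding ext_deriv_2form by simp
qed

end

section \<open>Pseudo-symplectic Nijenhuis structures\<close>

locale pseudo_symplectic = smooth_manifold A
  for A :: "('m::{t2_space,second_countable_topology}, 'e::{real_inner,banach,heine_borel}) atlas" +
  fixes \<omega> \<phi> :: "'m form" and N :: "'m tensor11" and P :: "'m mvfield"
  assumes nondegenerate: "nondegenerate_2form A \<omega>"
    and corresponding: "corresponding_2vector A \<omega> P"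
    and nijenhuis: "nijenhuis_structure A N"
    and compat: "compatible A P N"
    and closed: "closed_form A 3 \<phi>"
    and d\<omega>: "\<And>X Y Z. X \<in> vector_fields A \<Longrightarrow> Y \<in> vector_fields A \<Longrightarrow> Z \<in> vector_fields A \<Longrightarrow>
      ext_deriv \<omega> [X, Y, Z] = (\<lambda>p. \<phi> p [X p, Y p, N p (Z p)])"
begin

text \<open>In the comments, \<open>\<pi>\<close> stands for \<open>P\<close>, and \<open>Y\<^sub>f = \<pi>\<^sup>\<sharp> df\<close> for \<open>ham f\<close>, so that \<open>nham f\<close> is \<open>N Y\<^sub>f\<close>.\<close>

abbreviation "K \<equiv> sharp A P"
abbreviation "N' \<equiv> dual_map A N"

definition ham :: "('m \<Rightarrow> real) \<Rightarrow> 'm vfield" where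
  "ham f = (\<lambda>p. K p (differential f p))"

definition nham :: "('m \<Rightarrow> real) \<Rightarrow> 'm vfield" where
  "nham f = (\<lambda>p. N p (ham f p))"

lemma P_bivector: "P \<in> \<X> 2"
  using corresponding by (simp add: corresponding_2vector_def nondegenerate_2vector_def)

lemma P_nondegenerate: "nondegenerate_on (\<T>' p) (P p)"
  using corresponding by (simp add: corresponding_2vector_def nondegenerate_2vector_def)

lemma \<omega>_form: "\<omega> \<in> k_forms A 2" and \<phi>_form: "\<phi> \<in> k_forms A 3"
  using nondegenerate closed by (simp_all add: nondegenerate_2form_def closed_form_def)

lemma N_tangent: "u \<in> \<T> p \<Longrightarrow> N p u \<in> \<T> p"
  and N_add: "u \<in> \<T> p \<Longrightarrow> w \<in> \<T> p \<Longrightarrow> N p (\<lambda>f. u f + w f) = (\<lambda>f. N p u f + N p w f)"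
  and N_cmult: "u \<in> \<T> p \<Longrightarrow> N p (\<lambda>f. c * u f) = (\<lambda>f. c * N p u f)"
  and N_field: "X \<in> \<V> \<Longrightarrow> (\<lambda>p. N p (X p)) \<in> \<V>"
  using nijenhuis unfolding nijenhuis_structure_def tensors11_def by blast+

lemma dual_cotangent: assumes "\<alpha> \<in> \<T>' p" shows "N' p \<alpha> \<in> \<T>' p"
proof -
  have "N' p \<alpha> (\<lambda>f. u f + w f) = N' p \<alpha> u + N' p \<alpha> w" if "u \<in> \<T> p" "w \<in> \<T> p" for u w
    using that assms by (simp add: dual_map_def N_add covector_add N_tangent)
  moreover have "N' p \<alpha> (\<lambda>f. c * u f) = c * N' p \<alpha> u" if "u \<in> \<T> p" for u c
    using that assms by (simp add: dual_map_def N_cmult covector_cmult N_tangent)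
  ultimately show ?thesis by (simp add: cotangent_space_def dual_space_def dual_map_def)
qed

lemma N_sharp: "\<alpha> \<in> \<T>' p \<Longrightarrow> N p (K p \<alpha>) = K p (N' p \<alpha>)"
  using compat unfolding compatible_def by blast

lemmas K_tangent = sharp_tangent[OF P_bivector]
lemmas K_pairing = sharp_pairing[OF P_bivector]

lemma ham_field: "f \<in> \<S> \<Longrightarrow> ham f \<in> \<V>"
  unfolding ham_def by (intro sharp_field[OF P_bivector]) simp

lemma nham_field: "f \<in> \<S> \<Longrightarrow> nham f \<in> \<V>"
  unfolding nham_def by (intro N_field ham_field)

lemma N_lie_bracket_swap:
  assumes "X \<in> \<V>" "Y \<in> \<V>" shows "N p (lie_bracket Y X p) f = - N p (lie_bracket X Y p) f"
  using N_cmult[OF field_at[OF lie_bracket_field[OF assms]], where c = "-1"]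
  unfolding lie_bracket_swap[of Y X] by simp

lemma \<omega>_ham: "v \<in> \<T> p \<Longrightarrow> \<omega> p [ham f p, v] = - v f"
  unfolding ham_def using corresponding_sharp[OF corresponding differential_cotangent] by simp

lemmas \<omega>_alt = form_at[OF \<omega>_form]

lemma \<omega>_swap: "u \<in> \<T> p \<Longrightarrow> w \<in> \<T> p \<Longrightarrow> \<omega> p [w, u] = - \<omega> p [u, w]"
  by (rule alternating2_swap[OF \<omega>_alt tangent_subspace])

lemma \<omega>_ham_right: "f \<in> \<S> \<Longrightarrow> v \<in> \<T> p \<Longrightarrow> \<omega> p [v, ham f p] = v f"
  using \<omega>_swap[OF field_at[OF ham_field]] \<omega>_ham by simp

text \<open>Through \<open>\<omega>(\<pi>\<^sup>\<sharp>\<alpha>, v) = - \<alpha>(v)\<close> this is the condition \<open>N \<circ> \<pi>\<^sup>\<sharp> = \<pi>\<^sup>\<sharp> \<circ> N\<^sup>*\<close>.\<close>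

lemma \<omega>_N: assumes u: "u \<in> \<T> p" and w: "w \<in> \<T> p" shows "\<omega> p [N p u, w] = \<omega> p [u, N p w]"
proof -
  obtain \<alpha> where \<alpha>: "\<alpha> \<in> \<T>' p" "u = K p \<alpha>" using sharp_surj[OF P_bivector P_nondegenerate u] .
  have "\<omega> p [N p u, w] = - N' p \<alpha> w"
    unfolding \<alpha>(2) N_sharp[OF \<alpha>(1)] using corresponding_sharp[OF corresponding dual_cotangent[OF \<alpha>(1)] w] .
  also have "\<dots> = - \<alpha> (N p w)" using w by (simp add: dual_map_def)
  also have "\<dots> = \<omega> p [u, N p w]"
    unfolding \<alpha>(2) using corresponding_sharp[OF corresponding \<alpha>(1) N_tangent[OF w]] by simp
  finally show ?thesis .
qed

lemma \<omega>_nham_right: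
  assumes "f \<in> \<S>" "v \<in> \<T> p" shows "\<omega> p [v, nham f p] = N p v f"
  unfolding nham_def
  using \<omega>_N[OF assms(2) field_at[OF ham_field[OF assms(1)]]] \<omega>_ham_right[OF assms(1) N_tangent[OF assms(2)]]
  by simp

lemma ham_skew:
  assumes "f \<in> \<S>" "g \<in> \<S>"
  shows "ham g p f = - ham f p g" "nham g p f = - nham f p g"
    "N p (nham g p) f = - N p (nham f p) g"
proof -
  note H = field_at[OF ham_field[OF assms(1)], of p] field_at[OF ham_field[OF assms(2)], of p]
    and X = field_at[OF nham_field[OF assms(1)], of p] field_at[OF nham_field[OF assms(2)], of p]
  show "ham g p f = - ham f p g"
    using \<omega>_ham[OF H(2), of f] \<omega>_ham_right[OF assms(2) H(1)] by simp
  show "nham g p f = - nham f p g"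
    using \<omega>_ham[OF X(2), of f] \<omega>_nham_right[OF assms(2) H(1)] by (simp add: nham_def)
  have "\<omega> p [nham g p, nham f p] = N p (nham g p) f" "\<omega> p [nham f p, nham g p] = N p (nham f p) g"
    using \<omega>_nham_right X assms by auto
  then show "N p (nham g p) f = - N p (nham f p) g" using \<omega>_swap[OF X] by simp
qed

lemma lie_derivative_differential:
  assumes "X \<in> \<V>" "Z \<in> \<V>" "g \<in> \<S>"
  shows "lie_derivative X (differential g) Z p = Z p (\<lambda>q. X q g)"
  using assms by (simp add: lie_derivative_def field_at lie_bracket_field)
    (simp add: lie_bracket_def)

text \<open>
  The compatibility condition for \<open>df\<close> and \<open>dg\<close>: since \<open>\<L>\<^sub>X dg = d(X g)\<close>, the left-hand side
  and the last bracket on the right are exact.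
\<close>

lemma compat_exact:
  assumes F: "f \<in> \<S>" "g \<in> \<S>" and Z: "Z \<in> \<V>"
  shows "Z p (\<lambda>q. nham f q g) =
    ham f p (\<lambda>q. N q (Z q) g) - N p (lie_bracket (ham f) Z p) g
    - ham g p (\<lambda>q. N q (Z q) f) + N p (lie_bracket (ham g) Z p) f - N p (Z p) (\<lambda>q. ham f q g)"
proof -
  let ?f = "differential f" and ?g = "differential g"
  let ?fN = "\<lambda>q. N' q (?f q)" and ?gN = "\<lambda>q. N' q (?g q)"
  let ?NZ = "\<lambda>q. N q (Z q)"
  note hf = ham_field[OF F(1)] and hg = ham_field[OF F(2)]
    and nf = nham_field[OF F(1)] and ng = nham_field[OF F(2)]
  have NZ: "?NZ \<in> \<V>" by (rule N_field[OF Z])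
  have NK: "(\<lambda>q. N q (K q (differential h q))) = nham h" for h
    by (simp add: nham_def ham_def)
  have KN: "(\<lambda>q. K q (N' q (differential h q))) = nham h" for h
    unfolding nham_def ham_def by (simp add: N_sharp)
  have KK: "(\<lambda>q. K q (differential h q)) = ham h" for h
    by (simp add: ham_def)
  have pair: "(\<lambda>q. differential h q (X q)) = (\<lambda>q. X q h)" if "X \<in> \<V>" for h X
    using that by (simp add: field_at)
  have pairN: "N' q (differential h q) (X q) = N q (X q) h" if "X \<in> \<V>" for h X q
    using field_at[OF that] N_tangent by (simp add: dual_map_def)
  have lieN: "lie_derivative X (\<lambda>q. N' q (differential h q)) Z p =
      X p (\<lambda>q. N q (Z q) h) - N p (lie_bracket X Z p) h" if "X \<in> \<V>" for X h
    unfolding lie_derivative_def using pairN[OF Z] pairN[OF lie_bracket_field[OF that Z]] by simp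
  have sk: "Z p (\<lambda>q. nham g q f) = - Z p (\<lambda>q. nham f q g)"
    using ham_skew(2)[OF F] tangent_minus[OF field_at[OF Z] field_smooth[OF nf F(2)]] by simp
  have skK: "?NZ p (\<lambda>q. ham g q f) = - ?NZ p (\<lambda>q. ham f q g)"
    using ham_skew(1)[OF F] tangent_minus[OF field_at[OF NZ] field_smooth[OF hf F(2)]] by simp
  have "form_bracket (\<lambda>p \<xi>. N p (K p \<xi>)) ?f ?g Z p =
      form_bracket K ?fN ?g Z p + form_bracket K ?f ?gN Z p - form_bracket K ?f ?g ?NZ p"
    using fun_cong[OF compat[unfolded compatible_def, THEN conjunct2, rule_format,
        OF differential_one_form[OF F(1)] differential_one_form[OF F(2)] Z], of p] .
  moreover have "form_bracket (\<lambda>p \<xi>. N p (K p \<xi>)) ?f ?g Z p = - Z p (\<lambda>q. nham g q f)"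
  proof -
    have "(\<lambda>q. ?g q (N q (K q (?f q)))) = (\<lambda>q. nham f q g)"
      using pair[OF nf, of g] by (simp add: nham_def ham_def)
    then show ?thesis
      unfolding form_bracket_def NK by (simp add: lie_derivative_differential nf ng Z F)
  qed
  moreover have "form_bracket K ?fN ?g Z p = - (ham g p (\<lambda>q. N q (Z q) f) - N p (lie_bracket (ham g) Z p) f)"
  proof -
    have "(\<lambda>q. ?g q (K q (N' q (?f q)))) = (\<lambda>q. nham f q g)"
      using pair[OF nf, of g] fun_cong[OF KN[of f]] by simp
    then show ?thesis
      unfolding form_bracket_def KN KK lieN[OF hg] by (simp add: lie_derivative_differential nf Z F)
  qed
  moreover have "form_bracket K ?f ?gN Z p =
      ham f p (\<lambda>q. N q (Z q) g) - N p (lie_bracket (ham f) Z p) g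
      - Z p (\<lambda>q. nham g q f) - Z p (\<lambda>q. nham f q g)"
  proof -
    have "(\<lambda>q. ?gN q (K q (?f q))) = (\<lambda>q. nham f q g)"
      using pairN[OF hf, of _ g] by (simp add: ham_def nham_def)
    then show ?thesis
      unfolding form_bracket_def KN KK lieN[OF hf] by (simp add: lie_derivative_differential ng Z F)
  qed
  moreover have "form_bracket K ?f ?g ?NZ p = - ?NZ p (\<lambda>q. ham g q f)"
  proof -
    have "(\<lambda>q. ?g q (K q (?f q))) = (\<lambda>q. ham f q g)"
      using pair[OF hf, of g] by (simp add: ham_def)
    then show ?thesis
      unfolding form_bracket_def KK
      by (simp add: lie_derivative_differential[OF hf NZ F(2)] lie_derivative_differential[OF hg NZ F(1)])
  qed
  ultimately show ?thesis using sk skK by simp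
qed

lemma \<phi>_swap:
  assumes "U \<in> \<V>" "V \<in> \<V>" "W \<in> \<V>"
  shows "\<phi> p [V p, U p, W p] = - \<phi> p [U p, V p, W p]" "\<phi> p [U p, W p, V p] = - \<phi> p [U p, V p, W p]"
proof -
  note at = assms[THEN field_at]
  show "\<phi> p [V p, U p, W p] = - \<phi> p [U p, V p, W p]"
    by (rule alternating3_swap(1)[OF form_at[OF \<phi>_form] tangent_subspace at(1,2,3)])
  show "\<phi> p [U p, W p, V p] = - \<phi> p [U p, V p, W p]"
    by (rule alternating3_swap(2)[OF form_at[OF \<phi>_form] tangent_subspace at(2,3,1)])
qed

text \<open>
  The expression \<open>\<phi>(U, V, N W) = d\<omega>(U, V, W)\<close> is alternating in \<open>U, V, W\<close>, and \<open>\<phi>\<close> is alternating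
  in its own arguments. Comparing the two symmetries moves \<open>N\<close> from one argument of \<open>\<phi>\<close> to another.
\<close>

lemma \<phi>_shift:
  assumes V: "U \<in> \<V>" "V \<in> \<V>" "W \<in> \<V>"
  shows "\<phi> p [U p, N p (V p), W p] = \<phi> p [U p, V p, N p (W p)]"
    and "\<phi> p [N p (U p), V p, W p] = \<phi> p [U p, V p, N p (W p)]"
proof -
  have sh: "\<phi> p [U p, N p (V p), W p] = \<phi> p [U p, V p, N p (W p)]"
    if V: "U \<in> \<V>" "V \<in> \<V>" "W \<in> \<V>" for U V W
  proof -
    have "\<phi> p [U p, W p, N p (V p)] = - \<phi> p [U p, V p, N p (W p)]"
      using ext_deriv_2form_swap[OF \<omega>_form V, of p] fun_cong[OF d\<omega>[OF V], of p]
        fun_cong[OF d\<omega>[OF V(1,3,2)], of p] by simp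
    then show ?thesis using \<phi>_swap(2)[OF V(1) N_field[OF V(2)] V(3), of p] by simp
  qed
  show "\<phi> p [U p, N p (V p), W p] = \<phi> p [U p, V p, N p (W p)]" by (rule sh[OF V])
  show "\<phi> p [N p (U p), V p, W p] = \<phi> p [U p, V p, N p (W p)]"
    using sh[OF V(2,1,3)] \<phi>_swap(1)[OF V(2) N_field[OF V(1)] V(3), of p]
      \<phi>_swap(1)[OF V(2,1) N_field[OF V(3)], of p] by simp
qed

text \<open>
  In \<open>d\<omega>(N Y\<^sub>f, N Y\<^sub>g, Y\<^sub>h)\<close> the terms with two fields \<open>N Y\<close> acting on \<open>h\<close> cancel against the bracket
  of these fields.
\<close>

lemma \<phi>_nham_1:
  assumes F: "f \<in> \<S>" "g \<in> \<S>" "h \<in> \<S>"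
  shows "\<phi> p [nham f p, nham g p, nham h p] =
    ham h p (\<lambda>q. N q (nham f q) g) + N p (lie_bracket (nham f) (ham h) p) g - N p (lie_bracket (nham g) (ham h) p) f"
proof -
  note n = nham_field[OF F(1)] nham_field[OF F(2)] and hh = ham_field[OF F(3)]
  note LB = lie_bracket_field[THEN field_at]
  have e: "(\<lambda>q. \<omega> q [X q, ham h q]) = (\<lambda>q. X q h)" if "X \<in> \<V>" for X
    using that F by (simp add: \<omega>_ham_right field_at)
  have e2: "(\<lambda>q. \<omega> q [nham f q, nham g q]) = (\<lambda>q. N q (nham f q) g)"
    using F by (simp add: \<omega>_nham_right field_at[OF n(1)])
  have "\<phi> p [nham f p, nham g p, nham h p] = ext_deriv \<omega> [nham f, nham g, ham h] p"
    using fun_cong[OF d\<omega>[OF n hh], of p] by (simp add: nham_def)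
  also have "\<dots> = nham f p (\<lambda>q. nham g q h) - nham g p (\<lambda>q. nham f q h) + ham h p (\<lambda>q. N q (nham f q) g)
     - lie_bracket (nham f) (nham g) p h + N p (lie_bracket (nham f) (ham h) p) g
     - N p (lie_bracket (nham g) (ham h) p) f"
    unfolding ext_deriv_2form e[OF n(1)] e[OF n(2)] e2
    using \<omega>_ham_right[OF F(3) LB[OF n, of p]] \<omega>_nham_right[OF F(2) LB[OF n(1) hh, of p]]
      \<omega>_nham_right[OF F(1) LB[OF n(2) hh, of p]] by simp
  finally show ?thesis by (simp add: lie_bracket_def)
qed

text \<open>
  Two shifts of \<open>N\<close> turn \<open>\<phi>(N Y\<^sub>f, N Y\<^sub>g, N Y\<^sub>h)\<close> into \<open>d\<omega>(Y\<^sub>f, Y\<^sub>g, N\<^sup>2 Y\<^sub>h)\<close>.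
\<close>

lemma \<phi>_nham_2:
  assumes F: "f \<in> \<S>" "g \<in> \<S>" "h \<in> \<S>"
  shows "\<phi> p [nham f p, nham g p, nham h p] =
    - N p (nham h p) (\<lambda>q. ham f q g) - N p (N p (lie_bracket (ham f) (ham g) p)) h"
proof -
  note H = ham_field[OF F(1)] ham_field[OF F(2)] and nh = nham_field[OF F(3)]
  let ?Z = "\<lambda>q. N q (nham h q)"
  have Z: "?Z \<in> \<V>" by (rule N_field[OF nh])
  note LB = lie_bracket_field[THEN field_at]
  have "\<phi> p [nham f p, nham g p, nham h p] = \<phi> p [ham f p, nham g p, ?Z p]"
    using \<phi>_shift(2)[OF H(1) nham_field[OF F(2)] nh, of p] by (simp add: nham_def[of f])
  also have "\<dots> = \<phi> p [ham f p, ham g p, N p (?Z p)]"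
    using \<phi>_shift(1)[OF H Z, of p] by (simp add: nham_def[of g])
  also have "\<dots> = ext_deriv \<omega> [ham f, ham g, ?Z] p"
    using fun_cong[OF d\<omega>[OF H Z], of p] by simp
  also have "\<dots> = - ?Z p (\<lambda>q. ham f q g) - N p (N p (lie_bracket (ham f) (ham g) p)) h"
  proof -
    have e: "(\<lambda>q. \<omega> q [ham k q, X q]) = (\<lambda>q. - X q k)" if "X \<in> \<V>" for X k
      using that by (simp add: \<omega>_ham field_at)
    have m: "ham k p (\<lambda>q. - ?Z q l) = - ham k p (\<lambda>q. ?Z q l)" if "k \<in> \<S>" "l \<in> \<S>" for k l
      using tangent_minus[OF field_at[OF ham_field[OF that(1)]] field_smooth[OF Z that(2)]] .
    have sk: "(\<lambda>q. - ham g q f) = (\<lambda>q. ham f q g)" using ham_skew(1)[OF F(1,2)] by simp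
    have r: "\<omega> p [lie_bracket (ham f) (ham g) p, ?Z p] = N p (N p (lie_bracket (ham f) (ham g) p)) h"
      using \<omega>_N[OF LB[OF H] field_at[OF nh], of p] \<omega>_nham_right[OF F(3) N_tangent[OF LB[OF H]], of p] by simp
    have r2: "\<omega> p [lie_bracket (ham f) ?Z p, ham g p] = lie_bracket (ham f) ?Z p g"
        "\<omega> p [lie_bracket (ham g) ?Z p, ham f p] = lie_bracket (ham g) ?Z p f"
      using \<omega>_ham_right F LB[OF H(1) Z] LB[OF H(2) Z] by auto
    have "?Z p (\<lambda>q. ham g q f) = - ?Z p (\<lambda>q. ham f q g)"
      using ham_skew(1)[OF F(1,2)] tangent_minus[OF field_at[OF Z] field_smooth[OF H(1) F(2)]] by simp
    then show ?thesis
      unfolding ext_deriv_2form e[OF Z] e[OF H(2)] sk r r2 m[OF F(1,2)] m[OF F(2,1)]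
      by (simp add: lie_bracket_def)
  qed
  finally show ?thesis by simp
qed

lemma nijenhuis_ham:
  assumes F: "f \<in> \<S>" "h \<in> \<S>"
  shows "nham f p (\<lambda>q. nham h q k) - nham h p (\<lambda>q. nham f q k) =
    N p (lie_bracket (nham f) (ham h) p) k - N p (lie_bracket (nham h) (ham f) p) k
    - N p (N p (lie_bracket (ham f) (ham h) p)) k"
proof -
  note H = ham_field[OF F(1)] ham_field[OF F(2)] and n = nham_field[OF F(1)] nham_field[OF F(2)]
  note LB = lie_bracket_field[THEN field_at]
  let ?a = "lie_bracket (nham f) (ham h) p" and ?b = "lie_bracket (ham f) (nham h) p"
    and ?c = "lie_bracket (ham f) (ham h) p"
  have t: "?a \<in> \<T> p" "?b \<in> \<T> p" "N p ?c \<in> \<T> p" using LB H n N_tangent by auto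
  have "lie_bracket (nham f) (nham h) = (\<lambda>p. N p (nijenhuis_bracket N (ham f) (ham h) p))"
    using nijenhuis H unfolding nijenhuis_structure_def nham_def by blast
  then have "lie_bracket (nham f) (nham h) p k = N p (nijenhuis_bracket N (ham f) (ham h) p) k" by simp
  also have "nijenhuis_bracket N (ham f) (ham h) p = (\<lambda>x. (?a x + ?b x) + (-1) * N p ?c x)"
    by (simp add: nijenhuis_bracket_def nham_def[abs_def])
  also have "N p \<dots> k = N p ?a k + N p ?b k - N p (N p ?c) k"
    using N_add[OF tangent_space_add[OF t(1,2)] tangent_space_cmult[OF t(3), of "-1"]]
      N_add[OF t(1,2)] N_cmult[OF t(3), where c = "-1"] by simp
  finally show ?thesis
    using N_lie_bracket_swap[OF n(2) H(1), of p k] by (simp add: lie_bracket_def[of "nham f" "nham h"])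
qed

text \<open>
  The left-hand side is the Jacobiator of \<open>\<pi>\<^sub>N\<close> up to sign. Evaluating \<open>\<phi>(N Y\<^sub>f, N Y\<^sub>g, N Y\<^sub>h)\<close> as
  \<open>d\<omega>(N Y\<^sub>f, N Y\<^sub>g, Y\<^sub>h)\<close> and as \<open>d\<omega>(Y\<^sub>f, Y\<^sub>g, N\<^sup>2 Y\<^sub>h)\<close> gives two expressions; the
  compatibility condition at \<open>Z = N Y\<^sub>h\<close> and the vanishing torsion of \<open>N\<close> eliminate all terms
  other than the Jacobiator from their cyclic sums.
\<close>

lemma jacobiator_nham:
  assumes F: "f \<in> \<S>" "g \<in> \<S>" "h \<in> \<S>"
  shows "nham f p (\<lambda>q. nham g q h) + nham g p (\<lambda>q. nham h q f) + nham h p (\<lambda>q. nham f q g) =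
    - \<phi> p [nham f p, nham g p, nham h p]"
proof -
  define a where "a k l m = ham k p (\<lambda>q. N q (nham l q) m)" for k l m
  define b where "b k l m = N p (nham k p) (\<lambda>q. ham l q m)" for k l m
  define x where "x k l m = nham k p (\<lambda>q. nham l q m)" for k l m
  define n where "n k l m = N p (lie_bracket (nham k) (ham l) p) m" for k l m
  define s where "s k l m = N p (N p (lie_bracket (ham k) (ham l) p)) m" for k l m
  define c where "c k l m = \<phi> p [nham k p, nham l p, nham m p]" for k l m
  have a: "a k m l = - a k l m" if "k \<in> \<S>" "l \<in> \<S>" "m \<in> \<S>" for k l m
    unfolding a_def using ham_skew(3)[OF that(2,3)]
      tangent_minus[OF field_at[OF ham_field[OF that(1)]] field_smooth[OF N_field[OF nham_field[OF that(2)]] that(3)]]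
    by simp
  have b: "b k m l = - b k l m" if "k \<in> \<S>" "l \<in> \<S>" "m \<in> \<S>" for k l m
    unfolding b_def using ham_skew(1)[OF that(2,3)]
      tangent_minus[OF field_at[OF N_field[OF nham_field[OF that(1)]]] field_smooth[OF ham_field[OF that(2)] that(3)]]
    by simp
  have x: "x k m l = - x k l m" if "k \<in> \<S>" "l \<in> \<S>" "m \<in> \<S>" for k l m
    unfolding x_def using ham_skew(2)[OF that(2,3)]
      tangent_minus[OF field_at[OF nham_field[OF that(1)]] field_smooth[OF nham_field[OF that(2)] that(3)]]
    by simp
  have c: "c l k m = - c k l m" "c k m l = - c k l m" if "k \<in> \<S>" "l \<in> \<S>" "m \<in> \<S>" for k l m
    unfolding c_def using \<phi>_swap[OF that[THEN nham_field], of p] by simp_all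
  have 1: "c k l m = a m k l + n k m l - n l m k" if "k \<in> \<S>" "l \<in> \<S>" "m \<in> \<S>" for k l m
    unfolding c_def a_def n_def by (rule \<phi>_nham_1[OF that])
  have 2: "c k l m = - b m k l - s k l m" if "k \<in> \<S>" "l \<in> \<S>" "m \<in> \<S>" for k l m
    unfolding c_def b_def s_def by (rule \<phi>_nham_2[OF that])
  have 3: "x k l m - x l k m = n k l m - n l k m - s k l m" if "k \<in> \<S>" "l \<in> \<S>" for k l m
    unfolding x_def n_def s_def by (rule nijenhuis_ham[OF that])
  have 4: "x m k l = a k m l + n m k l - a l m k - n m l k - b m k l"
    if "k \<in> \<S>" "l \<in> \<S>" "m \<in> \<S>" for k l m
    using compat_exact[OF that(1,2) nham_field[OF that(3)], of p]
      N_lie_bracket_swap[OF nham_field[OF that(3)] ham_field[OF that(1)], of p l]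
      N_lie_bracket_swap[OF nham_field[OF that(3)] ham_field[OF that(2)], of p k]
    unfolding x_def a_def n_def b_def by simp
  (* Every relation is summed over the cyclic permutations of f, g, h. *)
  define \<Sigma> where "\<Sigma> q = q f g h + q g h f + q h f g" for q :: "('m \<Rightarrow> real) \<Rightarrow> ('m \<Rightarrow> real) \<Rightarrow> ('m \<Rightarrow> real) \<Rightarrow> real"
  define n' where "n' k l m = n l k m" for k l m
  have c': "c g h f = c f g h" "c h f g = c f g h"
    using c(1)[OF F(2,1,3)] c(2)[OF F(2,1,3)] c(1)[OF F(1,3,2)] c(2)[OF F(1,2,3)] c(1)[OF F(1,2,3)] by linarith+
  have "3 * c f g h = \<Sigma> a + \<Sigma> n' - \<Sigma> n"
    using 1[OF F(1,2,3)] 1[OF F(2,3,1)] 1[OF F(3,1,2)] unfolding c' \<Sigma>_def n'_def by algebra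
  moreover have "\<Sigma> s = - \<Sigma> b - 3 * c f g h"
    using 2[OF F(1,2,3)] 2[OF F(2,3,1)] 2[OF F(3,1,2)] unfolding c' \<Sigma>_def by algebra
  moreover have "2 * \<Sigma> x = \<Sigma> n - \<Sigma> n' - \<Sigma> s"
    using 3[OF F(1,2), of h] 3[OF F(2,3), of f] 3[OF F(3,1), of g]
    unfolding x[OF F(1,2,3)] x[OF F(2,3,1)] x[OF F(3,1,2)] \<Sigma>_def n'_def by algebra
  moreover have "\<Sigma> x = - 2 * \<Sigma> a + \<Sigma> n - \<Sigma> n' - \<Sigma> b"
    using 4[OF F(1,2,3)] 4[OF F(2,3,1)] 4[OF F(3,1,2)]
    unfolding a[OF F(1,2,3)] a[OF F(2,3,1)] a[OF F(3,1,2)] \<Sigma>_def n'_def by algebra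
  ultimately have "\<Sigma> x = - c f g h" by linarith
  then have "x f g h + x g h f + x h f g = - c f g h" by (simp add: \<Sigma>_def)
  then show ?thesis unfolding x_def c_def .
qed

subsection \<open>The bivector field of \<open>N \<pi>\<^sup>\<sharp>\<close>\<close>

lemma pi_N_apply: "\<alpha> \<in> \<T>' p \<Longrightarrow> \<beta> \<in> \<T>' p \<Longrightarrow> pi_N A P N p [\<alpha>, \<beta>] = \<beta> (N p (K p \<alpha>))"
  by (simp add: pi_N_def)

lemma pi_N_sharp_form:
  assumes "\<alpha> \<in> \<T>' p" "\<beta> \<in> \<T>' p" shows "pi_N A P N p [\<alpha>, \<beta>] = P p [\<alpha>, N' p \<beta>]"
  using assms K_tangent K_pairing[OF assms(1) dual_cotangent[OF assms(2)]]
  by (simp add: pi_N_apply dual_map_def)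

lemma pi_N_sharp_form':
  assumes "\<alpha> \<in> \<T>' p" "\<beta> \<in> \<T>' p" shows "pi_N A P N p [\<alpha>, \<beta>] = P p [N' p \<alpha>, \<beta>]"
  using assms by (simp add: pi_N_apply N_sharp K_pairing dual_cotangent)

lemma pi_N_bivector: "pi_N A P N \<in> \<X> 2"
proof (rule kvf_2I)
  fix p
  have sub: "\<And>u w. u \<in> \<T>' p \<Longrightarrow> w \<in> \<T>' p \<Longrightarrow> (\<lambda>x. u x + w x) \<in> \<T>' p"
    "\<And>c u. u \<in> \<T>' p \<Longrightarrow> (\<lambda>x. c * u x) \<in> \<T>' p"
    using cotangent_subspace by (auto simp: fun_subspace_def)
  note r = kvf_at[OF P_bivector] cotangent_subspace
  show "pi_N A P N p \<in> alternating_forms 2 (\<T>' p)"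
  proof (rule alternating_forms_2I)
    show "pi_N A P N p us = 0" if "\<not> (length us = 2 \<and> set us \<subseteq> \<T>' p)" for us
      using that unfolding pi_N_def by (rule if_not_P)
  next
    fix u w a assume V: "u \<in> \<T>' p" "w \<in> \<T>' p" "a \<in> \<T>' p"
    show "pi_N A P N p [\<lambda>x. u x + w x, a] = pi_N A P N p [u, a] + pi_N A P N p [w, a]"
      using V alternating2_add_left[OF r V(1,2) dual_cotangent[OF V(3)]]
      by (simp add: pi_N_sharp_form sub)
    show "pi_N A P N p [a, \<lambda>x. u x + w x] = pi_N A P N p [a, u] + pi_N A P N p [a, w]"
      using V by (simp add: pi_N_apply sub)
  next
    fix c u a assume V: "u \<in> \<T>' p" "a \<in> \<T>' p"
    show "pi_N A P N p [\<lambda>x. c * u x, a] = c * pi_N A P N p [u, a]"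
      using V alternating2_cmult_left[OF r V(1,1) dual_cotangent[OF V(2)]]
      by (simp add: pi_N_sharp_form sub)
    show "pi_N A P N p [a, \<lambda>x. c * u x] = c * pi_N A P N p [a, u]"
      using V by (simp add: pi_N_apply sub)
  next
    fix a assume a: "a \<in> \<T>' p"
    have "P p [N' p a, a] = - P p [a, N' p a]"
      using bivector_swap[OF P_bivector a dual_cotangent[OF a] a] .
    then show "pi_N A P N p [a, a] = 0" using pi_N_sharp_form[OF a a] pi_N_sharp_form'[OF a a] by simp
  qed
next
  fix \<alpha> \<beta> assume "\<alpha> \<in> one_forms A" "\<beta> \<in> one_forms A"
  then show "(\<lambda>p. pi_N A P N p [\<alpha> p, \<beta> p]) \<in> \<S>"
    using one_form_smooth[OF _ N_field[OF sharp_field[OF P_bivector]]] by (simp add: pi_N_apply one_form_at)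
qed

lemma pi_N_sharp: "\<alpha> \<in> \<T>' p \<Longrightarrow> sharp A (pi_N A P N) p \<alpha> = N p (K p \<alpha>)"
  by (rule sharp_eqI[OF pi_N_bivector]) (simp_all add: pi_N_apply N_tangent K_tangent)

lemma pbr_pi_N: "pbr (pi_N A P N) f g = (\<lambda>q. nham f q g)"
proof
  fix q
  have "N q (K q (differential f q)) \<in> \<T> q" by (intro N_tangent K_tangent) simp
  then show "pbr (pi_N A P N) f g q = nham f q g"
    by (simp add: pbr_def pi_N_apply nham_def ham_def)
qed

lemma jac_pi_N:
  assumes F: "f \<in> \<S>" "g \<in> \<S>" "h \<in> \<S>"
  shows "jac (pi_N A P N) (pi_N A P N) f g h p = 2 * \<phi> p [nham f p, nham g p, nham h p]"
proof -
  have "pbr (pi_N A P N) (pbr (pi_N A P N) k l) m p = - nham m p (\<lambda>q. nham k q l)"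
    if "k \<in> \<S>" "l \<in> \<S>" "m \<in> \<S>" for k l m
  proof -
    have "(\<lambda>q. nham k q l) \<in> \<S>" by (rule field_smooth[OF nham_field[OF that(1)] that(2)])
    then show ?thesis unfolding pbr_pi_N by (rule ham_skew(2)[OF that(3)])
  qed
  note this[OF F(1,2,3)] this[OF F(2,3,1)] this[OF F(3,1,2)]
  then show ?thesis unfolding jac_def using jacobiator_nham[OF F, of p] by simp
qed

end

theorem theorem5p3:
  fixes A :: "('m::{t2_space,second_countable_topology}, 'e::{real_inner,banach,heine_borel}) atlas"
    and B :: "nat \<Rightarrow> nat \<Rightarrow> 'm mvfield \<Rightarrow> 'm mvfield \<Rightarrow> 'm mvfield"
    and \<omega> \<phi> :: "'m form" and N :: "'m tensor11" and \<pi> :: "'m mvfield"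
  assumes "smooth_atlas A"
    and "schouten_bracket A B"
    and "pseudo_symplectic_nijenhuis A \<omega> N \<phi>"
    and "corresponding_2vector A \<omega> \<pi>"
  shows "twisted_poisson A B (pi_N A \<pi> N) \<phi>"
proof -
  interpret schouten A B by unfold_locales fact+
  note psn = assms(3)[unfolded pseudo_symplectic_nijenhuis_def]
  obtain \<pi>' where \<pi>': "corresponding_2vector A \<omega> \<pi>'" "compatible A \<pi>' N" using psn by blast
  have "\<pi>' = \<pi>" using corresponding_unique psn \<pi>'(1) assms(4) by blast
  then interpret pseudo_symplectic A \<omega> \<phi> N \<pi>
    using psn \<pi>' assms(4) by unfold_locales blast+
  let ?P = "pi_N A \<pi> N"
  have "1/2 * B 2 2 ?P ?P p \<alpha>s = sharp3 A ?P \<phi> p \<alpha>s" for p \<alpha>s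
  proof (cases "length \<alpha>s = 3 \<and> set \<alpha>s \<subseteq> \<T>' p")
    case True
    then obtain \<alpha> \<beta> \<gamma> where \<alpha>s: "\<alpha>s = [\<alpha>, \<beta>, \<gamma>]" by (auto simp: length_Suc_conv numeral_3_eq_3)
    with True have cov: "\<alpha> \<in> \<T>' p" "\<beta> \<in> \<T>' p" "\<gamma> \<in> \<T>' p" by auto
    obtain f where f: "f \<in> \<S>" "\<alpha> = differential f p" using covector_is_differential[OF cov(1)] .
    obtain g where g: "g \<in> \<S>" "\<beta> = differential g p" using covector_is_differential[OF cov(2)] .
    obtain h where h: "h \<in> \<S>" "\<gamma> = differential h p" using covector_is_differential[OF cov(3)] .
    have "B 2 2 ?P ?P p \<alpha>s = - jac ?P ?P f g h p"
      unfolding \<alpha>s f(2) g(2) h(2) by (rule schouten_eq_jac[OF pi_N_bivector pi_N_bivector f(1) g(1) h(1)])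
    also have "\<dots> = - 2 * \<phi> p [nham f p, nham g p, nham h p]"
      using jac_pi_N[OF f(1) g(1) h(1)] by simp
    finally show ?thesis
      by (simp add: sharp3_def \<alpha>s f(2) g(2) h(2) pi_N_sharp nham_def ham_def)
  next
    case False
    have "B 2 2 ?P ?P \<in> \<X> 3" using bracket_closed[OF pi_N_bivector pi_N_bivector] by simp
    then have "B 2 2 ?P ?P p \<alpha>s = 0" using alternating_outside[OF kvf_at False] by blast
    then show ?thesis using False by (auto simp: sharp3_def)
  qed
  then have "(\<lambda>p \<alpha>s. 1/2 * B 2 2 ?P ?P p \<alpha>s) = sharp3 A ?P \<phi>" by (intro ext)
  then show ?thesis
    unfolding twisted_poisson_def using pi_N_bivector \<phi>_form closed by blast
qed

end
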